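(* Let $(Y^\delta,X^\delta)_{\delta\in\Delta}$ be a family of closed subspaces of $Y\times X$ (i.e. $Y^\delta\subseteq Y$, $X^\delta\subseteq X$ closed) such that $$\gamma_\Delta:=\inf_{\delta\in\Delta}\ \inf_{\{u\in X^\delta\colon\partial_tu\neq0\}}\ \sup_{0\neq v\in Y^\delta}\frac{(\partial_tu)(v)}{\|\partial_tu\|_{Y'}\|v\|_Y}>0,$$ where the inner inf-sup is read as $1$ whenever $\{u\in X^\delta\colon\partial_tu\neq0\}=\emptyset$. Let $\rho=\rho_\Delta$ be the root in $[0,1)$ of $$\gamma_\Delta^2(\rho^2-\rho)+\|A_a\|_{\mathcal L(Y,Y')}^2(\rho-1)+\rho=0,$$ and let $$C_\Delta:=\frac{(3+\|A_a\|_{\mathcal L(Y,Y')}^2)(\sqrt3+\|A_a\|_{\mathcal L(Y,Y')})}{(1-\rho_\Delta)\gamma_\Delta^2},$$ so that $C_\Delta=3\sqrt3\,\gamma_\Delta^{-2}$ when $\|A_a\|_{\mathcal L(Y,Y')}=0$, and $\lim_{\|A_a\|_{\mathcal L(Y,Y')}\to\infty}C_\Delta=\infty$. Let $g\in Y'$, $u_0\in H$, let $(\lambda,u)\in Y\times X$ be the solution of the mixed system $$\begin{bmatrix} A_s & C\\ C' & -(A_s+\gamma_T'\gamma_T)\end{bmatrix}\begin{bmatrix}\lambda\\ u\end{bmatrix}=\begin{bmatrix} g\\ -(g+\gamma_0'u_0)\end{bmatrix}$$ (for which $\lambda=u$), and for $\delta\in\Delta$ let $(\lambda^\delta,u^\delta)\in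 Y^\delta\times X^\delta$ be the solution of its Galerkin discretization, i.e. for all $(v,w)\in Y^\delta\times X^\delta$, $$(A_s\lambda^\delta)(v)+(Cu^\delta)(v)=g(v),\qquad (Cw)(\lambda^\delta)-(A_su^\delta)(w)-\langle u^\delta(T),w(T)\rangle=-g(w)-\langle u_0,w(0)\rangle .$$ Then $$\sqrt{\|\lambda-\lambda^\delta\|_Y^2+\|u-u^\delta\|_X^2}\le C_\Delta\inf_{(\bar\lambda^\delta,\bar u^\delta)\in Y^\delta\times X^\delta}\sqrt{\|\lambda-\bar\lambda^\delta\|_Y^2+\|u-\bar u^\delta\|_X^2}.$$
   Context: All spaces are real. Let $V,H$ be separable Hilbert spaces (of functions on some spatial domain) with $V\hookrightarrow H$ densely and compactly; identify $H$ with its dual, giving the Gelfand triple $V\hookrightarrow H\simeq H'\hookrightarrow V'$. $\langle\cdot,\cdot\rangle$ denotes the scalar product on $H$ and also its continuous extension to the duality pairing on $V'\times V$; $\|\cdot\|$ is the norm on $H$. Let $T>0$ and $I:=(0,T)$. For a.e. $t\in I$, $a(t;\cdot,\cdot)$ is a bilinear form on $V\times V$ such that $t\mapsto a(t;\eta,\zeta)$ is measurable for all $\eta,\zeta\in V$, and, with constants independent of $t$, $|a(t;\eta,\zeta)|\lesssim\|\eta\|_V\|\zeta\|_V$ and $a(t;\eta,\eta)\gtrsim\|\eta\|_V^2$ for all $\eta,\zeta\in V$ and a.e. $t\in I$. Set $Y:=L_2(I;V)$ and $X:=L_2(I;V)\cap H^1(I;V')$. One has $X\hookrightarrow C(\bar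 I;H)$, and for $t\in\bar I$, $\gamma_t\colon X\to H$, $\gamma_tu:=u(t)=u(t,\cdot)$, is the bounded trace map. Define $A\colon Y\to Y'$, $(Au)(v):=\int_I a(t;u(t),v(t))\,dt$; $B\colon X\to Y'$, $(Bw)(v):=\int_I\langle\frac{dw}{dt}(t),v(t)\rangle+a(t;w(t),v(t))\,dt$; $A_s:=\frac12(A+A')$, $A_a:=\frac12(A-A')$; $C:=B-A_s$ and $\partial_t:=B-A$, both $X\to Y'$, so $(\partial_tw)(v)=\int_I\langle\frac{dw}{dt}(t),v(t)\rangle\,dt$. Primes on operators denote dual operators (e.g. $(C'v)(w)=(Cw)(v)$, $(\gamma_t'h)(w)=\langle h,w(t)\rangle$). Elements of $Y'$ are also viewed as elements of $X'$ by restriction to $X\subset Y$. The spaces $Y$ and $X$ are equipped with the energy norms $\|v\|_Y^2:=(A_sv)(v)$ and $\|u\|_X^2:=\|u\|_Y^2+\|\partial_tu\|_{Y'}^2+\|u(T)\|^2$ (equivalent to the standard norms), where $\|\cdot\|_{Y'}$ is the norm dual to $\|\cdot\|_Y$; $\|\cdot\|_{\mathcal L(Y,Y')}$ is the corresponding operator norm. *)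

theory Defs
  imports "HOL-Analysis.Analysis"
begin

text \<open>
  Conventions. The embedding of \<open>V\<close> into \<open>H\<close> is an explicit map \<open>j\<close>, and \<open>V'\<close> is the type
  \<open>'v \<Rightarrow>\<^sub>L real\<close>, so that the pairing of \<open>V'\<close> with \<open>V\<close> is application and \<open>h\<close> in \<open>H\<close> acts
  on \<open>V\<close> by \<open>\<lambda>\<eta>. h \<bullet> j \<eta>\<close>. Elements of Bochner spaces are represented by functions on
  \<open>real\<close>, of which only the values a.e. in \<open>{0<..<T}\<close> matter; norms on such spaces are therefore
  seminorms on functions, and equality of elements is equality a.e.
  Functionals on \<open>Y\<close> and operators into \<open>Y'\<close> are (curried) real-valued functions of
  representatives, only their values on \<open>Y\<close> being relevant.
\<close>

subsection \<open>The Gelfand triple and the bilinear forms\<close>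

definition gelfand_embedding ::
  "('v::{real_inner,banach,second_countable_topology} \<Rightarrow>
    'h::{real_inner,banach,second_countable_topology}) \<Rightarrow> bool" where
  "gelfand_embedding j \<longleftrightarrow>
     bounded_linear j \<and> inj j \<and> closure (range j) = UNIV \<and>
     (\<forall>S. bounded S \<longrightarrow> compact (closure (j ` S)))"

definition admissible_form ::
  "real \<Rightarrow> (real \<Rightarrow> 'v::{real_inner,banach,second_countable_topology} \<Rightarrow> 'v \<Rightarrow> real) \<Rightarrow> bool" where
  "admissible_form T a \<longleftrightarrow>
     (AE t in lebesgue_on {0<..<T}. bilinear (a t)) \<and>
     (\<forall>\<eta> \<zeta>. (\<lambda>t. a t \<eta> \<zeta>) \<in> borel_measurable (lebesgue_on {0<..<T})) \<and>
     (\<exists>M. AE t in lebesgue_on {0<..<T}. \<forall>\<eta> \<zeta>. \<bar>a t \<eta> \<zeta>\<bar> \<le> M * norm \<eta> * norm \<zeta>) \<and>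
     (\<exists>c>0. AE t in lebesgue_on {0<..<T}. \<forall>\<eta>. c * (norm \<eta>)\<^sup>2 \<le> a t \<eta> \<eta>)"

subsection \<open>Function spaces\<close>

text \<open>
  For a separable Banach space \<open>'b\<close>, Borel measurability is the same as strong (Bochner)
  measurability. It is used for \<open>V\<close> and for \<open>V'\<close>, the latter being separable since \<open>V\<close> is a
  separable Hilbert space.
\<close>

definition L2 :: "real \<Rightarrow> (real \<Rightarrow> 'b::real_normed_vector) set" where
  "L2 T = {f. f \<in> borel_measurable (lebesgue_on {0<..<T}) \<and>
              integrable (lebesgue_on {0<..<T}) (\<lambda>t. (norm (f t))\<^sup>2)}"

definition test_functions :: "real \<Rightarrow> (real \<Rightarrow> real) set" where
  "test_functions T = {\<phi>. (\<forall>n t. ((deriv ^^ n) \<phi>) differentiable (at t)) \<and>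
     (\<exists>K. compact K \<and> K \<subseteq> {0<..<T} \<and> (\<forall>t. t \<notin> K \<longrightarrow> \<phi> t = 0))}"

text \<open>
  \<open>w\<close> is the distributional derivative of \<open>u\<close> as a \<open>V'\<close>-valued function: the identity
  \<open>\<integral> \<phi>' u dt = - \<integral> \<phi> w dt\<close> in \<open>V'\<close>, evaluated at every \<open>\<eta>\<close> in \<open>V\<close> (evaluation commutes with
  the \<open>V'\<close>-valued integral, which the library does not provide for the type \<open>'v \<Rightarrow>\<^sub>L real\<close>).
\<close>

definition is_weak_deriv ::
  "real \<Rightarrow> ('v::{real_inner,banach,second_countable_topology} \<Rightarrow>
    'h::{real_inner,banach,second_countable_topology}) \<Rightarrow>
   (real \<Rightarrow> 'v) \<Rightarrow> (real \<Rightarrow> 'v \<Rightarrow>\<^sub>L real) \<Rightarrow> bool" where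
  "is_weak_deriv T j u w \<longleftrightarrow> (\<forall>\<phi>\<in>test_functions T. \<forall>\<eta>.
     (LINT t|lebesgue_on {0<..<T}. deriv \<phi> t * (j (u t) \<bullet> j \<eta>)) =
     - (LINT t|lebesgue_on {0<..<T}. \<phi> t * blinfun_apply (w t) \<eta>))"

definition wderiv ::
  "real \<Rightarrow> ('v::{real_inner,banach,second_countable_topology} \<Rightarrow>
    'h::{real_inner,banach,second_countable_topology}) \<Rightarrow>
   (real \<Rightarrow> 'v) \<Rightarrow> real \<Rightarrow> 'v \<Rightarrow>\<^sub>L real" where
  "wderiv T j u = (SOME w. w \<in> L2 T \<and> is_weak_deriv T j u w)"

abbreviation Yspace :: "real \<Rightarrow> (real \<Rightarrow> 'v::{real_inner,banach,second_countable_topology}) set" where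
  "Yspace T \<equiv> L2 T"

definition Xspace ::
  "real \<Rightarrow> ('v::{real_inner,banach,second_countable_topology} \<Rightarrow>
    'h::{real_inner,banach,second_countable_topology}) \<Rightarrow> (real \<Rightarrow> 'v) set" where
  "Xspace T j = {u \<in> L2 T. \<exists>w\<in>L2 T. is_weak_deriv T j u w}"

text \<open>
  The trace at \<open>t\<close> in \<open>{0..T}\<close> is the value at \<open>t\<close> of the continuous \<open>H\<close>-valued
  representative; note that \<open>j (u t)\<close> itself depends on the representative \<open>u\<close>.
\<close>

definition trace ::
  "real \<Rightarrow> ('v::{real_inner,banach,second_countable_topology} \<Rightarrow>
    'h::{real_inner,banach,second_countable_topology}) \<Rightarrow> real \<Rightarrow> (real \<Rightarrow> 'v) \<Rightarrow> 'h" where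
  "trace T j t u = (THE h. \<exists>c. continuous_on {0..T} c \<and>
     (AE s in lebesgue_on {0<..<T}. c s = j (u s)) \<and> c t = h)"

subsection \<open>Operators\<close>

definition Aop ::
  "real \<Rightarrow> (real \<Rightarrow> 'v::{real_inner,banach,second_countable_topology} \<Rightarrow> 'v \<Rightarrow> real) \<Rightarrow>
   (real \<Rightarrow> 'v) \<Rightarrow> (real \<Rightarrow> 'v) \<Rightarrow> real" where
  "Aop T a u v = (LINT t|lebesgue_on {0<..<T}. a t (u t) (v t))"

definition Bop ::
  "real \<Rightarrow> ('v::{real_inner,banach,second_countable_topology} \<Rightarrow>
    'h::{real_inner,banach,second_countable_topology}) \<Rightarrow>
   (real \<Rightarrow> 'v \<Rightarrow> 'v \<Rightarrow> real) \<Rightarrow> (real \<Rightarrow> 'v) \<Rightarrow> (real \<Rightarrow> 'v) \<Rightarrow> real" where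
  "Bop T j a w v = (LINT t|lebesgue_on {0<..<T}.
     blinfun_apply (wderiv T j w t) (v t) + a t (w t) (v t))"

definition dual_op :: "('p \<Rightarrow> 'q \<Rightarrow> real) \<Rightarrow> 'q \<Rightarrow> 'p \<Rightarrow> real" where
  "dual_op F q p = F p q"

definition As ::
  "real \<Rightarrow> (real \<Rightarrow> 'v::{real_inner,banach,second_countable_topology} \<Rightarrow> 'v \<Rightarrow> real) \<Rightarrow>
   (real \<Rightarrow> 'v) \<Rightarrow> (real \<Rightarrow> 'v) \<Rightarrow> real" where
  "As T a u v = (Aop T a u v + dual_op (Aop T a) u v) / 2"

definition Aa ::
  "real \<Rightarrow> (real \<Rightarrow> 'v::{real_inner,banach,second_countable_topology} \<Rightarrow> 'v \<Rightarrow> real) \<Rightarrow>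
   (real \<Rightarrow> 'v) \<Rightarrow> (real \<Rightarrow> 'v) \<Rightarrow> real" where
  "Aa T a u v = (Aop T a u v - dual_op (Aop T a) u v) / 2"

definition Cop ::
  "real \<Rightarrow> ('v::{real_inner,banach,second_countable_topology} \<Rightarrow>
    'h::{real_inner,banach,second_countable_topology}) \<Rightarrow>
   (real \<Rightarrow> 'v \<Rightarrow> 'v \<Rightarrow> real) \<Rightarrow> (real \<Rightarrow> 'v) \<Rightarrow> (real \<Rightarrow> 'v) \<Rightarrow> real" where
  "Cop T j a w v = Bop T j a w v - As T a w v"

definition dt ::
  "real \<Rightarrow> ('v::{real_inner,banach,second_countable_topology} \<Rightarrow>
    'h::{real_inner,banach,second_countable_topology}) \<Rightarrow>
   (real \<Rightarrow> 'v \<Rightarrow> 'v \<Rightarrow> real) \<Rightarrow> (real \<Rightarrow> 'v) \<Rightarrow> (real \<Rightarrow> 'v) \<Rightarrow> real" where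
  "dt T j a w v = Bop T j a w v - Aop T a w v"

subsection \<open>Energy norms\<close>

definition normY ::
  "real \<Rightarrow> (real \<Rightarrow> 'v::{real_inner,banach,second_countable_topology} \<Rightarrow> 'v \<Rightarrow> real) \<Rightarrow>
   (real \<Rightarrow> 'v) \<Rightarrow> real" where
  "normY T a v = sqrt (As T a v v)"

definition dual_space ::
  "real \<Rightarrow> (real \<Rightarrow> 'v::{real_inner,banach,second_countable_topology} \<Rightarrow> 'v \<Rightarrow> real) \<Rightarrow>
   ((real \<Rightarrow> 'v) \<Rightarrow> real) set" where
  "dual_space T a = {g.
     (\<forall>u\<in>Yspace T. \<forall>v\<in>Yspace T. g (\<lambda>t. u t + v t) = g u + g v) \<and>
     (\<forall>r. \<forall>v\<in>Yspace T. g (\<lambda>t. r *\<^sub>R v t) = r * g v) \<and>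
     (\<exists>K. \<forall>v\<in>Yspace T. \<bar>g v\<bar> \<le> K * normY T a v)}"

definition dual_norm ::
  "real \<Rightarrow> (real \<Rightarrow> 'v::{real_inner,banach,second_countable_topology} \<Rightarrow> 'v \<Rightarrow> real) \<Rightarrow>
   ((real \<Rightarrow> 'v) \<Rightarrow> real) \<Rightarrow> real" where
  "dual_norm T a g = (SUP v\<in>{v\<in>Yspace T. normY T a v \<le> 1}. \<bar>g v\<bar>)"

definition op_norm ::
  "real \<Rightarrow> (real \<Rightarrow> 'v::{real_inner,banach,second_countable_topology} \<Rightarrow> 'v \<Rightarrow> real) \<Rightarrow>
   ((real \<Rightarrow> 'v) \<Rightarrow> (real \<Rightarrow> 'v) \<Rightarrow> real) \<Rightarrow> real" where
  "op_norm T a F = (SUP v\<in>{v\<in>Yspace T. normY T a v \<le> 1}. dual_norm T a (F v))"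

definition normX ::
  "real \<Rightarrow> ('v::{real_inner,banach,second_countable_topology} \<Rightarrow>
    'h::{real_inner,banach,second_countable_topology}) \<Rightarrow>
   (real \<Rightarrow> 'v \<Rightarrow> 'v \<Rightarrow> real) \<Rightarrow> (real \<Rightarrow> 'v) \<Rightarrow> real" where
  "normX T j a u = sqrt ((normY T a u)\<^sup>2 + (dual_norm T a (dt T j a u))\<^sup>2 + (norm (trace T j T u))\<^sup>2)"

definition norm_YX ::
  "real \<Rightarrow> ('v::{real_inner,banach,second_countable_topology} \<Rightarrow>
    'h::{real_inner,banach,second_countable_topology}) \<Rightarrow>
   (real \<Rightarrow> 'v \<Rightarrow> 'v \<Rightarrow> real) \<Rightarrow> (real \<Rightarrow> 'v) \<Rightarrow> (real \<Rightarrow> 'v) \<Rightarrow> real" where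
  "norm_YX T j a v w = sqrt ((normY T a v)\<^sup>2 + (normX T j a w)\<^sup>2)"

text \<open>
  Closed linear subspaces of \<open>Z\<close> with respect to the seminorm \<open>N\<close>. Closedness makes \<open>S\<close>
  invariant under changing representatives, so these correspond exactly to the closed subspaces of
  the associated normed space of equivalence classes.
\<close>

definition closed_subspace ::
  "((real \<Rightarrow> 'v::real_vector) \<Rightarrow> real) \<Rightarrow> (real \<Rightarrow> 'v) set \<Rightarrow> (real \<Rightarrow> 'v) set \<Rightarrow> bool" where
  "closed_subspace N Z S \<longleftrightarrow> S \<subseteq> Z \<and>
     (\<lambda>t. 0) \<in> S \<and>
     (\<forall>u\<in>S. \<forall>v\<in>S. (\<lambda>t. u t + v t) \<in> S) \<and>
     (\<forall>r. \<forall>u\<in>S. (\<lambda>t. r *\<^sub>R u t) \<in> S) \<and>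
     (\<forall>s. \<forall>u\<in>Z. (\<forall>n. s n \<in> S) \<longrightarrow> (\<lambda>n. N (\<lambda>t. s n t - u t)) \<longlonglongrightarrow> 0 \<longrightarrow> u \<in> S)"

subsection \<open>The inf-sup constant and the quasi-optimality constant\<close>

text \<open>
  The infima and suprema are taken in \<open>ereal\<close>, where the supremum over the empty set (the case
  \<open>Y\<^sup>\<delta> = {0}\<close>) is minus infinity.
\<close>

definition gamma_inf_sup ::
  "real \<Rightarrow> ('v::{real_inner,banach,second_countable_topology} \<Rightarrow>
    'h::{real_inner,banach,second_countable_topology}) \<Rightarrow>
   (real \<Rightarrow> 'v \<Rightarrow> 'v \<Rightarrow> real) \<Rightarrow>
   'd set \<Rightarrow> ('d \<Rightarrow> (real \<Rightarrow> 'v) set) \<Rightarrow> ('d \<Rightarrow> (real \<Rightarrow> 'v) set) \<Rightarrow> ereal" where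
  "gamma_inf_sup T j a \<Delta> Yd Xd = (INF \<delta>\<in>\<Delta>.
     let U = {u \<in> Xd \<delta>. \<exists>v\<in>Yspace T. dt T j a u v \<noteq> 0} in
     if U = {} then 1
     else (INF u\<in>U. SUP v\<in>{v \<in> Yd \<delta>. \<not> (AE t in lebesgue_on {0<..<T}. v t = 0)}.
             ereal (dt T j a u v / (dual_norm T a (dt T j a u) * normY T a v))))"

definition rho_root :: "real \<Rightarrow> real \<Rightarrow> real" where
  "rho_root \<gamma> \<alpha> = (THE \<rho>. 0 \<le> \<rho> \<and> \<rho> < 1 \<and>
     \<gamma>\<^sup>2 * (\<rho>\<^sup>2 - \<rho>) + \<alpha>\<^sup>2 * (\<rho> - 1) + \<rho> = 0)"

definition C_const :: "real \<Rightarrow> real \<Rightarrow> real" where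
  "C_const \<gamma> \<alpha> = (3 + \<alpha>\<^sup>2) * (sqrt 3 + \<alpha>) / ((1 - rho_root \<gamma> \<alpha>) * \<gamma>\<^sup>2)"

subsection \<open>The mixed system and its Galerkin discretization\<close>

definition mixed_solution ::
  "real \<Rightarrow> ('v::{real_inner,banach,second_countable_topology} \<Rightarrow>
    'h::{real_inner,banach,second_countable_topology}) \<Rightarrow>
   (real \<Rightarrow> 'v \<Rightarrow> 'v \<Rightarrow> real) \<Rightarrow> ((real \<Rightarrow> 'v) \<Rightarrow> real) \<Rightarrow> 'h \<Rightarrow>
   (real \<Rightarrow> 'v) \<Rightarrow> (real \<Rightarrow> 'v) \<Rightarrow> bool" where
  "mixed_solution T j a g u0 l u \<longleftrightarrow> l \<in> Yspace T \<and> u \<in> Xspace T j \<and>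
     (\<forall>v\<in>Yspace T. As T a l v + Cop T j a u v = g v) \<and>
     (\<forall>w\<in>Xspace T j.
        dual_op (Cop T j a) l w - (As T a u w + trace T j T u \<bullet> trace T j T w)
        = - (g w + u0 \<bullet> trace T j 0 w))"

definition galerkin_solution ::
  "real \<Rightarrow> ('v::{real_inner,banach,second_countable_topology} \<Rightarrow>
    'h::{real_inner,banach,second_countable_topology}) \<Rightarrow>
   (real \<Rightarrow> 'v \<Rightarrow> 'v \<Rightarrow> real) \<Rightarrow> ((real \<Rightarrow> 'v) \<Rightarrow> real) \<Rightarrow> 'h \<Rightarrow>
   (real \<Rightarrow> 'v) set \<Rightarrow> (real \<Rightarrow> 'v) set \<Rightarrow>
   (real \<Rightarrow> 'v) \<Rightarrow> (real \<Rightarrow> 'v) \<Rightarrow> bool" where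
  "galerkin_solution T j a g u0 Ys Xs l u \<longleftrightarrow> l \<in> Ys \<and> u \<in> Xs \<and>
     (\<forall>v\<in>Ys. \<forall>w\<in>Xs.
        As T a l v + Cop T j a u v = g v \<and>
        Cop T j a w l - As T a u w - trace T j T u \<bullet> trace T j T w
        = - g w - u0 \<bullet> trace T j 0 w)"

end

theory Submission
  imports Defs
begin

text \<open>
  The theorem has two parts of different nature: the identity \<open>\<lambda> = u\<close>, and the quasi-optimality of the
  discretization with the explicit constant.

  For the first part, let \<open>e = \<lambda> - u\<close>. Testing both equations of the system with the same \<open>w\<close> in \<open>X\<close> and
  integrating by parts shows that \<open>e\<close> solves the backward problem with right-hand side zero. Hence \<open>e\<close>
  has a weak derivative, vanishes at \<open>T\<close>, and its energy balance reads
  \<open>\<parallel>e\<parallel>\<^sup>2 = - \<parallel>e(0)\<parallel>\<^sup>2 / 2\<close>, with the norms of \<open>Y\<close> and \<open>H\<close>, so that \<open>e = 0\<close>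
  (\<open>mixed_solution_multiplier\<close>). Existence for parabolic problems is not used.

  This argument needs the trace theorem for \<open>X\<close>. The Riesz isomorphism turns \<open>V'\<close>-valued functions into
  \<open>V\<close>-valued ones and the embedding into the operator \<open>K = j' j\<close> on \<open>V\<close>; then \<open>u\<close> lies in \<open>X\<close> only if \<open>K u\<close> is
  a.e. an indefinite integral \<open>W\<close> (\<open>gram_primitive\<close>). For a bounded self-adjoint \<open>L\<close> the product rule for
  \<open>L W \<bullet> W\<close> is Fubini's theorem (\<open>quadratic_form_cumint\<close>). To recover \<open>u\<close> from \<open>W\<close> let \<open>N = 1 - \<kappa> K\<close>
  with \<open>\<kappa>\<close> so small that \<open>0 \<le> N \<le> 1\<close>. The sums \<open>\<kappa> (1 + N + \<dots> + N\<^sup>n\<^sup>-\<^sup>1)\<close> are bounded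
  operators that send \<open>W = K u\<close> to \<open>u - N\<^sup>n u\<close>, and \<open>N\<^sup>n\<close> tends to zero strongly because \<open>K\<close> is injective.
  The product rule shows that these continuous approximations of \<open>u\<close> form a uniform Cauchy sequence in \<open>H\<close>, and it
  passes to the limit (\<open>continuous_representative\<close>, \<open>integration_by_parts\<close>).

  For the second part, put \<open>\<alpha> = \<parallel>A\<^sub>a\<parallel>\<close> and \<open>\<mu> = (1 - \<rho>) \<gamma>\<^sup>2\<close>. Eliminating the multiplier from the
  discrete system leaves the form \<open>\<parallel>C u\<parallel>\<^sup>2 + \<parallel>u\<parallel>\<^sup>2 + \<parallel>u(T)\<parallel>\<^sup>2\<close>, with the first norm taken in the dual of
  \<open>Y\<^sup>\<delta>\<close>. Since \<open>C = \<partial>\<^sub>t + A\<^sub>a\<close>, the inf-sup condition and Young's inequality with weight \<open>\<rho>\<close> bound it below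
  by \<open>\<mu>\<close> times the squared norm of \<open>X\<close> (\<open>schur_coercive\<close>). So the inverse of the discrete system has norm at
  most \<open>(3 + \<alpha>\<^sup>2) / \<mu>\<close>, the system itself is bounded by \<open>\<surd>3 + \<alpha>\<close>, and the Galerkin projection is bounded
  by the product of the two (\<open>discrete_stability\<close>). The error is the complementary projection of the error
  of any competitor. In a Hilbert norm complementary projections have equal norm, which saves the
  additional \<open>1\<close> of the usual estimate (\<open>kato_projection\<close>, \<open>galerkin_quasi_optimal\<close>).

  That the norm of \<open>X\<close> is a Hilbert norm is due to the dual norm of a semi-inner product being quadratic
  (\<open>fnorm_comb_sq\<close>). No completeness of \<open>L\<^sub>2(I; V)\<close> or of its subspaces is used: wherever a functional
  would be represented by a vector, an almost representing vector suffices
  (\<open>almost_representer\<close>).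
\<close>

section \<open>Semi-inner products and their dual norms\<close>

lemma quadratic_nonneg_discrim:
  fixes a b c :: real
  assumes "\<And>s. 0 \<le> a + 2 * s * b + s\<^sup>2 * c" and "0 \<le> c"
  shows "b\<^sup>2 \<le> a * c"
proof (cases "c = 0")
  case True
  have "b = 0"
  proof (rule ccontr)
    assume "b \<noteq> 0"
    then show False using assms(1)[of "- (a + 1) / (2 * b)"] True by (simp add: field_simps)
  qed
  then show ?thesis using True by simp
next
  case False
  then have "c > 0" using assms(2) by simp
  then show ?thesis using assms(1)[of "- b / c"]
    by (simp add: field_simps power2_eq_square)
qed

text \<open>
  A symmetric positive semidefinite form \<open>ip\<close> on a set \<open>Y\<close> that is closed under an addition and a
  scalar multiplication. The operations are parameters, because the spaces below consist of functions
  on the real line with pointwise operations, and neither definiteness nor completeness is assumed.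
\<close>

locale semi_ip =
  fixes Y :: "'f set" and add :: "'f \<Rightarrow> 'f \<Rightarrow> 'f" and smul :: "real \<Rightarrow> 'f \<Rightarrow> 'f"
    and ip :: "'f \<Rightarrow> 'f \<Rightarrow> real"
  assumes nonempty: "Y \<noteq> {}"
    and add_mem: "u \<in> Y \<Longrightarrow> v \<in> Y \<Longrightarrow> add u v \<in> Y"
    and smul_mem: "u \<in> Y \<Longrightarrow> smul r u \<in> Y"
    and ip_add: "u \<in> Y \<Longrightarrow> v \<in> Y \<Longrightarrow> w \<in> Y \<Longrightarrow> ip (add u v) w = ip u w + ip v w"
    and ip_smul: "u \<in> Y \<Longrightarrow> v \<in> Y \<Longrightarrow> ip (smul r u) v = r * ip u v"
    and ip_sym: "u \<in> Y \<Longrightarrow> v \<in> Y \<Longrightarrow> ip u v = ip v u"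
    and ip_nonneg: "u \<in> Y \<Longrightarrow> 0 \<le> ip u u"
begin

definition nrm :: "'f \<Rightarrow> real" where "nrm u = sqrt (ip u u)"

text \<open>
  Bounded linear functionals on \<open>Y\<close>; only their values on \<open>Y\<close> matter.
\<close>

definition is_functional :: "('f \<Rightarrow> real) \<Rightarrow> bool" where
  "is_functional f \<longleftrightarrow> (\<forall>u\<in>Y. \<forall>v\<in>Y. f (add u v) = f u + f v) \<and>
     (\<forall>r. \<forall>u\<in>Y. f (smul r u) = r * f u) \<and> (\<exists>K. \<forall>u\<in>Y. \<bar>f u\<bar> \<le> K * nrm u)"

definition fnorm :: "('f \<Rightarrow> real) \<Rightarrow> real" where
  "fnorm f = (SUP u\<in>{u\<in>Y. nrm u \<le> 1}. \<bar>f u\<bar>)"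

lemma nrm_nonneg: "u \<in> Y \<Longrightarrow> 0 \<le> nrm u"
  by (simp add: nrm_def ip_nonneg)

lemma nrm_sq: "u \<in> Y \<Longrightarrow> (nrm u)\<^sup>2 = ip u u"
  by (simp add: nrm_def ip_nonneg)

lemma ip_add_right: "u \<in> Y \<Longrightarrow> v \<in> Y \<Longrightarrow> w \<in> Y \<Longrightarrow> ip w (add u v) = ip w u + ip w v"
  by (metis add_mem ip_add ip_sym)

lemma ip_smul_right: "u \<in> Y \<Longrightarrow> v \<in> Y \<Longrightarrow> ip u (smul r v) = r * ip u v"
  by (metis smul_mem ip_smul ip_sym)

lemma nrm_smul: "u \<in> Y \<Longrightarrow> nrm (smul r u) = \<bar>r\<bar> * nrm u"
  by (simp add: nrm_def ip_smul ip_smul_right smul_mem real_sqrt_mult flip: mult.assoc)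

lemma nrm_comb_sq:
  assumes "u \<in> Y" "v \<in> Y"
  shows "(nrm (add (smul r u) (smul s v)))\<^sup>2 = r\<^sup>2 * (nrm u)\<^sup>2 + 2 * (r * s) * ip u v + s\<^sup>2 * (nrm v)\<^sup>2"
  using assms
  by (simp add: nrm_sq add_mem smul_mem ip_add ip_add_right ip_smul ip_smul_right ip_sym[of v u])
    (simp add: power2_eq_square algebra_simps)

lemma ip_cauchy_schwarz:
  assumes "u \<in> Y" "v \<in> Y"
  shows "\<bar>ip u v\<bar> \<le> nrm u * nrm v"
proof -
  have "(ip u v)\<^sup>2 \<le> (nrm u)\<^sup>2 * (nrm v)\<^sup>2"
  proof (rule quadratic_nonneg_discrim)
    show "0 \<le> (nrm u)\<^sup>2 + 2 * s * ip u v + s\<^sup>2 * (nrm v)\<^sup>2" for s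
      using nrm_comb_sq[OF assms, of 1 s] by (metis mult_1 one_power2 zero_le_power2)
  qed simp
  then show ?thesis
    using assms nrm_nonneg by (metis abs_le_square_iff abs_mult abs_of_nonneg power_mult_distrib)
qed

lemma zero_mem: "\<exists>z\<in>Y. nrm z = 0"
proof -
  obtain u where "u \<in> Y" using nonempty by blast
  then show ?thesis using nrm_smul[of u 0] smul_mem by force
qed

lemma
  assumes f: "is_functional f"
  shows functional_bound: "u \<in> Y \<Longrightarrow> \<bar>f u\<bar> \<le> fnorm f * nrm u"
    and fnorm_nonneg: "0 \<le> fnorm f"
    and fnorm_least: "0 \<le> c \<Longrightarrow> (\<And>u. u \<in> Y \<Longrightarrow> \<bar>f u\<bar> \<le> c * nrm u) \<Longrightarrow> fnorm f \<le> c"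
proof -
  obtain K where K: "\<And>u. u \<in> Y \<Longrightarrow> \<bar>f u\<bar> \<le> K * nrm u"
    using f unfolding is_functional_def by blast
  have bdd: "bdd_above ((\<lambda>u. \<bar>f u\<bar>) ` {u \<in> Y. nrm u \<le> 1})"
  proof (rule bdd_aboveI2)
    fix u assume u: "u \<in> {u \<in> Y. nrm u \<le> 1}"
    then have "\<bar>f u\<bar> \<le> \<bar>K\<bar> * nrm u"
      using K[of u] mult_right_mono[OF abs_ge_self[of K] nrm_nonneg[of u]] by simp
    also have "\<dots> \<le> \<bar>K\<bar> * 1" using u by (intro mult_left_mono) auto
    finally show "\<bar>f u\<bar> \<le> \<bar>K\<bar>" by simp
  qed
  have le: "\<bar>f u\<bar> \<le> fnorm f" if "u \<in> Y" "nrm u \<le> 1" for u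
    unfolding fnorm_def using that by (intro cSUP_upper bdd) auto
  show "0 \<le> fnorm f" using zero_mem le by fastforce
  show "\<bar>f u\<bar> \<le> fnorm f * nrm u" if u: "u \<in> Y"
  proof (cases "nrm u = 0")
    case True
    then show ?thesis using K[OF u] by simp
  next
    case False
    then have pos: "nrm u > 0" using nrm_nonneg[OF u] by simp
    have "\<bar>f (smul (1 / nrm u) u)\<bar> \<le> fnorm f"
      using u pos by (intro le) (auto simp: smul_mem nrm_smul)
    then show ?thesis
      using f u pos by (simp add: is_functional_def field_simps abs_mult)
  qed
  show "fnorm f \<le> c" if "0 \<le> c" "\<And>u. u \<in> Y \<Longrightarrow> \<bar>f u\<bar> \<le> c * nrm u"
    unfolding fnorm_def
  proof (rule cSUP_least)
    show "{u \<in> Y. nrm u \<le> 1} \<noteq> {}" using zero_mem by force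
    fix u assume u: "u \<in> {u \<in> Y. nrm u \<le> 1}"
    then have "c * nrm u \<le> c * 1" using that(1) by (intro mult_left_mono) auto
    then show "\<bar>f u\<bar> \<le> c" using that(2)[of u] u by simp
  qed
qed

lemma almost_representer_nrm:
  assumes f: "is_functional f" and z: "z \<in> Y" and e: "0 \<le> e"
    and close: "\<And>v. v \<in> Y \<Longrightarrow> \<bar>f v - ip z v\<bar> \<le> e * nrm v"
  shows "\<bar>nrm z - fnorm f\<bar> \<le> e"
proof -
  have "fnorm f \<le> nrm z + e"
  proof (rule fnorm_least[OF f])
    show "0 \<le> nrm z + e" using nrm_nonneg[OF z] e by simp
    fix u assume u: "u \<in> Y"
    have "\<bar>f u\<bar> \<le> \<bar>ip z u\<bar> + e * nrm u" using close[OF u] by linarith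
    then show "\<bar>f u\<bar> \<le> (nrm z + e) * nrm u"
      using ip_cauchy_schwarz[OF z u] by (simp add: algebra_simps)
  qed
  moreover have "nrm z \<le> fnorm f + e"
  proof (cases "nrm z = 0")
    case True
    then show ?thesis using fnorm_nonneg[OF f] e by simp
  next
    case False
    have "nrm z * nrm z \<le> f z + e * nrm z"
      using close[OF z] nrm_sq[OF z] by (simp add: power2_eq_square abs_le_iff)
    also have "\<dots> \<le> (fnorm f + e) * nrm z"
      using functional_bound[OF f z] by (simp add: algebra_simps)
    finally show ?thesis using False nrm_nonneg[OF z] by simp
  qed
  ultimately show ?thesis by (simp add: abs_le_iff)
qed

text \<open>
  A substitute for the Riesz representation that needs no completeness: a point at which
  \<open>2 * f u - ip u u\<close> is close to its supremum almost represents \<open>f\<close>.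
\<close>

lemma almost_representer:
  assumes f: "is_functional f" and e: "0 < e"
  shows "\<exists>z\<in>Y. (\<forall>v\<in>Y. \<bar>f v - ip z v\<bar> \<le> e * nrm v) \<and> \<bar>nrm z - fnorm f\<bar> \<le> e"
proof -
  have lin: "f (add u v) = f u + f v" "f (smul r u) = r * f u" if "u \<in> Y" "v \<in> Y" for u v r
    using f that by (auto simp: is_functional_def)
  define J where "J u = 2 * f u - ip u u" for u
  have Jle: "J u \<le> (fnorm f)\<^sup>2" if "u \<in> Y" for u
  proof -
    have "2 * f u \<le> 2 * (fnorm f * nrm u)" using functional_bound[OF f that] by linarith
    also have "\<dots> \<le> (fnorm f)\<^sup>2 + (nrm u)\<^sup>2" using sum_squares_bound[of "fnorm f" "nrm u"] by simp
    finally show ?thesis using nrm_sq[OF that] by (simp add: J_def)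
  qed
  have bdd: "bdd_above (J ` Y)" using Jle by (auto intro!: bdd_aboveI2)
  have "(SUP u\<in>Y. J u) - e\<^sup>2 < (SUP u\<in>Y. J u)" using e by simp
  then obtain z where z: "z \<in> Y" "(SUP u\<in>Y. J u) - e\<^sup>2 < J z"
    using less_cSUP_iff[OF nonempty bdd] by blast
  have Jz: "J u \<le> J z + e\<^sup>2" if "u \<in> Y" for u
    using cSUP_upper[OF that bdd] z by linarith
  have main: "\<bar>f v - ip z v\<bar> \<le> e * nrm v" if v: "v \<in> Y" for v
  proof -
    \<comment> \<open>near-maximality of \<open>z\<close> along the line through \<open>z\<close> with direction \<open>v\<close>\<close>
    have *: "0 \<le> e\<^sup>2 + 2 * s * (ip z v - f v) + s\<^sup>2 * (nrm v)\<^sup>2" for s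
    proof -
      have "J (add z (smul s v)) = J z + 2 * s * (f v - ip z v) - s\<^sup>2 * (nrm v)\<^sup>2"
        using z(1) v by (simp add: J_def lin smul_mem add_mem ip_add ip_add_right ip_smul
            ip_smul_right ip_sym[of v z] nrm_sq) (simp add: power2_eq_square algebra_simps)
      then show ?thesis using Jz[of "add z (smul s v)"] z(1) v
        by (simp add: add_mem smul_mem algebra_simps)
    qed
    have "(ip z v - f v)\<^sup>2 \<le> e\<^sup>2 * (nrm v)\<^sup>2"
      by (rule quadratic_nonneg_discrim[OF *]) simp
    then have "\<bar>ip z v - f v\<bar> \<le> \<bar>e * nrm v\<bar>"
      by (metis abs_le_square_iff power_mult_distrib)
    then show ?thesis using e nrm_nonneg[OF v] by (simp add: abs_minus_commute)
  qed
  show ?thesis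
    using z(1) main almost_representer_nrm[OF f z(1) less_imp_le[OF e] main] by blast
qed

lemma representing_sequence:
  assumes f: "is_functional f"
  obtains z where "\<And>n. z n \<in> Y" "\<And>n v. v \<in> Y \<Longrightarrow> \<bar>f v - ip (z n) v\<bar> \<le> nrm v / real (Suc n)"
    "(\<lambda>n. nrm (z n)) \<longlonglongrightarrow> fnorm f" "\<And>v. v \<in> Y \<Longrightarrow> (\<lambda>n. ip (z n) v) \<longlonglongrightarrow> f v"
proof -
  have "\<exists>z. \<forall>n. z n \<in> Y \<and> (\<forall>v\<in>Y. \<bar>f v - ip (z n) v\<bar> \<le> (1 / real (Suc n)) * nrm v) \<and>
      \<bar>nrm (z n) - fnorm f\<bar> \<le> 1 / real (Suc n)"
  proof (rule choice, rule allI)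
    fix n
    have "0 < 1 / real (Suc n)" by simp
    from almost_representer[OF f this]
    show "\<exists>z. z \<in> Y \<and> (\<forall>v\<in>Y. \<bar>f v - ip z v\<bar> \<le> (1 / real (Suc n)) * nrm v) \<and>
      \<bar>nrm z - fnorm f\<bar> \<le> 1 / real (Suc n)" by blast
  qed
  then obtain z where z: "\<And>n. z n \<in> Y" "\<And>n v. v \<in> Y \<Longrightarrow> \<bar>f v - ip (z n) v\<bar> \<le> nrm v / real (Suc n)"
    "\<And>n. \<bar>nrm (z n) - fnorm f\<bar> \<le> 1 / real (Suc n)" by force
  have lim: "(\<lambda>n. c / real (Suc n)) \<longlonglongrightarrow> 0" for c :: real
    using tendsto_mult[OF tendsto_const[of c] LIMSEQ_inverse_real_of_nat] by (simp add: divide_inverse)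
  show ?thesis
  proof (rule that)
    show "z n \<in> Y" for n by (rule z)
    show "\<bar>f v - ip (z n) v\<bar> \<le> nrm v / real (Suc n)" if "v \<in> Y" for v n using z(2) that .
    show "(\<lambda>n. nrm (z n)) \<longlonglongrightarrow> fnorm f"
      by (rule Lim_transform_bound[OF _ lim[of 1], THEN LIM_zero_cancel]) (use z(3) in \<open>auto intro!: always_eventually simp del: of_nat_Suc\<close>)
    show "(\<lambda>n. ip (z n) v) \<longlonglongrightarrow> f v" if v: "v \<in> Y" for v
    proof (rule LIM_zero_cancel, rule Lim_null_comparison[OF _ lim[of "nrm v"]])
      show "\<forall>\<^sub>F n in sequentially. norm (ip (z n) v - f v) \<le> nrm v / real (Suc n)"
        using z(2)[OF v] by (auto intro!: always_eventually simp: abs_minus_commute simp del: of_nat_Suc)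
    qed
  qed
qed

lemma is_functional_comb:
  assumes f: "is_functional f" and g: "is_functional g"
  shows "is_functional (\<lambda>v. s * f v + t * g v)"
proof -
  have "\<bar>s * f v + t * g v\<bar> \<le> (\<bar>s\<bar> * fnorm f + \<bar>t\<bar> * fnorm g) * nrm v" if "v \<in> Y" for v
  proof -
    have "\<bar>s * f v + t * g v\<bar> \<le> \<bar>s\<bar> * \<bar>f v\<bar> + \<bar>t\<bar> * \<bar>g v\<bar>"
      by (metis abs_mult abs_triangle_ineq)
    also have "\<dots> \<le> \<bar>s\<bar> * (fnorm f * nrm v) + \<bar>t\<bar> * (fnorm g * nrm v)"
      using functional_bound[OF f that] functional_bound[OF g that]
      by (intro add_mono mult_left_mono) auto
    finally show ?thesis by (simp add: algebra_simps)
  qed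
  then show ?thesis using f g unfolding is_functional_def
    by (auto simp: algebra_simps intro!: exI[of _ "\<bar>s\<bar> * fnorm f + \<bar>t\<bar> * fnorm g"])
qed

text \<open>
  The squared dual norm is a quadratic form on the span of two functionals, so the dual norm comes
  from a semi-inner product as well.
\<close>

lemma fnorm_comb_sq:
  assumes f: "is_functional f" and g: "is_functional g"
  obtains B where "\<And>s t. (fnorm (\<lambda>v. s * f v + t * g v))\<^sup>2 = s\<^sup>2 * (fnorm f)\<^sup>2 + 2 * (s * t) * B + t\<^sup>2 * (fnorm g)\<^sup>2"
proof -
  from representing_sequence[OF f] obtain x where x: "\<And>n. x n \<in> Y"
    "\<And>n v. v \<in> Y \<Longrightarrow> \<bar>f v - ip (x n) v\<bar> \<le> nrm v / real (Suc n)"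
    "(\<lambda>n. nrm (x n)) \<longlonglongrightarrow> fnorm f" by metis
  from representing_sequence[OF g] obtain y where y: "\<And>n. y n \<in> Y"
    "\<And>n v. v \<in> Y \<Longrightarrow> \<bar>g v - ip (y n) v\<bar> \<le> nrm v / real (Suc n)"
    "(\<lambda>n. nrm (y n)) \<longlonglongrightarrow> fnorm g" by metis
  have lim: "(\<lambda>n. nrm (add (smul s (x n)) (smul t (y n)))) \<longlonglongrightarrow> fnorm (\<lambda>v. s * f v + t * g v)" for s t
  proof -
    let ?h = "\<lambda>v. s * f v + t * g v" and ?z = "\<lambda>n. add (smul s (x n)) (smul t (y n))"
    have h: "is_functional ?h" by (rule is_functional_comb[OF f g])
    have zY: "?z n \<in> Y" for n using x y by (simp add: add_mem smul_mem)
    have close: "\<bar>?h v - ip (?z n) v\<bar> \<le> (\<bar>s\<bar> + \<bar>t\<bar>) / real (Suc n) * nrm v" if v: "v \<in> Y" for v n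
    proof -
      have "?h v - ip (?z n) v = s * (f v - ip (x n) v) + t * (g v - ip (y n) v)"
        using x(1) y(1) v by (simp add: ip_add ip_smul smul_mem algebra_simps)
      also have "\<bar>\<dots>\<bar> \<le> \<bar>s\<bar> * \<bar>f v - ip (x n) v\<bar> + \<bar>t\<bar> * \<bar>g v - ip (y n) v\<bar>"
        by (metis abs_mult abs_triangle_ineq)
      also have "\<dots> \<le> \<bar>s\<bar> * (nrm v / real (Suc n)) + \<bar>t\<bar> * (nrm v / real (Suc n))"
        using x(2)[OF v] y(2)[OF v] by (intro add_mono mult_left_mono) auto
      finally show ?thesis by (simp add: algebra_simps add_divide_distrib)
    qed
    have bd: "\<bar>nrm (?z n) - fnorm ?h\<bar> \<le> (\<bar>s\<bar> + \<bar>t\<bar>) / real (Suc n)" for n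
      by (rule almost_representer_nrm[OF h zY _ close]) simp
    have "(\<lambda>n. (\<bar>s\<bar> + \<bar>t\<bar>) / real (Suc n)) \<longlonglongrightarrow> 0"
      using tendsto_mult[OF tendsto_const[of "\<bar>s\<bar> + \<bar>t\<bar>"] LIMSEQ_inverse_real_of_nat] by (simp add: divide_inverse)
    then show ?thesis
      by (rule Lim_null_comparison[rotated, THEN LIM_zero_cancel])
        (use bd in \<open>auto intro!: always_eventually simp del: of_nat_Suc\<close>)
  qed
  define B where "B = ((fnorm (\<lambda>v. 1 * f v + 1 * g v))\<^sup>2 - (fnorm f)\<^sup>2 - (fnorm g)\<^sup>2) / 2"
  have ipl: "(\<lambda>n. ip (x n) (y n)) \<longlonglongrightarrow> B"
  proof -
    have "(\<lambda>n. ((nrm (add (smul 1 (x n)) (smul 1 (y n))))\<^sup>2 - (nrm (x n))\<^sup>2 - (nrm (y n))\<^sup>2) / 2) \<longlonglongrightarrow> B"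
      unfolding B_def by (intro tendsto_intros lim x y) simp
    then show ?thesis by (simp add: nrm_comb_sq x y)
  qed
  show ?thesis
  proof (rule that)
    fix s t
    have "(\<lambda>n. s\<^sup>2 * (nrm (x n))\<^sup>2 + 2 * (s * t) * ip (x n) (y n) + t\<^sup>2 * (nrm (y n))\<^sup>2)
       \<longlonglongrightarrow> s\<^sup>2 * (fnorm f)\<^sup>2 + 2 * (s * t) * B + t\<^sup>2 * (fnorm g)\<^sup>2"
      by (intro tendsto_intros x y ipl)
    moreover have "(\<lambda>n. (nrm (add (smul s (x n)) (smul t (y n))))\<^sup>2) \<longlonglongrightarrow> (fnorm (\<lambda>v. s * f v + t * g v))\<^sup>2"
      by (intro tendsto_intros lim)
    ultimately show "(fnorm (\<lambda>v. s * f v + t * g v))\<^sup>2 = s\<^sup>2 * (fnorm f)\<^sup>2 + 2 * (s * t) * B + t\<^sup>2 * (fnorm g)\<^sup>2"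
      using LIMSEQ_unique by (simp add: nrm_comb_sq x y) 
  qed
qed

text \<open>
  If \<open>z\<close> represented \<open>f\<close>, the square root would be the norm of \<open>z - l\<close>.
\<close>

lemma functional_minus_ip_bound:
  assumes f: "is_functional f" and l: "l \<in> Y" and v: "v \<in> Y"
  shows "\<bar>f v - ip l v\<bar> \<le> sqrt ((fnorm f)\<^sup>2 - 2 * f l + (nrm l)\<^sup>2) * nrm v"
proof -
  obtain z where z: "\<And>n. z n \<in> Y" "(\<lambda>n. nrm (z n)) \<longlonglongrightarrow> fnorm f" "\<And>v. v \<in> Y \<Longrightarrow> (\<lambda>n. ip (z n) v) \<longlonglongrightarrow> f v"
    using representing_sequence[OF f] by metis
  have eq: "nrm (add (smul 1 (z n)) (smul (-1) l)) = sqrt ((nrm (z n))\<^sup>2 - 2 * ip (z n) l + (nrm l)\<^sup>2)" for n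
  proof (rule real_sqrt_unique[symmetric])
    show "(nrm (add (smul 1 (z n)) (smul (-1) l)))\<^sup>2 = (nrm (z n))\<^sup>2 - 2 * ip (z n) l + (nrm l)\<^sup>2"
      using nrm_comb_sq[OF z(1)[of n] l, of 1 "-1"] by simp
    show "0 \<le> nrm (add (smul 1 (z n)) (smul (-1) l))"
      by (rule nrm_nonneg[OF add_mem[OF smul_mem[OF z(1)] smul_mem[OF l]]])
  qed
  have le: "\<bar>ip (z n) v - ip l v\<bar> \<le> sqrt ((nrm (z n))\<^sup>2 - 2 * ip (z n) l + (nrm l)\<^sup>2) * nrm v" for n
    using ip_cauchy_schwarz[OF add_mem[OF smul_mem[OF z(1)] smul_mem[OF l]] v, of 1 n "-1"] z(1) l v
    by (simp add: eq ip_add ip_smul smul_mem)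
  have "(\<lambda>n. \<bar>ip (z n) v - ip l v\<bar>) \<longlonglongrightarrow> \<bar>f v - ip l v\<bar>"
    by (intro tendsto_intros z v)
  moreover have "(\<lambda>n. sqrt ((nrm (z n))\<^sup>2 - 2 * ip (z n) l + (nrm l)\<^sup>2) * nrm v)
      \<longlonglongrightarrow> sqrt ((fnorm f)\<^sup>2 - 2 * f l + (nrm l)\<^sup>2) * nrm v"
    by (intro tendsto_intros z l)
  ultimately show ?thesis using le by (intro LIMSEQ_le) auto
qed

text \<open>
  If \<open>z\<close> represented \<open>f\<close>, the left-hand side would be the inner product of \<open>z - l\<close> with \<open>z\<close>.
\<close>

lemma fnorm_sq_minus_le:
  assumes f: "is_functional f" and l: "l \<in> Y" and G: "\<And>v. v \<in> Y \<Longrightarrow> \<bar>f v - ip l v\<bar> \<le> G * nrm v"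
  shows "(fnorm f)\<^sup>2 - f l \<le> G * fnorm f"
proof -
  obtain z where z: "\<And>n. z n \<in> Y" "\<And>n v. v \<in> Y \<Longrightarrow> \<bar>f v - ip (z n) v\<bar> \<le> nrm v / real (Suc n)"
    "(\<lambda>n. nrm (z n)) \<longlonglongrightarrow> fnorm f" "\<And>v. v \<in> Y \<Longrightarrow> (\<lambda>n. ip (z n) v) \<longlonglongrightarrow> f v"
    using representing_sequence[OF f] by metis
  have le: "(nrm (z n))\<^sup>2 - ip (z n) l \<le> G * nrm (z n) + nrm (z n) * (1 / real (Suc n))" for n
    using z(2)[OF z(1), of n n] G[OF z(1), of n] nrm_sq[OF z(1), of n] ip_sym[OF z(1) l, of n]
    by (simp add: abs_le_iff del: of_nat_Suc)
  have "(\<lambda>n. 1 / real (Suc n)) \<longlonglongrightarrow> 0"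
    using LIMSEQ_inverse_real_of_nat by (simp add: inverse_eq_divide)
  then have "(\<lambda>n. G * nrm (z n) + nrm (z n) * (1 / real (Suc n))) \<longlonglongrightarrow> G * fnorm f + fnorm f * 0"
    by (intro tendsto_intros z)
  moreover have "(\<lambda>n. (nrm (z n))\<^sup>2 - ip (z n) l) \<longlonglongrightarrow> (fnorm f)\<^sup>2 - f l"
    by (intro tendsto_intros z l)
  ultimately show ?thesis using le by (auto intro: LIMSEQ_le)
qed

end

section \<open>The Riesz representation of functionals\<close>

lemma riesz_exists:
  fixes f :: "'a::{real_inner,banach} \<Rightarrow>\<^sub>L real"
  shows "\<exists>z. \<forall>x. blinfun_apply f x = z \<bullet> x"
proof -
  interpret semi_ip "UNIV :: 'a set" "(+)" "scaleR" "inner"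
    by unfold_locales (auto simp: inner_add_left intro: inner_commute)
  have n: "nrm x = norm x" for x unfolding nrm_def by (rule norm_eq_sqrt_inner[symmetric])
  have "is_functional (blinfun_apply f)"
    unfolding is_functional_def n
    using norm_blinfun[of f] by (auto simp: blinfun.add_right blinfun.scaleR_right)
  then obtain z where z: "\<And>n v. \<bar>f v - z n \<bullet> v\<bar> \<le> norm v / real (Suc n)"
    and zl: "\<And>v. (\<lambda>n. z n \<bullet> v) \<longlonglongrightarrow> f v"
    using representing_sequence[of "blinfun_apply f"] by (auto simp: n simp del: of_nat_Suc) metis
  have "Cauchy z"
  proof (rule metric_CauchyI)
    fix e :: real assume "0 < e"
    then obtain M where M: "M \<noteq> 0" "1 / real M < e / 2"
      using real_arch_inverse[of "e/2"] by (auto simp: inverse_eq_divide)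
    show "\<exists>M. \<forall>m\<ge>M. \<forall>n\<ge>M. dist (z m) (z n) < e"
    proof (intro exI allI impI)
      fix m n assume mn: "M \<le> m" "M \<le> n"
      have le: "1 / real (Suc k) \<le> 1 / real M" if "M \<le> k" for k
        using that M(1) by (intro divide_left_mono) auto
      let ?d = "z m - z n"
      have "norm ?d * norm ?d = z m \<bullet> ?d - z n \<bullet> ?d"
        by (simp add: inner_diff_left flip: power2_eq_square) (simp add: power2_norm_eq_inner inner_diff_left)
      also have "\<dots> \<le> norm ?d / real (Suc m) + norm ?d / real (Suc n)"
        using z[of ?d m] z[of ?d n] by linarith
      also have "\<dots> = norm ?d * (1 / real (Suc m) + 1 / real (Suc n))"
        by (simp add: distrib_left)
      finally have "norm ?d \<le> 1 / real (Suc m) + 1 / real (Suc n)"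
        by (cases "norm ?d = 0") (auto simp del: of_nat_Suc)
      also have "\<dots> < e" using le[OF mn(1)] le[OF mn(2)] M(2) by linarith
      finally show "dist (z m) (z n) < e" by (simp add: dist_norm)
    qed
  qed
  then obtain w where "z \<longlonglongrightarrow> w" using Cauchy_convergent convergent_def by blast
  then have "(\<lambda>n. z n \<bullet> v) \<longlonglongrightarrow> w \<bullet> v" for v by (intro tendsto_intros)
  then show ?thesis using zl LIMSEQ_unique by blast
qed

text \<open>
  The vector representing a functional on a Hilbert space.
\<close>

definition riesz :: "('a::{real_inner,banach} \<Rightarrow>\<^sub>L real) \<Rightarrow> 'a" where
  "riesz f = (SOME z. \<forall>x. blinfun_apply f x = z \<bullet> x)"

lemma riesz: "riesz f \<bullet> x = blinfun_apply f x"
  unfolding riesz_def by (rule someI_ex[OF riesz_exists[of f], THEN spec, symmetric])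

lemma riesz_unique: "(\<And>x. z \<bullet> x = blinfun_apply f x) \<Longrightarrow> riesz f = z"
  by (metis riesz vector_eq_rdot)

lemma norm_riesz: "norm (riesz f) = norm f"
proof (rule antisym)
  have "norm (riesz f) * norm (riesz f) \<le> norm f * norm (riesz f)"
    using norm_blinfun[of f "riesz f"] by (simp add: riesz[symmetric] flip: power2_norm_eq_inner) (simp add: power2_eq_square)
  then show "norm (riesz f) \<le> norm f" by (cases "norm (riesz f) = 0") auto
  show "norm f \<le> norm (riesz f)"
    by (rule norm_blinfun_bound) (auto simp flip: riesz simp: Cauchy_Schwarz_ineq2)
qed

lemma bounded_linear_riesz: "bounded_linear riesz"
  by (rule bounded_linear_intro[where K = 1])
    (auto intro!: riesz_unique simp: norm_riesz inner_add_left riesz blinfun.add_left blinfun.scaleR_left)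

lemma riesz_inner_left [simp]: "riesz (blinfun_inner_left z) = z"
  by (rule riesz_unique) (simp add: inner_commute)

section \<open>Test functions on an interval\<close>

text \<open>
  Infinitely differentiable real functions.
\<close>

definition smooth_fun :: "(real \<Rightarrow> real) \<Rightarrow> bool" where
  "smooth_fun f \<longleftrightarrow> (\<forall>n t. ((deriv ^^ n) f) differentiable (at t))"

text \<open>
  A set of functions that contains a derivative of each of its elements consists of smooth functions.
\<close>

lemma smooth_fun_coinduct:
  assumes "f \<in> S" and step: "\<And>f. f \<in> S \<Longrightarrow> \<exists>f'\<in>S. \<forall>x. (f has_real_derivative f' x) (at x)"
  shows "smooth_fun f"
proof -
  have "(deriv ^^ n) f \<in> S" for n
  proof (induction n)
    case 0
    then show ?case using assms(1) by simp
  next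
    case (Suc n)
    from step[OF this] obtain f' where f': "f' \<in> S" "\<And>x. ((deriv ^^ n) f has_real_derivative f' x) (at x)"
      by blast
    then have "deriv ((deriv ^^ n) f) = f'" by (intro ext DERIV_imp_deriv)
    then show ?case using f'(1) by simp
  qed
  then show ?thesis
    unfolding smooth_fun_def using step real_differentiable_def by blast
qed

lemma smooth_fun_has_deriv: "smooth_fun f \<Longrightarrow> (f has_real_derivative deriv f x) (at x)"
  unfolding smooth_fun_def
  by (metis DERIV_deriv_iff_real_differentiable funpow_0)

lemma smooth_fun_deriv: "smooth_fun f \<Longrightarrow> smooth_fun (deriv f)"
  unfolding smooth_fun_def by (metis comp_apply funpow_Suc_right)

lemma smooth_fun_isCont: "smooth_fun f \<Longrightarrow> isCont f x"
  using smooth_fun_has_deriv DERIV_isCont by blast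

lemma smooth_fun_continuous_on: "smooth_fun f \<Longrightarrow> continuous_on A f"
  by (simp add: continuous_at_imp_continuous_on smooth_fun_isCont)

lemma smooth_fun_primitive:
  assumes "\<And>x. (f has_real_derivative f' x) (at x)" "smooth_fun f'"
  shows "smooth_fun f"
  by (rule smooth_fun_coinduct[of f "insert f {g. smooth_fun g}"])
    (use assms smooth_fun_has_deriv smooth_fun_deriv in blast)+

lemma smooth_fun_const: "smooth_fun (\<lambda>x. c)"
  by (rule smooth_fun_coinduct[of _ "range (\<lambda>c x. c)"]) (auto intro!: derivative_eq_intros)

lemma smooth_fun_add:
  assumes "smooth_fun f" "smooth_fun g"
  shows "smooth_fun (\<lambda>x. f x + g x)"
proof (rule smooth_fun_coinduct[of _ "{\<lambda>x. f x + g x | f g. smooth_fun f \<and> smooth_fun g}"])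
  fix h assume "h \<in> {\<lambda>x. f x + g x | f g. smooth_fun f \<and> smooth_fun g}"
  then obtain f g where h: "h = (\<lambda>x. f x + g x)" "smooth_fun f" "smooth_fun g" by blast
  then have "\<forall>x. (h has_real_derivative deriv f x + deriv g x) (at x)"
    by (auto intro!: derivative_intros smooth_fun_has_deriv)
  then show "\<exists>h'\<in>{\<lambda>x. f x + g x | f g. smooth_fun f \<and> smooth_fun g}. \<forall>x. (h has_real_derivative h' x) (at x)"
    using h smooth_fun_deriv by (intro bexI[of _ "\<lambda>x. deriv f x + deriv g x"]) auto
qed (use assms in blast)

text \<open>
  Finite sums of products of smooth functions; by the product rule, derivatives stay in this set.
\<close>

inductive_set product_sums :: "(real \<Rightarrow> real) set" where
  product: "smooth_fun f \<Longrightarrow> smooth_fun g \<Longrightarrow> (\<lambda>x. f x * g x) \<in> product_sums"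
| sum: "f \<in> product_sums \<Longrightarrow> g \<in> product_sums \<Longrightarrow> (\<lambda>x. f x + g x) \<in> product_sums"

lemma smooth_fun_mult:
  assumes "smooth_fun f" "smooth_fun g"
  shows "smooth_fun (\<lambda>x. f x * g x)"
proof (rule smooth_fun_coinduct[OF product_sums.product[OF assms]])
  fix h :: "real \<Rightarrow> real" assume "h \<in> product_sums"
  then show "\<exists>h'\<in>product_sums. \<forall>x. (h has_real_derivative h' x) (at x)"
  proof induction
    case (product f g)
    have "(\<lambda>x. deriv f x * g x + f x * deriv g x) \<in> product_sums"
      using product by (intro product_sums.intros smooth_fun_deriv)
    moreover have "((\<lambda>x. f x * g x) has_real_derivative deriv f x * g x + f x * deriv g x) (at x)" for x
      using DERIV_mult[OF smooth_fun_has_deriv[OF product(1), of x] smooth_fun_has_deriv[OF product(2), of x]]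
      by (simp add: mult.commute)
    ultimately show ?case by (intro bexI[of _ "\<lambda>x. deriv f x * g x + f x * deriv g x"]) auto
  next
    case (sum f g)
    then obtain f' g' where "f' \<in> product_sums" "g' \<in> product_sums"
      "\<And>x. (f has_real_derivative f' x) (at x)" "\<And>x. (g has_real_derivative g' x) (at x)" by blast
    then show ?case
      by (intro bexI[of _ "\<lambda>x. f' x + g' x"]) (auto intro!: derivative_intros product_sums.sum)
  qed
qed

lemma smooth_fun_power: "smooth_fun f \<Longrightarrow> smooth_fun (\<lambda>x. f x ^ n)"
  by (induction n) (auto intro: smooth_fun_const smooth_fun_mult)

lemma smooth_fun_lin:
  assumes "smooth_fun f" "smooth_fun g"
  shows "smooth_fun (\<lambda>x. r * f x + s * g x)"
  by (intro smooth_fun_add smooth_fun_mult smooth_fun_const assms)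

text \<open>
  The function \<open>p(1/x) exp(-1/x)\<close>, extended by \<open>0\<close> to \<open>x \<le> 0\<close>. Differentiation only changes
  the polynomial \<open>p\<close>, which makes these functions smooth.
\<close>

definition flat_exp :: "real poly \<Rightarrow> real \<Rightarrow> real" where
  "flat_exp p x = (if 0 < x then poly p (1 / x) * exp (- (1 / x)) else 0)"

lemma poly_exp_tendsto_0: "((\<lambda>y. poly p y * exp (- y)) \<longlongrightarrow> (0::real)) at_top"
proof -
  have "((\<lambda>y. \<Sum>i\<le>degree p. coeff p i * (y ^ i / exp y)) \<longlongrightarrow> 0) at_top"
    by (intro tendsto_null_sum tendsto_mult_right_zero tendsto_power_div_exp_0)
  then show ?thesis
    by (simp add: poly_altdef sum_distrib_right exp_minus field_simps sum_divide_distrib)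
qed

lemma flat_exp_deriv:
  "(flat_exp p has_real_derivative flat_exp (pCons 0 (pCons 0 (p - pderiv p))) x) (at x)"
proof (cases "x = 0")
  case False
  show ?thesis
  proof (cases "0 < x")
    case True
    have "((\<lambda>x. poly p (1 / x) * exp (- (1 / x))) has_real_derivative
        flat_exp (pCons 0 (pCons 0 (p - pderiv p))) x) (at x)"
      using True by (auto intro!: derivative_eq_intros simp: flat_exp_def field_simps power2_eq_square)
    moreover have "\<forall>\<^sub>F y in nhds x. flat_exp p y = poly p (1 / y) * exp (- (1 / y))"
      using eventually_nhds_in_open[of "{0<..}" x] True by (auto elim!: eventually_mono simp: flat_exp_def)
    ultimately show ?thesis by (simp add: DERIV_cong_ev)
  next
    case neg: False
    have "\<forall>\<^sub>F y in nhds x. flat_exp p y = 0"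
      using eventually_nhds_in_open[of "{..<0}" x] neg False by (auto elim!: eventually_mono simp: flat_exp_def)
    then show ?thesis using neg False by (subst DERIV_cong_ev[OF refl _ refl]) (auto simp: flat_exp_def)
  qed
next
  case True
  have "((\<lambda>x. poly (pCons 0 p) (inverse x) * exp (- inverse x)) \<longlongrightarrow> 0) (at_right (0::real))"
    using filterlim_compose[OF poly_exp_tendsto_0 filterlim_inverse_at_top_right] .
  then have "((\<lambda>y. (flat_exp p y - flat_exp p 0) / (y - 0)) \<longlongrightarrow> 0) (at_right 0)"
    by (rule Lim_transform_eventually)
      (auto simp: flat_exp_def eventually_at_right_less inverse_eq_divide intro!: eventually_mono[OF eventually_at_right_less])
  moreover have "((\<lambda>y. (flat_exp p y - flat_exp p 0) / (y - 0)) \<longlongrightarrow> 0) (at_left 0)"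
    by (rule Lim_transform_eventually[OF tendsto_const])
      (auto simp: flat_exp_def eventually_at_left_field intro!: exI[of _ "-1"])
  ultimately have "((\<lambda>y. (flat_exp p y - flat_exp p 0) / (y - 0)) \<longlongrightarrow> 0) (at 0)"
    using filterlim_split_at by blast
  then show ?thesis using True by (simp add: has_field_derivative_iff flat_exp_def)
qed

lemma smooth_fun_flat_exp: "smooth_fun (\<lambda>x. flat_exp p (s * x + c))"
proof (rule smooth_fun_coinduct[of _ "{\<lambda>x. k * flat_exp p (s * x + c) | p k. True}"])
  show "(\<lambda>x. flat_exp p (s * x + c)) \<in> {\<lambda>x. k * flat_exp p (s * x + c) | p k. True}"
    by (rule CollectI, rule exI[of _ p], rule exI[of _ 1]) simp
  fix f assume "f \<in> {\<lambda>x. k * flat_exp p (s * x + c) | p k. True}"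
  then obtain p k where f: "f = (\<lambda>x. k * flat_exp p (s * x + c))" by blast
  let ?q = "pCons 0 (pCons 0 (p - pderiv p))"
  have "(f has_real_derivative (k * s) * flat_exp ?q (s * x + c)) (at x)" for x
  proof -
    have "((\<lambda>x. flat_exp p (s * x + c)) has_real_derivative flat_exp ?q (s * x + c) * s) (at x)"
      by (rule DERIV_chain2[OF flat_exp_deriv]) (auto intro!: derivative_eq_intros)
    from DERIV_cmult[OF this, of k] show ?thesis by (simp add: f mult_ac)
  qed
  then show "\<exists>f'\<in>{\<lambda>x. k * flat_exp p (s * x + c) | p k. True}. \<forall>x. (f has_real_derivative f' x) (at x)"
    by (intro bexI[of _ "\<lambda>x. (k * s) * flat_exp ?q (s * x + c)"]) auto
qed

text \<open>
  A smooth function with values in \<open>[0, 1)\<close> that is positive exactly on the interval from \<open>a\<close> to \<open>b\<close>.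
  The redundant factors \<open>1\<close> match the affine arguments in \<open>smooth_fun_flat_exp\<close>.
\<close>

definition bump :: "real \<Rightarrow> real \<Rightarrow> real \<Rightarrow> real" where
  "bump a b x = flat_exp 1 (1 * x + (- a)) * flat_exp 1 (- 1 * x + b)"

lemma smooth_fun_bump: "smooth_fun (bump a b)"
  using smooth_fun_mult[OF smooth_fun_flat_exp[of 1 1 "- a"] smooth_fun_flat_exp[of 1 "- 1" b]]
  by (simp add: bump_def[abs_def])

lemma bump_bounds: "0 \<le> bump a b x" "bump a b x < 1"
proof -
  have *: "0 \<le> flat_exp 1 y" "flat_exp 1 y < 1" for y by (auto simp: flat_exp_def)
  show "0 \<le> bump a b x" unfolding bump_def using * by simp
  show "bump a b x < 1" unfolding bump_def
    using mult_strict_mono'[OF *(2) *(2) *(1) *(1)] by simp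
qed

lemma bump_pos_iff: "0 < bump a b x \<longleftrightarrow> a < x \<and> x < b"
  by (auto simp: bump_def flat_exp_def)

lemma test_functions_iff:
  assumes "0 < T"
  shows "\<phi> \<in> test_functions T \<longleftrightarrow> smooth_fun \<phi> \<and> (\<exists>a b. 0 < a \<and> a < b \<and> b < T \<and> (\<forall>t. t \<notin> {a..b} \<longrightarrow> \<phi> t = 0))"
proof
  assume "\<phi> \<in> test_functions T"
  then obtain K where sm: "smooth_fun \<phi>" and K: "compact K" "K \<subseteq> {0<..<T}" "\<And>t. t \<notin> K \<Longrightarrow> \<phi> t = 0"
    unfolding test_functions_def smooth_fun_def by blast
  have "\<exists>a b. 0 < a \<and> a < b \<and> b < T \<and> K \<subseteq> {a..b}"
  proof (cases "K = {}")
    case True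
    then show ?thesis using assms by (intro exI[of _ "T/3"] exI[of _ "T/2"]) auto
  next
    case False
    obtain x where x: "x \<in> K" "\<And>t. t \<in> K \<Longrightarrow> x \<le> t" using compact_attains_inf[OF K(1) False] by blast
    obtain y where y: "y \<in> K" "\<And>t. t \<in> K \<Longrightarrow> t \<le> y" using compact_attains_sup[OF K(1) False] by blast
    have "0 < x" "x \<le> y" "y < T" using x y K(2) by auto
    then show ?thesis using x y by (intro exI[of _ x] exI[of _ "(y + T) / 2"]) force
  qed
  then show "smooth_fun \<phi> \<and> (\<exists>a b. 0 < a \<and> a < b \<and> b < T \<and> (\<forall>t. t \<notin> {a..b} \<longrightarrow> \<phi> t = 0))"
    using sm K(3) by blast
next
  assume "smooth_fun \<phi> \<and> (\<exists>a b. 0 < a \<and> a < b \<and> b < T \<and> (\<forall>t. t \<notin> {a..b} \<longrightarrow> \<phi> t = 0))"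
  then obtain a b where "smooth_fun \<phi>" "0 < a" "a < b" "b < T" "\<And>t. t \<notin> {a..b} \<Longrightarrow> \<phi> t = 0" by blast
  then show "\<phi> \<in> test_functions T" unfolding test_functions_def smooth_fun_def
    by (auto intro!: exI[of _ "{a..b}"])
qed

lemma test_functionI:
  assumes "0 < a" "a < b" "b < T" "smooth_fun \<phi>" "\<And>t. t \<notin> {a..b} \<Longrightarrow> \<phi> t = 0"
  shows "\<phi> \<in> test_functions T"
  using assms by (subst test_functions_iff) force+

lemma test_function_smooth: "\<phi> \<in> test_functions T \<Longrightarrow> smooth_fun \<phi>"
  by (auto simp: test_functions_def smooth_fun_def)

lemma test_function_lin:
  assumes "0 < T" "\<phi> \<in> test_functions T" "\<psi> \<in> test_functions T"
  shows "(\<lambda>t. r * \<phi> t + s * \<psi> t) \<in> test_functions T"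
proof -
  from assms obtain a b where a: "0 < a" "a < b" "b < T" "\<And>t. t \<notin> {a..b} \<Longrightarrow> \<phi> t = 0"
    by (auto simp: test_functions_iff)
  from assms obtain c d where c: "0 < c" "c < d" "d < T" "\<And>t. t \<notin> {c..d} \<Longrightarrow> \<psi> t = 0"
    by (auto simp: test_functions_iff)
  show ?thesis
  proof (rule test_functionI[of "min a c" "max b d"])
    show "smooth_fun (\<lambda>t. r * \<phi> t + s * \<psi> t)"
      using assms by (intro smooth_fun_lin test_function_smooth)
    show "r * \<phi> t + s * \<psi> t = 0" if "t \<notin> {min a c..max b d}" for t
    proof -
      have "t \<notin> {a..b}" "t \<notin> {c..d}" using that by auto
      then show ?thesis using a(4) c(4) by simp
    qed
  qed (use a c in auto)
qed

lemma test_function_deriv: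
  assumes "0 < T" "\<phi> \<in> test_functions T"
  shows "deriv \<phi> \<in> test_functions T"
proof -
  from assms obtain a b where a: "0 < a" "a < b" "b < T" "\<And>t. t \<notin> {a..b} \<Longrightarrow> \<phi> t = 0"
    by (auto simp: test_functions_iff)
  have "deriv \<phi> t = 0" if "t \<notin> {a..b}" for t
  proof -
    have "open (- {a..b})" by auto
    then have "\<forall>\<^sub>F y in nhds t. \<phi> y = 0"
      using eventually_nhds_in_open[of "- {a..b}" t] a(4) that by (auto elim!: eventually_mono)
    then have "(\<phi> has_real_derivative 0) (at t)"
      by (subst DERIV_cong_ev[OF refl _ refl, where g = "\<lambda>_. 0"]) auto
    then show ?thesis by (rule DERIV_imp_deriv)
  qed
  then show ?thesis
    using a test_function_smooth[OF assms(2)] by (intro test_functionI[of a b]) (auto intro: smooth_fun_deriv)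
qed

lemma test_function_bounded:
  assumes "0 < T" "\<phi> \<in> test_functions T"
  shows "\<exists>B\<ge>0. \<forall>t. \<bar>\<phi> t\<bar> \<le> B"
proof -
  from assms obtain a b where a: "0 < a" "a < b" "b < T" "\<And>t. t \<notin> {a..b} \<Longrightarrow> \<phi> t = 0"
    by (auto simp: test_functions_iff)
  have "bounded (\<phi> ` {a..b})"
    using smooth_fun_continuous_on[OF test_function_smooth[OF assms(2)]]
    by (intro compact_imp_bounded compact_continuous_image) auto
  then obtain B where "\<forall>y\<in>\<phi> ` {a..b}. norm y \<le> B" using bounded_iff by blast
  then have "\<bar>\<phi> t\<bar> \<le> B" if "t \<in> {a..b}" for t using that by simp
  then have "\<bar>\<phi> t\<bar> \<le> max 0 B" for t using a(4)[of t] by (cases "t \<in> {a..b}") force+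
  then show ?thesis by (intro exI[of _ "max 0 B"]) auto
qed

text \<open>
  Since \<open>1 - bump\<close> is less than \<open>1\<close> exactly on the open interval, its powers tend to the indicator
  of the complement.
\<close>

lemma indicator_approx:
  assumes "0 < a" "a < b" "b < T"
  shows "(\<lambda>t. 1 - (1 - bump a b t) ^ n) \<in> test_functions T"
    and "0 \<le> 1 - (1 - bump a b t) ^ n" "1 - (1 - bump a b t) ^ n \<le> 1"
    and "(\<lambda>n. 1 - (1 - bump a b t) ^ n) \<longlonglongrightarrow> indicator {a<..<b} t"
proof -
  have sm: "smooth_fun (\<lambda>t. 1 - (1 - bump a b t) ^ n)"
  proof -
    have "smooth_fun (\<lambda>t. 1 * 1 + (-1) * (1 * 1 + (-1) * bump a b t) ^ n)"
      by (intro smooth_fun_lin smooth_fun_power smooth_fun_bump smooth_fun_const)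
    then show ?thesis by simp
  qed
  have "bump a b t = 0" if "t \<notin> {a..b}" for t
    using bump_bounds(1)[of a b t] bump_pos_iff[of a b t] that by auto
  then show "(\<lambda>t. 1 - (1 - bump a b t) ^ n) \<in> test_functions T"
    using assms sm by (intro test_functionI[of a b]) auto
  show "0 \<le> 1 - (1 - bump a b t) ^ n" using bump_bounds[of a b t] by (simp add: power_le_one)
  show "1 - (1 - bump a b t) ^ n \<le> 1" using bump_bounds[of a b t] by simp
  show "(\<lambda>n. 1 - (1 - bump a b t) ^ n) \<longlonglongrightarrow> indicator {a<..<b} t"
  proof (cases "a < t \<and> t < b")
    case True
    then have "0 < bump a b t" by (simp add: bump_pos_iff)
    then have "(\<lambda>n. (1 - bump a b t) ^ n) \<longlonglongrightarrow> 0"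
      using bump_bounds[of a b t] by (intro LIMSEQ_realpow_zero) auto
    from tendsto_diff[OF tendsto_const[of 1] this] show ?thesis using True by simp
  next
    case False
    then have "bump a b t = 0" using bump_bounds(1)[of a b t] bump_pos_iff[of a b t] by auto
    then show ?thesis using False by simp
  qed
qed

section \<open>Integration on the time interval\<close>

lemma finite_measure_interval: "finite_measure (lebesgue_on {0<..<T::real})"
  by (rule finite_measure_lebesgue_on) (simp add: bounded_set_imp_lmeasurable)

lemma measurable_interval_id [measurable]: "(\<lambda>t. t) \<in> borel_measurable (lebesgue_on {0<..<T::real})"
  by (simp add: measurable_restrict_space1 measurable_completion)

lemma measurable_interval_continuous:
  "continuous_on UNIV f \<Longrightarrow> f \<in> borel_measurable (lebesgue_on {0<..<T::real})"
  using borel_measurable_continuous_onI[of f] measurable_compose[OF measurable_interval_id] by blast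

lemma integrable_interval_bounded_mult:
  fixes f :: "real \<Rightarrow> 'b::{banach,second_countable_topology}" and \<phi> :: "real \<Rightarrow> real"
  assumes f: "integrable (lebesgue_on {0<..<T}) f" and m: "\<phi> \<in> borel_measurable (lebesgue_on {0<..<T})"
    and B: "\<And>t. \<bar>\<phi> t\<bar> \<le> B"
  shows "integrable (lebesgue_on {0<..<T}) (\<lambda>t. \<phi> t *\<^sub>R f t)"
proof (rule Bochner_Integration.integrable_bound)
  show "integrable (lebesgue_on {0<..<T}) (\<lambda>t. B *\<^sub>R f t)" using f by simp
  show "(\<lambda>t. \<phi> t *\<^sub>R f t) \<in> borel_measurable (lebesgue_on {0<..<T})" using f m by measurable
  have "norm (\<phi> t *\<^sub>R f t) \<le> norm (B *\<^sub>R f t)" for t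
    using B[of t] by (auto intro!: mult_right_mono)
  then show "AE t in lebesgue_on {0<..<T}. norm (\<phi> t *\<^sub>R f t) \<le> norm (B *\<^sub>R f t)" by simp
qed

lemma test_function_measurable:
  "\<phi> \<in> test_functions T \<Longrightarrow> \<phi> \<in> borel_measurable (lebesgue_on {0<..<T})"
  using measurable_interval_continuous smooth_fun_continuous_on test_function_smooth by blast

lemma integrable_test_mult:
  fixes f :: "real \<Rightarrow> 'b::{banach,second_countable_topology}"
  assumes "0 < T" "\<phi> \<in> test_functions T" "integrable (lebesgue_on {0<..<T}) f"
  shows "integrable (lebesgue_on {0<..<T}) (\<lambda>t. \<phi> t *\<^sub>R f t)"
  using integrable_interval_bounded_mult[OF assms(3) test_function_measurable[OF assms(2)]]
    test_function_bounded[OF assms(1,2)] by metis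

text \<open>
  The indefinite integral of \<open>f\<close> from \<open>0\<close> to \<open>t\<close>, for \<open>t\<close> in \<open>{0..T}\<close>; it is constant outside this
  interval.
\<close>

definition cumint :: "real \<Rightarrow> (real \<Rightarrow> 'b::{banach,second_countable_topology}) \<Rightarrow> real \<Rightarrow> 'b" where
  "cumint T f t = (LINT s|lebesgue_on {0<..<T}. indicator {..<t} s *\<^sub>R f s)"

lemma cumint_FTC:
  fixes F :: "real \<Rightarrow> real"
  assumes F: "\<And>x. (F has_real_derivative f x) (at x)" and f: "continuous_on UNIV f"
    and t: "0 \<le> t" "t \<le> T"
  shows "cumint T f t = F t - F 0"
proof -
  have "cumint T f t = (LINT s|lebesgue_on {0<..<T}. (if s \<in> {0<..<t} then f s else 0))"
    unfolding cumint_def by (intro Bochner_Integration.integral_cong) (auto simp: indicator_def)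
  also have "\<dots> = (LINT s|lebesgue_on {0<..<t}. f s)"
    using t by (intro integral_restrict) auto
  also have "\<dots> = integral {0<..<t} f"
  proof (rule lebesgue_integral_eq_integral)
    have "f absolutely_integrable_on {0..t}"
      by (intro absolutely_integrable_continuous_real continuous_on_subset[OF f]) auto
    then have "f absolutely_integrable_on {0<..<t}"
      by (rule set_integrable_subset) auto
    then show "integrable (lebesgue_on {0<..<t}) f"
      by (simp add: integrable_restrict_space set_integrable_def)
  qed auto
  also have "\<dots> = F t - F 0"
  proof (rule integral_unique)
    have "(f has_integral F t - F 0) {0..t}"
      using t F by (intro fundamental_theorem_of_calculus)
        (auto simp: has_real_derivative_iff_has_vector_derivative[symmetric] intro: DERIV_subset)
    then show "(f has_integral F t - F 0) {0<..<t}" by (simp add: has_integral_Icc_iff_Ioo)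
  qed
  finally show ?thesis .
qed

lemma test_function_primitive:
  assumes T: "0 < T" and \<psi>: "\<psi> \<in> test_functions T" and zero: "(LINT t|lebesgue_on {0<..<T}. \<psi> t) = 0"
  obtains \<Phi> where "\<Phi> \<in> test_functions T" "deriv \<Phi> = \<psi>" "\<And>t. t \<in> {0..T} \<Longrightarrow> \<Phi> t = cumint T \<psi> t"
proof -
  have sm: "smooth_fun \<psi>" using \<psi> by (rule test_function_smooth)
  have "\<exists>F. \<forall>x :: real. -\<infinity> < ereal x \<longrightarrow> ereal x < \<infinity> \<longrightarrow> (F has_vector_derivative \<psi> x) (at x)"
    by (rule einterval_antiderivative) (auto intro: smooth_fun_isCont[OF sm])
  then obtain G where G: "\<And>x. (G has_real_derivative \<psi> x) (at x)"
    by (auto simp: has_real_derivative_iff_has_vector_derivative)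
  define F where "F x = G x - G 0" for x
  have F: "(F has_real_derivative \<psi> x) (at x)" for x
    unfolding F_def[abs_def] by (auto intro!: derivative_eq_intros G)
  have F0: "F 0 = 0" by (simp add: F_def)
  have cum: "F t = cumint T \<psi> t" if "t \<in> {0..T}" for t
    using cumint_FTC[OF F smooth_fun_continuous_on[OF sm], of t T] that F0 by simp
  have FT: "F T = 0"
  proof -
    have "cumint T \<psi> T = (LINT t|lebesgue_on {0<..<T}. \<psi> t)"
      unfolding cumint_def by (intro Bochner_Integration.integral_cong) auto
    then show ?thesis using cum[of T] zero T by simp
  qed
  from \<psi> T obtain a b where a: "0 < a" "a < b" "b < T" "\<And>t. t \<notin> {a..b} \<Longrightarrow> \<psi> t = 0"
    by (auto simp: test_functions_iff)
  have const: "F x = F y" if "x < y" "\<And>t. x < t \<Longrightarrow> t < y \<Longrightarrow> \<psi> t = 0" for x y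
  proof -
    from MVT2[OF that(1), of F \<psi>] F obtain z where "x < z" "z < y" "F y - F x = (y - x) * \<psi> z" by blast
    then show ?thesis using that(2)[of z] by simp
  qed
  have out: "F t = 0" if "t \<notin> {a..b}" for t
  proof (cases "t < a")
    case True
    show ?thesis
      using const[of t 0] const[of 0 t] True a F0 by (cases t "0::real" rule: linorder_cases) auto
  next
    case False
    then have "b < t" using that by auto
    then show ?thesis
      using const[of t T] const[of T t] a FT by (cases t T rule: linorder_cases) auto
  qed
  show ?thesis
  proof (rule that)
    show "F \<in> test_functions T"
      unfolding test_functions_iff[OF T] using smooth_fun_primitive[OF F sm] a out by blast
    show "deriv F = \<psi>" using F by (intro ext DERIV_imp_deriv)
  qed (use cum in auto)
qed

lemma test_function_mean_one:
  assumes T: "0 < T"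
  obtains \<phi> where "\<phi> \<in> test_functions T" "(LINT t|lebesgue_on {0<..<T}. \<phi> t) = 1"
proof -
  interpret finite_measure "lebesgue_on {0<..<T}" by (rule finite_measure_interval)
  have bt: "(\<lambda>t. 1 - (1 - bump (T/3) (T/2) t) ^ 1) \<in> test_functions T"
    using T by (intro indicator_approx) auto
  then have b: "bump (T/3) (T/2) \<in> test_functions T" by simp
  define c where "c = (LINT t|lebesgue_on {0<..<T}. bump (T/3) (T/2) t)"
  have int: "integrable (lebesgue_on {0<..<T}) (bump (T/3) (T/2))"
    using integrable_test_mult[OF T b, of "\<lambda>_. 1::real"] by simp
  have "c \<noteq> 0"
  proof
    assume "c = 0"
    then have "AE t in lebesgue_on {0<..<T}. bump (T/3) (T/2) t = 0"
      using integral_nonneg_eq_0_iff_AE[OF int] bump_bounds by (simp add: c_def)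
    then have "AE t in lebesgue. t \<in> {0<..<T} \<longrightarrow> bump (T/3) (T/2) t = 0"
      by (subst (asm) AE_restrict_space_iff) auto
    then have "AE t in lborel. t \<in> {0<..<T} \<longrightarrow> bump (T/3) (T/2) t = 0"
      by (simp add: AE_completion_iff)
    then have "AE t in lborel. t \<notin> {T/3<..<T/2}"
      by eventually_elim (use T bump_pos_iff[of "T/3" "T/2"] in force)
    then have "emeasure lborel {T/3<..<T/2} = 0"
      by (subst (asm) AE_iff_measurable[where N = "{T/3<..<T/2}"]) auto
    then show False using T by simp
  qed
  then show ?thesis
    using that[of "\<lambda>t. (1/c) * bump (T/3) (T/2) t + 0 * bump (T/3) (T/2) t"]
      test_function_lin[OF T b b, of "1/c" 0] by (simp add: c_def)
qed

section \<open>The fundamental lemma of the calculus of variations\<close>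

text \<open>
  Two limits: the interval is exhausted by intervals whose closures lie in \<open>{0<..<T}\<close>, and the
  indicator of each of these is a bounded limit of test functions.
\<close>

lemma integral_open_interval_zero:
  fixes f :: "real \<Rightarrow> real"
  assumes T: "0 < T" and f: "integrable (lebesgue_on {0<..<T}) f"
    and zero: "\<And>\<phi>. \<phi> \<in> test_functions T \<Longrightarrow> (LINT t|lebesgue_on {0<..<T}. \<phi> t * f t) = 0"
  shows "(LINT t|lebesgue_on {0<..<T}. indicator {a<..<b} t * f t) = 0"
proof -
  have inner: "(LINT t|lebesgue_on {0<..<T}. indicator {c<..<d} t * f t) = 0" if "0 < c" "d < T" for c d
  proof (cases "c < d")
    case True
    have "(\<lambda>n. LINT t|lebesgue_on {0<..<T}. (1 - (1 - bump c d t) ^ n) * f t)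
       \<longlonglongrightarrow> (LINT t|lebesgue_on {0<..<T}. indicator {c<..<d} t * f t)"
    proof (rule integral_dominated_convergence[where w = "\<lambda>t. norm (f t)"])
      show "(\<lambda>t. indicator {c<..<d} t * f t) \<in> borel_measurable (lebesgue_on {0<..<T})"
        using f by measurable
      show "(\<lambda>t. (1 - (1 - bump c d t) ^ n) * f t) \<in> borel_measurable (lebesgue_on {0<..<T})" for n
        using f test_function_measurable[OF indicator_approx(1)[OF \<open>0 < c\<close> True \<open>d < T\<close>, of n]] by measurable
      show "integrable (lebesgue_on {0<..<T}) (\<lambda>t. norm (f t))" using f by simp
      show "AE t in lebesgue_on {0<..<T}. (\<lambda>n. (1 - (1 - bump c d t) ^ n) * f t) \<longlonglongrightarrow> indicator {c<..<d} t * f t"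
        by (intro AE_I2 tendsto_mult tendsto_const indicator_approx(4)[OF \<open>0 < c\<close> True \<open>d < T\<close>])
      show "AE t in lebesgue_on {0<..<T}. norm ((1 - (1 - bump c d t) ^ n) * f t) \<le> norm (f t)" for n
        using indicator_approx(2,3)[OF \<open>0 < c\<close> True \<open>d < T\<close>]
        by (intro AE_I2) (auto simp: abs_mult abs_of_nonneg intro!: mult_left_le_one_le)
    qed
    then show ?thesis
      using zero[OF indicator_approx(1)[OF \<open>0 < c\<close> True \<open>d < T\<close>]] by (simp add: LIMSEQ_const_iff)
  qed auto
  define c where "c n = max a 0 + 1 / real (Suc n)" for n
  define d where "d n = min b T - 1 / real (Suc n)" for n
  have zlim: "(\<lambda>n. 1 / real (Suc n)) \<longlonglongrightarrow> 0"
    using LIMSEQ_inverse_real_of_nat by (simp add: inverse_eq_divide)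
  have "(\<lambda>n. LINT t|lebesgue_on {0<..<T}. indicator {c n<..<d n} t * f t)
     \<longlonglongrightarrow> (LINT t|lebesgue_on {0<..<T}. indicator {a<..<b} t * f t)"
  proof (rule integral_dominated_convergence[where w = "\<lambda>t. norm (f t)"])
    show "(\<lambda>t. indicator {a<..<b} t * f t) \<in> borel_measurable (lebesgue_on {0<..<T})"
      using f by measurable
    show "(\<lambda>t. indicator {c n<..<d n} t * f t) \<in> borel_measurable (lebesgue_on {0<..<T})" for n
      using f by measurable
    show "integrable (lebesgue_on {0<..<T}) (\<lambda>t. norm (f t))" using f by simp
    show "AE t in lebesgue_on {0<..<T}. norm (indicator {c n<..<d n} t * f t) \<le> norm (f t)" for n
      by (intro AE_I2) (auto simp: indicator_def)
    show "AE t in lebesgue_on {0<..<T}. (\<lambda>n. indicator {c n<..<d n} t * f t) \<longlonglongrightarrow> indicator {a<..<b} t * f t"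
    proof (intro AE_I2 tendsto_mult tendsto_const)
      fix t assume t: "t \<in> space (lebesgue_on {0<..<T})"
      have cl: "c \<longlonglongrightarrow> max a 0" and dl: "d \<longlonglongrightarrow> min b T"
        unfolding c_def[abs_def] d_def[abs_def]
        using tendsto_add[OF tendsto_const zlim, of "max a 0"] tendsto_diff[OF tendsto_const zlim, of "min b T"] by auto
      show "(\<lambda>n. indicator {c n<..<d n} t :: real) \<longlonglongrightarrow> indicator {a<..<b} t"
      proof (cases "a < t \<and> t < b")
        case True
        have "\<forall>\<^sub>F n in sequentially. c n < t" "\<forall>\<^sub>F n in sequentially. t < d n"
          using True t order_tendstoD(2)[OF cl, of t] order_tendstoD(1)[OF dl, of t] by auto
        then have "\<forall>\<^sub>F n in sequentially. indicator {c n<..<d n} t = (1::real)"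
          by eventually_elim auto
        then show ?thesis using True by (simp add: tendsto_eventually)
      next
        case False
        have "indicator {c n<..<d n} t = (0::real)" for n
        proof -
          have "0 \<le> 1 / real (Suc n)" by simp
          then have "max a 0 \<le> c n" "d n \<le> min b T" unfolding c_def d_def by linarith+
          then show ?thesis using False by (auto simp: indicator_def)
        qed
        then show ?thesis using False by simp
      qed
    qed
  qed
  moreover have "(LINT t|lebesgue_on {0<..<T}. indicator {c n<..<d n} t * f t) = 0" for n
  proof (rule inner)
    show "0 < c n" by (simp add: c_def add_nonneg_pos)
    have "0 < 1 / real (Suc n)" by simp
    then show "d n < T" unfolding d_def by linarith
  qed
  ultimately show ?thesis by (simp add: LIMSEQ_const_iff)
qed

lemma fundamental_lemma_real:
  fixes f :: "real \<Rightarrow> real"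
  assumes T: "0 < T" and f: "integrable (lebesgue_on {0<..<T}) f"
    and zero: "\<And>\<phi>. \<phi> \<in> test_functions T \<Longrightarrow> (LINT t|lebesgue_on {0<..<T}. \<phi> t * f t) = 0"
  shows "AE t in lebesgue_on {0<..<T}. f t = 0"
proof -
  let ?M = "lebesgue_on {0<..<T}"
  have int: "integrable ?M (\<lambda>t. indicator A t * f t)" if "A \<in> sets borel" for A
    using integrable_interval_bounded_mult[OF f, of "indicator A" 1] that by (auto simp: indicator_def)
  have borel0: "(LINT t|?M. indicator A t * f t) = 0" if "A \<in> sets borel" for A
  proof -
    have "Int_stable (range (\<lambda>(a, b). box a (b::real)))"
      by (auto simp: Int_stable_def Int_interval)
    moreover have "range (\<lambda>(a, b). box a (b::real)) \<subseteq> Pow UNIV" by simp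
    moreover have "A \<in> sigma_sets UNIV (range (\<lambda>(a, b). box a (b::real)))"
      using that by (simp add: borel_eq_box)
    ultimately show ?thesis
    proof (induction rule: sigma_sets_induct_disjoint)
      case (basic A)
      then show ?case using integral_open_interval_zero[OF T f zero] by auto
    next
      case (compl A)
      then have A: "A \<in> sets borel" by (simp add: borel_eq_box)
      have "(LINT t|?M. f t) = (LINT t|?M. indicator {-1<..<T+1} t * f t)"
        by (intro Bochner_Integration.integral_cong) (auto simp: indicator_def)
      then have f0: "(LINT t|?M. f t) = 0" using integral_open_interval_zero[OF T f zero] by simp
      have "(LINT t|?M. indicator (UNIV - A) t * f t) = (LINT t|?M. f t - indicator A t * f t)"
        by (intro Bochner_Integration.integral_cong) (auto simp: indicator_def)
      then show ?case using f0 compl int[OF A] f by simp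
    next
      case (union A)
      then have A: "A i \<in> sets borel" for i by (auto simp: borel_eq_box)
      have "(\<lambda>n. LINT t|?M. indicator (\<Union>i<n. A i) t * f t) \<longlonglongrightarrow> (LINT t|?M. indicator (\<Union>i. A i) t * f t)"
      proof (rule integral_dominated_convergence[where w = "\<lambda>t. norm (f t)"])
        show "(\<lambda>t. indicator (\<Union>i. A i) t * f t) \<in> borel_measurable ?M"
          using int[of "\<Union>i. A i"] A by auto
        show "(\<lambda>t. indicator (\<Union>i<n. A i) t * f t) \<in> borel_measurable ?M" for n
          using int[of "\<Union>i<n. A i"] A by auto
        show "integrable ?M (\<lambda>t. norm (f t))" using f by simp
        show "AE t in ?M. norm (indicator (\<Union>i<n. A i) t * f t) \<le> norm (f t)" for n
          by (intro AE_I2) (auto simp: indicator_def)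
        show "AE t in ?M. (\<lambda>n. indicator (\<Union>i<n. A i) t * f t) \<longlonglongrightarrow> indicator (\<Union>i. A i) t * f t"
          by (intro AE_I2 tendsto_mult tendsto_const LIMSEQ_indicator_UN)
      qed
      moreover have "(LINT t|?M. indicator (\<Union>i<n. A i) t * f t) = 0" for n
      proof (induction n)
        case (Suc n)
        have "(LINT t|?M. indicator (\<Union>i<Suc n. A i) t * f t)
            = (LINT t|?M. indicator (\<Union>i<n. A i) t * f t + indicator (A n) t * f t)"
        proof (intro Bochner_Integration.integral_cong refl)
          fix t
          have "t \<notin> A n" if "t \<in> A i" "i < n" for i
            using disjoint_family_onD[OF union(1), of i n] that by auto
          then show "indicator (\<Union>i<Suc n. A i) t * f t = indicator (\<Union>i<n. A i) t * f t + indicator (A n) t * f t"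
            by (auto simp: indicator_def less_Suc_eq)
        qed
        then show ?case using Suc union(3)[of n] int[OF A] int[of "\<Union>i<n. A i"] A by auto
      qed simp
      ultimately show ?case by (simp add: LIMSEQ_const_iff)
    qed auto
  qed
  \<comment> \<open>a Borel version of \<open>f\<close> makes the sets where it is positive or negative Borel sets\<close>
  have fm: "(\<lambda>t. if t \<in> {0<..<T} then f t else 0) \<in> borel_measurable lebesgue"
    using f by (subst borel_measurable_if_I) auto
  obtain g where g: "g \<in> borel_measurable lborel" and fg: "AE t in lborel. (if t \<in> {0<..<T} then f t else 0) = g t"
    using completion_ex_borel_measurable_real[OF fm] by blast
  have "AE t in lebesgue. (if t \<in> {0<..<T} then f t else 0) = g t"
    using fg by (simp add: AE_completion)
  then have fg': "AE t in ?M. f t = g t"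
    by (subst AE_restrict_space_iff) (auto elim!: eventually_mono)
  have half: "AE t in ?M. \<sigma> * f t \<le> 0" for \<sigma> :: real
  proof -
    let ?A = "{t. \<sigma> * g t > 0}"
    have A: "?A \<in> sets borel" using g by measurable
    have i: "integrable ?M (\<lambda>t. \<sigma> * (indicator ?A t * f t))" using int[OF A] by simp
    have "(LINT t|?M. \<sigma> * (indicator ?A t * f t)) = 0" using borel0[OF A] by simp
    moreover have "AE t in ?M. 0 \<le> \<sigma> * (indicator ?A t * f t)"
      using fg' by eventually_elim (auto simp: indicator_def)
    ultimately have "AE t in ?M. \<sigma> * (indicator ?A t * f t) = 0"
      using integral_nonneg_eq_0_iff_AE[OF i] by blast
    with fg' show ?thesis by eventually_elim (auto simp: indicator_def split: if_splits)
  qed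
  from half[of 1] half[of "-1"] show ?thesis by eventually_elim auto
qed

lemma inner_countable_separating:
  obtains D :: "'b::{real_inner,second_countable_topology} set"
    where "countable D" "\<And>x. (\<And>d. d \<in> D \<Longrightarrow> x \<bullet> d = 0) \<Longrightarrow> x = 0"
proof -
  obtain D :: "'b set" where D: "countable D" "\<And>U. open U \<Longrightarrow> U \<noteq> {} \<Longrightarrow> \<exists>d\<in>D. d \<in> U"
    by (erule countable_dense_setE)
  have "x = 0" if x: "\<And>d. d \<in> D \<Longrightarrow> x \<bullet> d = 0" for x
  proof (rule ccontr)
    assume "x \<noteq> 0"
    have "open ((\<lambda>y. x \<bullet> y) -` {0<..})" by (intro open_vimage continuous_intros)
    moreover have "x \<in> (\<lambda>y. x \<bullet> y) -` {0<..}" using \<open>x \<noteq> 0\<close> by simp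
    ultimately obtain d where "d \<in> D" "0 < x \<bullet> d" using D(2) by blast
    then show False using x by force
  qed
  then show ?thesis using that D by blast
qed

lemma AE_zero_if_inner_AE_zero:
  fixes f :: "'a \<Rightarrow> 'b::{real_inner,second_countable_topology}"
  assumes "\<And>d. AE t in M. f t \<bullet> d = 0"
  shows "AE t in M. f t = 0"
proof -
  obtain D :: "'b set" where D: "countable D" "\<And>x. (\<And>d. d \<in> D \<Longrightarrow> x \<bullet> d = 0) \<Longrightarrow> x = 0"
    using inner_countable_separating by metis
  have "AE t in M. \<forall>d\<in>D. f t \<bullet> d = 0" using assms D(1) by (simp add: AE_ball_countable)
  then show ?thesis by eventually_elim (use D(2) in blast)
qed

lemma fundamental_lemma:
  fixes f :: "real \<Rightarrow> 'b::{real_inner,banach,second_countable_topology}"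
  assumes T: "0 < T" and f: "integrable (lebesgue_on {0<..<T}) f"
    and zero: "\<And>\<phi> d. \<phi> \<in> test_functions T \<Longrightarrow> (LINT t|lebesgue_on {0<..<T}. \<phi> t * (f t \<bullet> d)) = 0"
  shows "AE t in lebesgue_on {0<..<T}. f t = 0"
proof (rule AE_zero_if_inner_AE_zero)
  show "AE t in lebesgue_on {0<..<T}. f t \<bullet> d = 0" for d
    by (rule fundamental_lemma_real[OF T integrable_inner_left[OF f] zero])
qed

section \<open>The Gram operator of the embedding\<close>

text \<open>
  Self-adjoint operators between \<open>0\<close> and the identity. The last assumption says that \<open>N (1 - N)\<close> is
  nonnegative, which is how the upper bound is used.
\<close>

locale nonneg_contraction =
  fixes N :: "'a::{real_inner,banach} \<Rightarrow> 'a"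
  assumes lin: "bounded_linear N"
    and sym: "N x \<bullet> y = x \<bullet> N y"
    and nonneg: "0 \<le> N x \<bullet> x"
    and contr: "N x \<bullet> N x \<le> N x \<bullet> x"
begin

lemma norm_le: "norm (N x) \<le> norm x"
proof -
  have "norm (N x) * norm (N x) \<le> norm (N x) * norm x"
    using contr[of x] Cauchy_Schwarz_ineq2[of "N x" x]
    by (simp flip: power2_norm_eq_inner) (simp add: power2_eq_square)
  then show ?thesis by (cases "norm (N x) = 0") auto
qed

lemma pow_bounded_linear: "bounded_linear (N ^^ n)"
  by (induction n) (auto simp: id_def o_def intro: bounded_linear_ident bounded_linear_compose[OF lin])

lemma pow_norm_le: "norm ((N ^^ n) x) \<le> norm x"
  by (induction n) (auto intro: order_trans[OF norm_le])

lemma pow_sym: "(N ^^ n) x \<bullet> y = x \<bullet> (N ^^ n) y"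
proof (induction n arbitrary: x y)
  case (Suc n)
  then show ?case by (simp add: sym funpow_swap1)
qed simp

lemma pow_inner: "(N ^^ m) x \<bullet> (N ^^ n) x = (N ^^ (m + n)) x \<bullet> x"
  by (metis funpow_add inner_commute o_apply pow_sym)

lemma moment_decreasing: "(N ^^ Suc n) x \<bullet> x \<le> (N ^^ n) x \<bullet> x"
proof (cases "even n")
  case True
  then obtain k where k: "n = k + k" by (metis evenE mult_2)
  have "N ((N ^^ k) x) \<bullet> (N ^^ k) x \<le> (N ^^ k) x \<bullet> (N ^^ k) x"
    using norm_cauchy_schwarz[of "N ((N ^^ k) x)" "(N ^^ k) x"]
      mult_right_mono[OF norm_le[of "(N ^^ k) x"] norm_ge_zero[of "(N ^^ k) x"]]
    by (simp flip: power2_norm_eq_inner) (simp add: power2_eq_square)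
  then show ?thesis
    using pow_inner[of "Suc k" x k] pow_inner[of k x k] k by simp
next
  case False
  then obtain k where k: "n = Suc (k + k)" by (metis oddE mult_2 Suc_eq_plus1)
  show ?thesis
    using contr[of "(N ^^ k) x"] pow_inner[of "Suc k" x k] pow_inner[of "Suc k" x "Suc k"] k by simp
qed

text \<open>
  The moments \<open>(N ^^ n) x \<bullet> x\<close> decrease and are nonnegative, so they converge, and the square of the
  distance of two powers applied to \<open>x\<close> is a combination of moments.
\<close>

lemma pow_convergent_fixpoint:
  obtains p where "(\<lambda>n. (N ^^ n) x) \<longlonglongrightarrow> p" "N p = p"
proof -
  define m where "m n = (N ^^ n) x \<bullet> x" for n
  have "0 \<le> m n" for n
  proof (cases "even n")
    case True
    then obtain k where "n = k + k" by (metis evenE mult_2)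
    then show ?thesis unfolding m_def by (simp flip: pow_inner)
  next
    case False
    then obtain k where "n = Suc k + k" by (metis oddE mult_2 Suc_eq_plus1 add_Suc)
    then show ?thesis unfolding m_def using nonneg[of "(N ^^ k) x"] pow_inner[of "Suc k" x k] by simp
  qed
  moreover have "decseq m"
    by (rule decseq_SucI) (simp add: m_def moment_decreasing del: funpow.simps)
  ultimately obtain L where L: "m \<longlonglongrightarrow> L" "\<And>n. L \<le> m n"
    using decseq_convergent by metis
  have "Cauchy (\<lambda>n. (N ^^ n) x)"
  proof (rule metric_CauchyI)
    fix e :: real assume e: "0 < e"
    then have "\<forall>\<^sub>F n in sequentially. m n < L + e\<^sup>2 / 2"
      by (intro order_tendstoD(2)[OF L(1)]) auto
    then obtain M where M: "\<And>n. M \<le> n \<Longrightarrow> m n < L + e\<^sup>2 / 2"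
      unfolding eventually_sequentially by blast
    show "\<exists>M. \<forall>i\<ge>M. \<forall>j\<ge>M. dist ((N ^^ i) x) ((N ^^ j) x) < e"
    proof (intro exI allI impI)
      fix i j assume ij: "M \<le> i" "M \<le> j"
      have "(norm ((N ^^ i) x - (N ^^ j) x))\<^sup>2 = m (i + i) - 2 * m (i + j) + m (j + j)"
        by (simp add: power2_norm_eq_inner inner_diff_left inner_diff_right pow_inner m_def add.commute)
      also have "\<dots> < e\<^sup>2"
        using M[of "i + i"] M[of "j + j"] L(2)[of "i + j"] ij by simp
      finally show "dist ((N ^^ i) x) ((N ^^ j) x) < e"
        using e by (simp add: dist_norm power_less_imp_less_base)
    qed
  qed
  then obtain p where p: "(\<lambda>n. (N ^^ n) x) \<longlonglongrightarrow> p" using Cauchy_convergent convergent_def by blast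
  have "(\<lambda>n. N ((N ^^ n) x)) \<longlonglongrightarrow> N p" by (rule bounded_linear.tendsto[OF lin p])
  moreover have "(\<lambda>n. N ((N ^^ n) x)) \<longlonglongrightarrow> p" using LIMSEQ_Suc[OF p] by simp
  ultimately show ?thesis using that p LIMSEQ_unique by blast
qed

end

text \<open>
  A bounded injective linear map between Hilbert spaces; neither density nor compactness is needed here.
\<close>

locale hilbert_embedding =
  fixes j :: "'v::{real_inner,banach,second_countable_topology} \<Rightarrow> 'h::{real_inner,banach,second_countable_topology}"
  assumes bl_j: "bounded_linear j" and inj_j: "inj j"
begin

interpretation j: bounded_linear j by (rule bl_j)

text \<open>
  The operator \<open>j' j\<close>, where \<open>'v\<close> is identified with its dual by the Riesz isomorphism: \<open>gram x\<close>
  represents \<open>j x\<close> as a functional on \<open>'v\<close>.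
\<close>

definition gram :: "'v \<Rightarrow> 'v" where
  "gram x = riesz (blinfun_inner_left (j x) o\<^sub>L Blinfun j)"

lemma gram_inner: "gram x \<bullet> y = j x \<bullet> j y"
  unfolding gram_def riesz by (simp add: bounded_linear_Blinfun_apply bl_j inner_commute)

lemma gram_sym: "gram x \<bullet> y = x \<bullet> gram y"
  by (metis gram_inner inner_commute)

lemma gram_eq_0: "gram x = 0 \<Longrightarrow> x = 0"
proof -
  assume "gram x = 0"
  then have "j x \<bullet> j x = 0" using gram_inner[of x x] by simp
  then have "j x = j 0" by (simp add: j.zero)
  then show "x = 0" by (rule injD[OF inj_j])
qed

text \<open>
  Some positive bound of the norm of \<open>j\<close>.
\<close>

definition jbound :: real where "jbound = (SOME K. 0 < K \<and> (\<forall>x. norm (j x) \<le> norm x * K))"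

lemma jbound: "0 < jbound" "norm (j x) \<le> norm x * jbound"
proof -
  have "\<exists>K. 0 < K \<and> (\<forall>x. norm (j x) \<le> norm x * K)" using j.pos_bounded by blast
  from someI_ex[OF this] show "0 < jbound" "norm (j x) \<le> norm x * jbound" by (auto simp: jbound_def)
qed

lemma norm_gram_j: "norm (gram x) \<le> jbound * norm (j x)"
proof -
  have "norm (gram x) * norm (gram x) = j x \<bullet> j (gram x)"
    by (simp flip: gram_inner add: power2_norm_eq_inner[symmetric]) (simp add: power2_eq_square)
  also have "\<dots> \<le> norm (j x) * (norm (gram x) * jbound)"
    by (intro order_trans[OF norm_cauchy_schwarz] mult_left_mono jbound) auto
  finally show ?thesis by (cases "norm (gram x) = 0") (auto simp: jbound(1) less_imp_le mult_ac)
qed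

lemma bounded_linear_gram: "bounded_linear gram"
proof (rule bounded_linear_intro[where K = "jbound * jbound"])
  show "gram (x + y) = gram x + gram y" for x y
    by (rule vector_eq_rdot[THEN iffD1]) (simp add: gram_inner inner_add_left j.add)
  show "gram (r *\<^sub>R x) = r *\<^sub>R gram x" for r x
    by (rule vector_eq_rdot[THEN iffD1]) (simp add: gram_inner j.scaleR)
  show "norm (gram x) \<le> norm x * (jbound * jbound)" for x
    using order_trans[OF norm_gram_j mult_left_mono[OF jbound(2)[of x]]] jbound(1) by (simp add: mult_ac)
qed

text \<open>
  With this step size \<open>damp\<close>, the identity minus a multiple of \<open>gram\<close>, lies between \<open>0\<close> and the
  identity.
\<close>

definition kap :: real where "kap = 1 / jbound\<^sup>2"

definition damp :: "'v \<Rightarrow> 'v" where "damp x = x - kap *\<^sub>R gram x"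

lemma kap_pos: "0 < kap" using jbound by (simp add: kap_def)

lemma kap_gram_le: "kap * (gram x \<bullet> gram x) \<le> gram x \<bullet> x"
proof -
  have "(norm (gram x))\<^sup>2 \<le> jbound\<^sup>2 * (norm (j x))\<^sup>2"
    using power_mono[OF norm_gram_j norm_ge_zero, of x 2] by (simp add: power_mult_distrib)
  then show ?thesis using jbound(1)
    by (simp add: kap_def gram_inner[of x x] power2_norm_eq_inner divide_simps mult.commute)
qed

lemma bounded_linear_damp: "bounded_linear damp"
  unfolding damp_def[abs_def]
  by (intro bounded_linear_sub bounded_linear_ident
      bounded_linear_compose[OF bounded_linear_scaleR_right bounded_linear_gram])

lemma kap_gram_le_self: "kap * (gram x \<bullet> x) \<le> x \<bullet> x"
proof -
  have "gram x \<bullet> x = j x \<bullet> j x" by (rule gram_inner)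
  also have "\<dots> \<le> (norm x)\<^sup>2 * jbound\<^sup>2"
    using power_mono[OF jbound(2)[of x] norm_ge_zero, of 2] by (simp add: power2_norm_eq_inner power_mult_distrib)
  finally show ?thesis using jbound(1) by (simp add: kap_def power2_norm_eq_inner divide_simps mult.commute)
qed

lemma damp_contr: "damp x \<bullet> damp x \<le> damp x \<bullet> x"
proof -
  have "damp x \<bullet> x - damp x \<bullet> damp x = kap * (gram x \<bullet> x - kap * (gram x \<bullet> gram x))"
    by (simp add: damp_def inner_diff_left inner_diff_right inner_commute[of x "gram x"] algebra_simps)
  moreover have "0 \<le> kap * (gram x \<bullet> x - kap * (gram x \<bullet> gram x))" using kap_gram_le[of x] kap_pos by simp
  ultimately show ?thesis by simp
qed

sublocale damp: nonneg_contraction damp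
proof (rule nonneg_contraction.intro, rule bounded_linear_damp)
  show "damp x \<bullet> y = x \<bullet> damp y" for x y
    by (simp add: damp_def inner_diff_left inner_diff_right gram_sym)
  show "0 \<le> damp x \<bullet> x" for x
    using kap_gram_le_self[of x] by (simp add: damp_def inner_diff_left)
  show "damp x \<bullet> damp x \<le> damp x \<bullet> x" for x by (rule damp_contr)
qed

lemma damp_pow_tendsto_0: "(\<lambda>n. (damp ^^ n) x) \<longlonglongrightarrow> 0"
proof -
  obtain p where p: "(\<lambda>n. (damp ^^ n) x) \<longlonglongrightarrow> p" "damp p = p"
    by (rule damp.pow_convergent_fixpoint)
  then have "kap *\<^sub>R gram p = 0" by (simp add: damp_def)
  then have "p = 0" using kap_pos gram_eq_0 by simp
  then show ?thesis using p by simp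
qed

text \<open>
  Bounded approximate inverses of \<open>gram\<close>: the partial sums of the Neumann series of its inverse. They
  satisfy \<open>resolv n (gram x) = x - (damp ^^ n) x\<close>, which tends to \<open>x\<close>.
\<close>

definition resolv :: "nat \<Rightarrow> 'v \<Rightarrow> 'v" where
  "resolv n x = kap *\<^sub>R (\<Sum>i<n. (damp ^^ i) x)"

lemma bounded_linear_resolv: "bounded_linear (resolv n)"
  unfolding resolv_def[abs_def]
  by (intro bounded_linear_compose[OF bounded_linear_scaleR_right] bounded_linear_sum damp.pow_bounded_linear)

lemma resolv_sym: "resolv n x \<bullet> y = x \<bullet> resolv n y"
  by (simp add: resolv_def inner_sum_left inner_sum_right damp.pow_sym)

lemma gram_damp_pow: "gram ((damp ^^ n) x) = (damp ^^ n) (gram x)"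
proof (induction n arbitrary: x)
  case (Suc n)
  have "gram (damp y) = damp (gram y)" for y
    using bounded_linear_gram by (simp add: damp_def linear_simps)
  then show ?case using Suc by simp
qed simp

lemma resolv_gram: "resolv n (gram x) = x - (damp ^^ n) x"
proof (induction n)
  case (Suc n)
  have "resolv (Suc n) (gram x) = resolv n (gram x) + kap *\<^sub>R (damp ^^ n) (gram x)"
    by (simp add: resolv_def scaleR_right_distrib)
  also have "\<dots> = x - (damp ^^ n) x + kap *\<^sub>R gram ((damp ^^ n) x)"
    by (simp add: Suc gram_damp_pow)
  also have "\<dots> = x - (damp ^^ Suc n) x" by (simp add: damp_def)
  finally show ?case .
qed (simp add: resolv_def)

end

section \<open>A product rule for indefinite integrals\<close>

lemma integrable_indicator_mult:
  fixes f :: "real \<Rightarrow> 'b::{banach,second_countable_topology}"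
  assumes "integrable (lebesgue_on {0<..<T}) f" "A \<in> sets borel"
  shows "integrable (lebesgue_on {0<..<T}) (\<lambda>s. indicator A s *\<^sub>R f s)"
  by (rule integrable_interval_bounded_mult[OF assms(1), where B = 1])
    (use assms(2) in \<open>auto simp: indicator_def\<close>)

lemma cumint_continuous:
  fixes f :: "real \<Rightarrow> 'b::{banach,second_countable_topology}"
  assumes f: "integrable (lebesgue_on {0<..<T}) f"
  shows "continuous_on A (cumint T f)"
proof -
  have "isCont (cumint T f) t" for t
    unfolding continuous_at_sequentially
  proof (intro allI impI)
    fix x :: "nat \<Rightarrow> real" assume x: "x \<longlonglongrightarrow> t"
    show "(cumint T f \<circ> x) \<longlonglongrightarrow> cumint T f t"
      unfolding cumint_def o_def
    proof (rule integral_dominated_convergence[where w = "\<lambda>t. norm (f t)"])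
      show "(\<lambda>s. indicator {..<t} s *\<^sub>R f s) \<in> borel_measurable (lebesgue_on {0<..<T})"
        using integrable_indicator_mult[OF f, of "{..<t}"] by auto
      show "(\<lambda>s. indicator {..<x n} s *\<^sub>R f s) \<in> borel_measurable (lebesgue_on {0<..<T})" for n
        using integrable_indicator_mult[OF f, of "{..<x n}"] by auto
      show "AE s in lebesgue_on {0<..<T}. norm (indicator {..<x n} s *\<^sub>R f s) \<le> norm (f s)" for n
        by (intro AE_I2) (auto simp: indicator_def)
      have "AE s in lborel. s \<noteq> t" by (rule AE_lborel_singleton)
      then have "AE s in lebesgue_on {0<..<T}. s \<noteq> t"
        by (subst AE_restrict_space_iff) (auto intro: AE_completion)
      then show "AE s in lebesgue_on {0<..<T}. (\<lambda>n. indicator {..<x n} s *\<^sub>R f s) \<longlonglongrightarrow> indicator {..<t} s *\<^sub>R f s"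
      proof eventually_elim
        case (elim s)
        have "\<forall>\<^sub>F n in sequentially. indicator {..<x n} s = (indicator {..<t} s :: real)"
        proof (cases "s < t")
          case True
          from order_tendstoD(1)[OF x this] show ?thesis by eventually_elim (use True in auto)
        next
          case False
          then have "t < s" using elim by simp
          from order_tendstoD(2)[OF x this] show ?thesis by eventually_elim (use False in auto)
        qed
        then have "\<forall>\<^sub>F n in sequentially. indicator {..<x n} s *\<^sub>R f s = indicator {..<t} s *\<^sub>R f s"
          by eventually_elim simp
        then show ?case by (rule tendsto_eventually)
      qed
    qed (use f in auto)
  qed
  then show ?thesis by (simp add: continuous_at_imp_continuous_on)
qed

lemma integrable_inner_times:
  fixes f g :: "real \<Rightarrow> 'b::{real_inner,banach,second_countable_topology}"
  assumes f: "integrable (lebesgue_on {0<..<T}) f" and g: "continuous_on UNIV g"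
  shows "integrable (lebesgue_on {0<..<T}) (\<lambda>s. f s \<bullet> g s)"
proof -
  have "bounded (g ` {0..T})"
    by (intro compact_imp_bounded compact_continuous_image continuous_on_subset[OF g]) auto
  then obtain B where B: "\<And>s. s \<in> {0..T} \<Longrightarrow> norm (g s) \<le> B" unfolding bounded_iff by blast
  have gm: "g \<in> borel_measurable (lebesgue_on {0<..<T})"
    using borel_measurable_continuous_onI[OF g] measurable_compose[OF measurable_interval_id] by blast
  show ?thesis
  proof (rule Bochner_Integration.integrable_bound)
    show "integrable (lebesgue_on {0<..<T}) (\<lambda>s. B * norm (f s))" using f by simp
    show "(\<lambda>s. f s \<bullet> g s) \<in> borel_measurable (lebesgue_on {0<..<T})" using f gm by measurable
    show "AE s in lebesgue_on {0<..<T}. norm (f s \<bullet> g s) \<le> norm (B * norm (f s))"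
    proof (rule AE_I2)
      fix s assume "s \<in> space (lebesgue_on {0<..<T})"
      then have "norm (g s) \<le> B" using B[of s] by simp
      then have "norm (f s) * norm (g s) \<le> norm (f s) * B" by (intro mult_left_mono) auto
      then show "norm (f s \<bullet> g s) \<le> norm (B * norm (f s))"
        using Cauchy_Schwarz_ineq2[of "f s" "g s"] by (simp add: mult.commute)
    qed
  qed
qed

text \<open>Fubini's theorem on the triangle \<open>s < t\<close>.\<close>

lemma fubini_triangle:
  fixes f g :: "real \<Rightarrow> 'b::{real_inner,banach,second_countable_topology}"
  assumes f: "integrable (lebesgue_on {0<..<T}) f" and g: "integrable (lebesgue_on {0<..<T}) g"
  shows "(LINT t|lebesgue_on {0<..<T}. f t \<bullet> cumint T g t) =
    (LINT s|lebesgue_on {0<..<T}. (cumint T f T - cumint T f s) \<bullet> g s)"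
proof -
  let ?M = "lebesgue_on {0<..<T}"
  interpret M: finite_measure ?M by (rule finite_measure_interval)
  interpret P: pair_sigma_finite ?M ?M ..
  let ?k = "\<lambda>t s. (indicator {..<t} s :: real) * (f t \<bullet> g s)"
  have fm [measurable]: "f \<in> borel_measurable ?M" and gm [measurable]: "g \<in> borel_measurable ?M" using f g by auto
  have [measurable]: "(\<lambda>p. indicator {..<fst p} (snd p) :: real) \<in> borel_measurable (?M \<Otimes>\<^sub>M ?M)"
  proof -
    have "(\<lambda>p. if snd p < fst p then 1 else 0 :: real) \<in> borel_measurable (?M \<Otimes>\<^sub>M ?M)" by measurable
    then show ?thesis by (simp add: indicator_def)
  qed
  have int: "integrable (?M \<Otimes>\<^sub>M ?M) (case_prod ?k)"
  proof (rule P.Fubini_integrable)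
    show "case_prod ?k \<in> borel_measurable (?M \<Otimes>\<^sub>M ?M)"
      unfolding case_prod_beta by measurable
    have b: "norm (case_prod ?k (t, s)) \<le> norm (f t) * norm (g s)" for t s
      using Cauchy_Schwarz_ineq2[of "f t" "g s"] by (auto simp: indicator_def)
    show "AE t in ?M. integrable ?M (\<lambda>s. case_prod ?k (t, s))"
    proof (rule AE_I2)
      fix t
      show "integrable ?M (\<lambda>s. case_prod ?k (t, s))"
        using integrable_indicator_mult[of T "\<lambda>s. f t \<bullet> g s" "{..<t}"] g by simp
    qed
    then show "integrable ?M (\<lambda>t. LINT s|?M. norm (case_prod ?k (t, s)))"
    proof -
      have "integrable ?M (\<lambda>t. norm (f t) * (LINT s|?M. norm (g s)))" using f by simp
      then show ?thesis
      proof (rule Bochner_Integration.integrable_bound)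
        show "(\<lambda>t. LINT s|?M. norm (case_prod ?k (t, s))) \<in> borel_measurable ?M"
          unfolding case_prod_beta by measurable
        have "(LINT s|?M. norm (case_prod ?k (t, s))) \<le> norm (f t) * (LINT s|?M. norm (g s))" for t
        proof -
          have "(LINT s|?M. norm (case_prod ?k (t, s))) \<le> (LINT s|?M. norm (f t) * norm (g s))"
            using integrable_indicator_mult[of T "\<lambda>s. f t \<bullet> g s" "{..<t}"] g b
            by (intro integral_mono) auto
          then show ?thesis by simp
        qed
        then show "AE t in ?M. norm (LINT s|?M. norm (case_prod ?k (t, s))) \<le> norm (norm (f t) * (LINT s|?M. norm (g s)))"
          by (intro AE_I2) (simp add: integral_nonneg_AE abs_of_nonneg)
      qed
    qed
  qed
  have "(LINT t|?M. f t \<bullet> cumint T g t) = (LINT t|?M. LINT s|?M. ?k t s)"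
  proof (intro Bochner_Integration.integral_cong refl)
    fix t
    have "f t \<bullet> cumint T g t = (LINT s|?M. f t \<bullet> (indicator {..<t} s *\<^sub>R g s))"
      unfolding cumint_def by (subst integral_inner_right) (auto intro: integrable_indicator_mult g)
    then show "f t \<bullet> cumint T g t = (LINT s|?M. ?k t s)" by simp
  qed
  also have "\<dots> = (LINT s|?M. LINT t|?M. ?k t s)"
    using P.Fubini_integral[OF int] by simp
  also have "\<dots> = (LINT s|?M. (cumint T f T - cumint T f s) \<bullet> g s)"
  proof (intro Bochner_Integration.integral_cong refl)
    fix s assume s: "s \<in> space ?M"
    have i: "integrable ?M (\<lambda>t. indicator {..<r} t *\<^sub>R f t)" for r
      by (rule integrable_indicator_mult[OF f]) auto
    have "AE t in lborel. t \<noteq> s" by (rule AE_lborel_singleton)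
    then have ne: "AE t in ?M. t \<noteq> s"
      by (subst AE_restrict_space_iff) (auto intro: AE_completion)
    have sp: "AE t in ?M. t < T" by (rule AE_I2) simp
    have "(cumint T f T - cumint T f s) \<bullet> g s
        = (LINT t|?M. (indicator {..<T} t *\<^sub>R f t - indicator {..<s} t *\<^sub>R f t) \<bullet> g s)"
      unfolding cumint_def by (subst integral_inner_left) (auto intro: i simp: Bochner_Integration.integral_diff[OF i i])
    also have "\<dots> = (LINT t|?M. ?k t s)"
    proof (rule integral_cong_AE)
      show "AE t in ?M. (indicator {..<T} t *\<^sub>R f t - indicator {..<s} t *\<^sub>R f t) \<bullet> g s = ?k t s"
        using ne sp by eventually_elim (use s in \<open>auto simp: indicator_def\<close>)
      show "(\<lambda>t. (indicator {..<T} t *\<^sub>R f t - indicator {..<s} t *\<^sub>R f t) \<bullet> g s) \<in> borel_measurable ?M"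
        by measurable
      have "(\<lambda>t. if s < t then f t \<bullet> g s else 0) \<in> borel_measurable ?M" by measurable
      then show "(\<lambda>t. ?k t s) \<in> borel_measurable ?M"
        by (rule back_subst) (auto simp: indicator_def)
    qed
    finally show "(LINT t|?M. ?k t s) = (cumint T f T - cumint T f s) \<bullet> g s" by simp
  qed
  finally show ?thesis .
qed

lemma cumint_cumint:
  fixes f :: "real \<Rightarrow> 'b::{banach,second_countable_topology}"
  shows "cumint T (\<lambda>s. indicator {..<t} s *\<^sub>R f s) r = cumint T f (min r t)"
  unfolding cumint_def
  by (intro Bochner_Integration.integral_cong) (auto simp: indicator_def)

text \<open>
  The product rule for \<open>L W \<bullet> W\<close> with \<open>W\<close> an indefinite integral and \<open>L\<close> self-adjoint, in
  integrated form.
\<close>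

lemma quadratic_form_cumint:
  fixes w :: "real \<Rightarrow> 'b::{real_inner,banach,second_countable_topology}"
  assumes w: "integrable (lebesgue_on {0<..<T}) w" and L: "bounded_linear L"
    and sym: "\<And>x y. L x \<bullet> y = x \<bullet> L y" and t: "t \<le> T"
  shows "L (x0 + cumint T w t) \<bullet> (x0 + cumint T w t) =
    L x0 \<bullet> x0 + 2 * cumint T (\<lambda>s. w s \<bullet> L (x0 + cumint T w s)) t"
proof -
  let ?M = "lebesgue_on {0<..<T}"
  interpret L: bounded_linear L by (rule L)
  define I where "I = cumint T w"
  have Icont: "continuous_on UNIV I" unfolding I_def by (rule cumint_continuous[OF w])
  have LI: "continuous_on UNIV (\<lambda>s. L (I s))" by (intro L.continuous_on Icont)
  have Lw: "integrable ?M (\<lambda>s. L (w s))" by (rule integrable_bounded_linear[OF L w])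
  have cumL: "cumint T (\<lambda>s. L (w s)) r = L (I r)" for r
  proof -
    have "L (I r) = (LINT s|?M. L (indicator {..<r} s *\<^sub>R w s))"
      unfolding I_def cumint_def
      by (rule integral_bounded_linear[OF L, symmetric]) (auto intro: integrable_indicator_mult w)
    then show ?thesis by (simp add: cumint_def L.scaleR)
  qed
  define A where "A = cumint T (\<lambda>s. w s \<bullet> L (I s)) t"
  \<comment> \<open>Fubini on the triangle turns the integral \<open>A\<close> over \<open>s < r\<close> into the one over \<open>r < s\<close>\<close>
  have A: "A = L (I t) \<bullet> I t - A"
  proof -
    let ?f = "\<lambda>s. indicator {..<t} s *\<^sub>R L (w s)" and ?g = "\<lambda>s. indicator {..<t} s *\<^sub>R w s"
    have i: "integrable ?M (\<lambda>s. indicator {..<t} s * (w s \<bullet> L (I s)))" "integrable ?M (\<lambda>s. indicator {..<t} s * (w s \<bullet> L (I t)))"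
      using integrable_indicator_mult[OF integrable_inner_times[OF w LI], of "{..<t}"]
        integrable_indicator_mult[of T "\<lambda>s. w s \<bullet> L (I t)" "{..<t}"] w by auto
    have "A = (LINT s|?M. ?f s \<bullet> cumint T ?g s)"
      unfolding A_def cumint_cumint by (subst cumint_def, intro Bochner_Integration.integral_cong)
        (auto simp: indicator_def I_def sym min_def)
    also have "\<dots> = (LINT s|?M. (cumint T ?f T - cumint T ?f s) \<bullet> ?g s)"
      by (rule fubini_triangle) (auto intro: integrable_indicator_mult Lw w)
    also have "\<dots> = (LINT s|?M. indicator {..<t} s * (w s \<bullet> L (I t)) - indicator {..<t} s * (w s \<bullet> L (I s)))"
      unfolding cumint_cumint cumL using t
      by (intro Bochner_Integration.integral_cong)
        (auto simp: indicator_def min_def inner_diff_left inner_diff_right inner_commute)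
    also have "\<dots> = (LINT s|?M. indicator {..<t} s * (w s \<bullet> L (I t))) - A"
      using i by (simp add: A_def cumint_def)
    also have "(LINT s|?M. indicator {..<t} s * (w s \<bullet> L (I t))) = I t \<bullet> L (I t)"
    proof -
      have "I t \<bullet> L (I t) = (LINT s|?M. (indicator {..<t} s *\<^sub>R w s) \<bullet> L (I t))"
        unfolding I_def by (subst (1) cumint_def, rule integral_inner_left[symmetric]) (auto intro: integrable_indicator_mult w)
      then show ?thesis by simp
    qed
    finally show ?thesis by (simp add: inner_commute)
  qed
  have B: "cumint T (\<lambda>s. w s \<bullet> L x0) t = I t \<bullet> L x0"
  proof -
    have "I t \<bullet> L x0 = (LINT s|?M. (indicator {..<t} s *\<^sub>R w s) \<bullet> L x0)"
      unfolding I_def by (subst (1) cumint_def, rule integral_inner_left[symmetric]) (auto intro: integrable_indicator_mult w)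
    then show ?thesis by (simp add: cumint_def)
  qed
  have "cumint T (\<lambda>s. w s \<bullet> L (x0 + I s)) t = cumint T (\<lambda>s. w s \<bullet> L x0) t + A"
  proof -
    have "cumint T (\<lambda>s. w s \<bullet> L (x0 + I s)) t
      = (LINT s|?M. indicator {..<t} s *\<^sub>R (w s \<bullet> L x0) + indicator {..<t} s *\<^sub>R (w s \<bullet> L (I s)))"
      unfolding cumint_def by (intro Bochner_Integration.integral_cong) (auto simp: L.add inner_add_right distrib_left)
    also have "\<dots> = cumint T (\<lambda>s. w s \<bullet> L x0) t + A"
      unfolding A_def cumint_def
      by (rule Bochner_Integration.integral_add; rule integrable_indicator_mult)
        (use integrable_inner_times[OF w LI] w in auto)
    finally show ?thesis .
  qed
  moreover have "L (x0 + I t) \<bullet> (x0 + I t) = L x0 \<bullet> x0 + 2 * (I t \<bullet> L x0) + L (I t) \<bullet> I t"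
    using sym[of "I t" x0] by (simp add: L.add inner_add_left inner_add_right inner_commute)
  ultimately show ?thesis using A B by (simp add: I_def)
qed

section \<open>Square integrable functions\<close>

lemma
  assumes "f \<in> L2 T"
  shows L2_measurable: "f \<in> borel_measurable (lebesgue_on {0<..<T})"
    and L2_norm_sq: "integrable (lebesgue_on {0<..<T}) (\<lambda>t. (norm (f t))\<^sup>2)"
  using assms by (auto simp: L2_def)

lemma integrable_mult_of_squares:
  fixes f g :: "'a \<Rightarrow> real"
  assumes "f \<in> borel_measurable M" "g \<in> borel_measurable M"
    and "integrable M (\<lambda>t. (f t)\<^sup>2)" "integrable M (\<lambda>t. (g t)\<^sup>2)"
  shows "integrable M (\<lambda>t. f t * g t)"
proof (rule Bochner_Integration.integrable_bound)
  show "integrable M (\<lambda>t. (f t)\<^sup>2 + (g t)\<^sup>2)" using assms by simp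
  show "(\<lambda>t. f t * g t) \<in> borel_measurable M" using assms by measurable
  show "AE t in M. norm (f t * g t) \<le> norm ((f t)\<^sup>2 + (g t)\<^sup>2)"
  proof (rule AE_I2)
    fix t
    have "2 * (\<bar>f t\<bar> * \<bar>g t\<bar>) \<le> (f t)\<^sup>2 + (g t)\<^sup>2"
      using sum_squares_bound[of "\<bar>f t\<bar>" "\<bar>g t\<bar>"] by simp
    moreover have "0 \<le> \<bar>f t\<bar> * \<bar>g t\<bar>" by simp
    ultimately have "\<bar>f t\<bar> * \<bar>g t\<bar> \<le> (f t)\<^sup>2 + (g t)\<^sup>2" by linarith
    then show "norm (f t * g t) \<le> norm ((f t)\<^sup>2 + (g t)\<^sup>2)"
      by (simp add: abs_mult)
  qed
qed

lemma L2_norm_mult_integrable: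
  assumes "f \<in> L2 T" "g \<in> L2 T"
  shows "integrable (lebesgue_on {0<..<T}) (\<lambda>t. norm (f t) * norm (g t))"
  using assms by (intro integrable_mult_of_squares) (auto simp: L2_def)

lemma L2_norm_integrable:
  assumes "f \<in> L2 T"
  shows "integrable (lebesgue_on {0<..<T}) (\<lambda>t. norm (f t))"
proof -
  interpret finite_measure "lebesgue_on {0<..<T}" by (rule finite_measure_interval)
  have "(\<lambda>_. 1::real) \<in> L2 T" by (simp add: L2_def)
  from L2_norm_mult_integrable[OF assms this] show ?thesis by simp
qed

lemma L2_integrable:
  fixes f :: "real \<Rightarrow> 'b::{banach,second_countable_topology}"
  assumes "f \<in> L2 T"
  shows "integrable (lebesgue_on {0<..<T}) f"
  using L2_norm_integrable[OF assms] L2_measurable[OF assms] by (simp add: integrable_norm_iff)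

lemma L2_inner_integrable:
  fixes f g :: "real \<Rightarrow> 'b::{real_inner,banach,second_countable_topology}"
  assumes "f \<in> L2 T" "g \<in> L2 T"
  shows "integrable (lebesgue_on {0<..<T}) (\<lambda>t. f t \<bullet> g t)"
proof (rule Bochner_Integration.integrable_bound[OF L2_norm_mult_integrable[OF assms]])
  show "(\<lambda>t. f t \<bullet> g t) \<in> borel_measurable (lebesgue_on {0<..<T})"
    using assms[THEN L2_measurable] by measurable
  show "AE t in lebesgue_on {0<..<T}. norm (f t \<bullet> g t) \<le> norm (norm (f t) * norm (g t))"
    by (intro AE_I2) (simp add: Cauchy_Schwarz_ineq2)
qed

lemma L2_bounded_by:
  fixes f :: "real \<Rightarrow> 'b::real_normed_vector" and g :: "real \<Rightarrow> 'c::real_normed_vector"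
  assumes g: "g \<in> L2 T" and f: "f \<in> borel_measurable (lebesgue_on {0<..<T})"
    and le: "AE t in lebesgue_on {0<..<T}. norm (f t) \<le> K * norm (g t)"
  shows "f \<in> L2 T"
proof -
  have "integrable (lebesgue_on {0<..<T}) (\<lambda>t. (norm (f t))\<^sup>2)"
  proof (rule Bochner_Integration.integrable_bound)
    show "integrable (lebesgue_on {0<..<T}) (\<lambda>t. K\<^sup>2 * (norm (g t))\<^sup>2)" using L2_norm_sq[OF g] by simp
    show "(\<lambda>t. (norm (f t))\<^sup>2) \<in> borel_measurable (lebesgue_on {0<..<T})" using f by measurable
    show "AE t in lebesgue_on {0<..<T}. norm ((norm (f t))\<^sup>2) \<le> norm (K\<^sup>2 * (norm (g t))\<^sup>2)"
      using le
    proof eventually_elim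
      case (elim t)
      from power_mono[OF this norm_ge_zero, of 2] show ?case by (simp add: power_mult_distrib)
    qed
  qed
  then show ?thesis using f by (simp add: L2_def)
qed

lemma L2_bounded_linear:
  assumes "bounded_linear L" "f \<in> L2 T"
  shows "(\<lambda>t. L (f t)) \<in> L2 T"
proof -
  obtain K where "\<And>x. norm (L x) \<le> norm x * K" using bounded_linear.bounded[OF assms(1)] by blast
  moreover have "(\<lambda>t. L (f t)) \<in> borel_measurable (lebesgue_on {0<..<T})"
    using measurable_compose[OF L2_measurable[OF assms(2)]
        borel_measurable_continuous_onI[OF linear_continuous_on[OF assms(1)]]] .
  ultimately show ?thesis
    by (intro L2_bounded_by[OF assms(2), where K = K]) (auto simp: mult.commute)
qed

lemma L2_add:
  fixes f g :: "real \<Rightarrow> 'b::{real_normed_vector,second_countable_topology}"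
  assumes "f \<in> L2 T" "g \<in> L2 T"
  shows "(\<lambda>t. f t + g t) \<in> L2 T"
proof -
  have m: "(\<lambda>t. f t + g t) \<in> borel_measurable (lebesgue_on {0<..<T})"
    using assms[THEN L2_measurable] by measurable
  have "integrable (lebesgue_on {0<..<T}) (\<lambda>t. (norm (f t + g t))\<^sup>2)"
  proof (rule Bochner_Integration.integrable_bound)
    show "integrable (lebesgue_on {0<..<T}) (\<lambda>t. (norm (f t))\<^sup>2 + 2 * (norm (f t) * norm (g t)) + (norm (g t))\<^sup>2)"
      using assms L2_norm_mult_integrable[OF assms] by (auto simp: L2_norm_sq)
    show "(\<lambda>t. (norm (f t + g t))\<^sup>2) \<in> borel_measurable (lebesgue_on {0<..<T})" using m by measurable
    show "AE t in lebesgue_on {0<..<T}. norm ((norm (f t + g t))\<^sup>2)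
        \<le> norm ((norm (f t))\<^sup>2 + 2 * (norm (f t) * norm (g t)) + (norm (g t))\<^sup>2)"
    proof (rule AE_I2)
      fix t
      have "(norm (f t + g t))\<^sup>2 \<le> (norm (f t) + norm (g t))\<^sup>2"
        by (intro power_mono norm_triangle_ineq) auto
      also have "\<dots> = (norm (f t))\<^sup>2 + 2 * (norm (f t) * norm (g t)) + (norm (g t))\<^sup>2"
        by (simp add: power2_sum)
      finally show "norm ((norm (f t + g t))\<^sup>2) \<le> norm ((norm (f t))\<^sup>2 + 2 * (norm (f t) * norm (g t)) + (norm (g t))\<^sup>2)"
        by simp
    qed
  qed
  then show ?thesis using m by (simp add: L2_def)
qed

lemma L2_scale:
  fixes f :: "real \<Rightarrow> 'b::real_normed_vector"
  shows "f \<in> L2 T \<Longrightarrow> (\<lambda>t. r *\<^sub>R f t) \<in> L2 T"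
  by (rule L2_bounded_linear[OF bounded_linear_scaleR_right])

lemma L2_lin:
  fixes f g :: "real \<Rightarrow> 'b::{real_normed_vector,second_countable_topology}"
  shows "f \<in> L2 T \<Longrightarrow> g \<in> L2 T \<Longrightarrow> (\<lambda>t. r *\<^sub>R f t + s *\<^sub>R g t) \<in> L2 T"
  by (intro L2_add L2_scale)

lemma L2_zero: "(\<lambda>t. 0) \<in> L2 T" by (simp add: L2_def)

lemma L2_riesz:
  fixes w :: "real \<Rightarrow> 'v::{real_inner,banach} \<Rightarrow>\<^sub>L real"
  shows "w \<in> L2 T \<Longrightarrow> (\<lambda>t. riesz (w t)) \<in> L2 T"
  by (rule L2_bounded_linear[OF bounded_linear_riesz])

lemma L2_of_riesz: "z \<in> L2 T \<Longrightarrow> (\<lambda>t. blinfun_inner_left (z t)) \<in> L2 T"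
  by (rule L2_bounded_linear[OF bounded_linear_blinfun_inner_left])

lemma riesz_inject: "riesz f = riesz g \<Longrightarrow> f = g"
  by (metis blinfun_eqI riesz)

text \<open>
  Closed balls are countable intersections of half-spaces, and open sets are countable unions of
  balls.
\<close>

lemma weakly_measurable_imp_measurable:
  fixes f :: "'a \<Rightarrow> 'b::{real_inner,second_countable_topology}"
  assumes "\<And>d. (\<lambda>t. f t \<bullet> d) \<in> borel_measurable M"
  shows "f \<in> borel_measurable M"
proof -
  obtain D :: "'b set" where D: "countable D" "\<And>U. open U \<Longrightarrow> U \<noteq> {} \<Longrightarrow> \<exists>d\<in>D. d \<in> U"
    by (erule countable_dense_setE)
  have norm_le_iff: "norm x \<le> r \<longleftrightarrow> (\<forall>d\<in>D. x \<bullet> d \<le> r * norm d)" if r: "0 \<le> r" for x :: 'b and r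
  proof
    assume "norm x \<le> r"
    then show "\<forall>d\<in>D. x \<bullet> d \<le> r * norm d"
      by (meson mult_right_mono norm_cauchy_schwarz norm_ge_zero order_trans)
  next
    assume *: "\<forall>d\<in>D. x \<bullet> d \<le> r * norm d"
    show "norm x \<le> r"
    proof (rule ccontr)
      assume "\<not> norm x \<le> r"
      then have nx: "r < norm x" by simp
      have "open ((\<lambda>y. x \<bullet> y - r * norm y) -` {0<..})" by (intro open_vimage continuous_intros)
      moreover have "r * norm x < norm x * norm x" using nx r by (intro mult_strict_right_mono) auto
      then have "x \<in> (\<lambda>y. x \<bullet> y - r * norm y) -` {0<..}"
        by (simp flip: power2_norm_eq_inner add: power2_eq_square)
      ultimately obtain d where "d \<in> D" "0 < x \<bullet> d - r * norm d" using D(2) by blast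
      then show False using * by force
    qed
  qed
  have ball: "f -` ball c r \<inter> space M \<in> sets M" for c r
  proof -
    have cb: "{t \<in> space M. norm (f t - c) \<le> q} \<in> sets M" if "0 \<le> q" for q
    proof -
      have "{t \<in> space M. norm (f t - c) \<le> q} = {t \<in> space M. \<forall>d\<in>D. f t \<bullet> d - c \<bullet> d \<le> q * norm d}"
        using norm_le_iff[OF that] by (auto simp: inner_diff_left)
      also have "\<dots> \<in> sets M" using assms D(1) by measurable
      finally show ?thesis .
    qed
    have "f -` ball c r \<inter> space M = (\<Union>q\<in>{q\<in>\<rat>. 0 \<le> q \<and> q < r}. {t \<in> space M. norm (f t - c) \<le> q})"
    proof (intro equalityI subsetI)
      fix t assume "t \<in> f -` ball c r \<inter> space M"
      then have t: "t \<in> space M" "norm (f t - c) < r" by (auto simp: dist_norm norm_minus_commute)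
      then obtain q where "q \<in> \<rat>" "norm (f t - c) < q" "q < r" using Rats_dense_in_real by blast
      then show "t \<in> (\<Union>q\<in>{q\<in>\<rat>. 0 \<le> q \<and> q < r}. {t \<in> space M. norm (f t - c) \<le> q})"
        using t norm_ge_zero[of "f t - c"] by (intro UN_I[of q]) (auto simp del: norm_ge_zero)
    qed (auto simp: dist_norm norm_minus_commute)
    also have "\<dots> \<in> sets M" using cb by (intro sets.countable_UN') (auto intro: countable_subset[OF _ countable_rat])
    finally show ?thesis .
  qed
  show ?thesis
  proof (rule borel_measurableI)
    fix S :: "'b set" assume S: "open S"
    let ?I = "{p \<in> D \<times> \<rat>. ball (fst p) (snd p) \<subseteq> S}"
    have "S = (\<Union>p\<in>?I. ball (fst p) (snd p))"
    proof (intro equalityI subsetI)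
      fix x assume "x \<in> S"
      then obtain e where e: "0 < e" "ball x e \<subseteq> S" using S open_contains_ball by blast
      obtain d where d: "d \<in> D" "d \<in> ball x (e / 3)" using D(2)[of "ball x (e/3)"] e(1) by auto
      obtain q where q: "q \<in> \<rat>" "e / 3 < q" "q < e / 2" using Rats_dense_in_real[of "e/3" "e/2"] e(1) by auto
      have "ball d q \<subseteq> ball x e"
      proof
        fix y assume "y \<in> ball d q"
        then have "dist x y < e / 3 + q" using d(2) dist_triangle[of x y d] by simp
        then show "y \<in> ball x e" using q(3) e(1) by simp
      qed
      then have "(d, q) \<in> ?I" using d(1) q(1) e(2) by auto
      moreover have "x \<in> ball d q" using d(2) q(2) by (simp add: dist_commute)
      ultimately show "x \<in> (\<Union>p\<in>?I. ball (fst p) (snd p))" by (intro UN_I[of "(d, q)"]) auto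
    qed auto
    then have "f -` S \<inter> space M = (\<Union>p\<in>?I. f -` ball (fst p) (snd p) \<inter> space M)" by blast
    also have "\<dots> \<in> sets M"
    proof (rule sets.countable_UN')
      show "countable ?I"
        by (rule countable_subset[of _ "D \<times> \<rat>"]) (use D(1) countable_rat in auto)
    qed (use ball in auto)
    finally show "f -` S \<inter> space M \<in> sets M" .
  qed
qed

text \<open>
  A set of full measure in the interval is dense in its closure.
\<close>

lemma AE_interval_dense:
  fixes T t e :: real
  assumes T: "0 < T" and P: "AE s in lebesgue_on {0<..<T}. P s" and t: "t \<in> {0..T}" and e: "0 < e"
  shows "\<exists>s\<in>{0<..<T}. \<bar>s - t\<bar> < e \<and> P s"
proof (rule ccontr)
  assume *: "\<not> ?thesis"
  have "AE s in lebesgue. s \<in> {0<..<T} \<longrightarrow> P s"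
  proof -
    have "{0<..<T} \<inter> space lebesgue \<in> sets lebesgue" by (simp add: sets_completionI_sets)
    from AE_restrict_space_iff[OF this] show ?thesis using P by blast
  qed
  then have "AE s in lborel. s \<in> {0<..<T} \<longrightarrow> P s"
    by (simp add: AE_completion_iff)
  then have "AE s in lborel. s \<notin> {max 0 (t - e)<..<min T (t + e)}"
    by eventually_elim (use * in \<open>auto simp: abs_less_iff\<close>)
  then have "emeasure lborel {max 0 (t - e)<..<min T (t + e)} = 0"
    by (subst (asm) AE_iff_measurable[where N = "{max 0 (t - e)<..<min T (t + e)}"]) auto
  moreover have lt: "max 0 (t - e) < min T (t + e)" using T t e by auto
  moreover have "emeasure lborel {max 0 (t - e)<..<min T (t + e)} = ennreal (min T (t + e) - max 0 (t - e))"
    by (rule emeasure_lborel_Ioo) (use lt in linarith)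
  ultimately show False by (metis diff_gt_0_iff_gt ennreal_eq_0_iff not_le)
qed

lemma continuous_AE_eq_imp_eq:
  fixes c d :: "real \<Rightarrow> 'b::real_normed_vector"
  assumes T: "0 < T" and c: "continuous_on {0..T} c" and d: "continuous_on {0..T} d"
    and eq: "AE s in lebesgue_on {0<..<T}. c s = d s" and t: "t \<in> {0..T}"
  shows "c t = d t"
proof -
  have "\<forall>n. \<exists>s\<in>{0<..<T}. \<bar>s - t\<bar> < 1 / real (Suc n) \<and> c s = d s"
    using AE_interval_dense[OF T eq t] by simp
  then obtain s where s: "\<And>n. s n \<in> {0<..<T}" "\<And>n. \<bar>s n - t\<bar> < 1 / real (Suc n)" "\<And>n. c (s n) = d (s n)"
    by metis
  have lim: "s \<longlonglongrightarrow> t"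
  proof (rule LIM_zero_cancel, rule Lim_null_comparison)
    show "\<forall>\<^sub>F n in sequentially. norm (s n - t) \<le> 1 / real (Suc n)"
      using s(2) by (auto intro!: always_eventually less_imp_le simp del: of_nat_Suc)
    show "(\<lambda>n. 1 / real (Suc n)) \<longlonglongrightarrow> 0"
      using LIMSEQ_inverse_real_of_nat by (simp add: inverse_eq_divide)
  qed
  have in': "\<forall>\<^sub>F n in sequentially. s n \<in> {0..T}" using s(1) by (intro always_eventually allI) (simp add: less_imp_le)
  have "(\<lambda>n. c (s n)) \<longlonglongrightarrow> c t" "(\<lambda>n. d (s n)) \<longlonglongrightarrow> d t"
    using continuous_on_tendsto_compose[OF c lim t in'] continuous_on_tendsto_compose[OF d lim t in'] by auto
  then show ?thesis using s(3) LIMSEQ_unique by auto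
qed

lemma trace_eqI:
  assumes T: "0 < T" and c: "continuous_on {0..T} c" and eq: "AE s in lebesgue_on {0<..<T}. c s = j (u s)"
    and t: "t \<in> {0..T}"
  shows "trace T j t u = c t"
  unfolding trace_def
proof (rule the_equality)
  show "\<exists>c'. continuous_on {0..T} c' \<and> (AE s in lebesgue_on {0<..<T}. c' s = j (u s)) \<and> c' t = c t"
    using c eq by blast
  fix h assume "\<exists>d. continuous_on {0..T} d \<and> (AE s in lebesgue_on {0<..<T}. d s = j (u s)) \<and> d t = h"
  then obtain d where d: "continuous_on {0..T} d" "AE s in lebesgue_on {0<..<T}. d s = j (u s)" "d t = h" by blast
  have "AE s in lebesgue_on {0<..<T}. d s = c s" using d(2) eq by eventually_elim simp
  then show "h = c t" using continuous_AE_eq_imp_eq[OF T d(1) c _ t] d(3) by simp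
qed

section \<open>Weak time derivatives\<close>

locale evolution_space = hilbert_embedding j
  for j :: "'v::{real_inner,banach,second_countable_topology} \<Rightarrow> 'h::{real_inner,banach,second_countable_topology}" +
  fixes T :: real
  assumes T_pos: "0 < T"
begin

abbreviation "I \<equiv> lebesgue_on {0<..<T}"
abbreviation "X \<equiv> Xspace T j"

text \<open>The weak time derivative as a \<open>'v\<close>-valued function, by the Riesz isomorphism.\<close>

definition xder :: "(real \<Rightarrow> 'v) \<Rightarrow> real \<Rightarrow> 'v" where
  "xder u t = riesz (wderiv T j u t)"

lemma is_weak_deriv_riesz:
  "is_weak_deriv T j u w \<longleftrightarrow> (\<forall>\<phi>\<in>test_functions T. \<forall>\<eta>.
     (LINT t|I. deriv \<phi> t * (gram (u t) \<bullet> \<eta>)) = - (LINT t|I. \<phi> t * (riesz (w t) \<bullet> \<eta>)))"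
  unfolding is_weak_deriv_def by (simp add: gram_inner riesz)

lemma
  assumes "u \<in> X"
  shows X_L2: "u \<in> L2 T" and wderiv_L2: "wderiv T j u \<in> L2 T"
    and wderiv: "is_weak_deriv T j u (wderiv T j u)" and xder_L2: "xder u \<in> L2 T"
proof -
  show "u \<in> L2 T" using assms by (simp add: Xspace_def)
  have "\<exists>w. w \<in> L2 T \<and> is_weak_deriv T j u w" using assms by (auto simp: Xspace_def)
  from someI_ex[OF this] show *: "wderiv T j u \<in> L2 T" "is_weak_deriv T j u (wderiv T j u)"
    by (auto simp: wderiv_def)
  show "xder u \<in> L2 T" unfolding xder_def[abs_def] by (rule L2_riesz[OF *(1)])
qed

lemma integrable_test_inner:
  assumes "f \<in> L2 T" "\<phi> \<in> test_functions T"
  shows "integrable I (\<lambda>t. \<phi> t * (f t \<bullet> (\<eta>::'v)))"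
  using integrable_test_mult[OF T_pos assms(2), of "\<lambda>t. f t \<bullet> \<eta>"] L2_integrable[OF assms(1)] by simp

lemma weak_deriv_unique:
  assumes "is_weak_deriv T j u w" "w \<in> L2 T" "is_weak_deriv T j u w'" "w' \<in> L2 T"
  shows "AE t in I. w t = w' t"
proof -
  note R = L2_riesz[OF assms(2)] L2_riesz[OF assms(4)]
  have "AE t in I. riesz (w t) - riesz (w' t) = 0"
  proof (rule fundamental_lemma[OF T_pos])
    show "integrable I (\<lambda>t. riesz (w t) - riesz (w' t))"
      using R by (intro Bochner_Integration.integrable_diff L2_integrable)
    fix \<phi> d assume \<phi>: "\<phi> \<in> test_functions T"
    have "(LINT t|I. \<phi> t * (riesz (w t) \<bullet> d)) = (LINT t|I. \<phi> t * (riesz (w' t) \<bullet> d))"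
      using assms(1)[unfolded is_weak_deriv_riesz, rule_format, OF \<phi>, of d]
        assms(3)[unfolded is_weak_deriv_riesz, rule_format, OF \<phi>, of d] by linarith
    then show "(LINT t|I. \<phi> t * ((riesz (w t) - riesz (w' t)) \<bullet> d)) = 0"
      using integrable_test_inner[OF R(1) \<phi>, of d] integrable_test_inner[OF R(2) \<phi>, of d]
      by (simp add: inner_diff_left right_diff_distrib)
  qed
  then show ?thesis by eventually_elim (simp add: riesz_inject)
qed

text \<open>
  Membership in \<open>X\<close>, with the weak derivative given by its Riesz representative \<open>z\<close>.
\<close>

lemma X_I:
  assumes "u \<in> L2 T" "z \<in> L2 T"
    and "\<And>\<phi> \<eta>. \<phi> \<in> test_functions T \<Longrightarrow>
      (LINT t|I. deriv \<phi> t * (gram (u t) \<bullet> \<eta>)) = - (LINT t|I. \<phi> t * (z t \<bullet> \<eta>))"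
  shows "u \<in> X" and "AE t in I. xder u t = z t"
proof -
  let ?w = "\<lambda>t. blinfun_inner_left (z t)"
  have w: "is_weak_deriv T j u ?w" "?w \<in> L2 T"
    using assms(3) L2_of_riesz[OF assms(2)] by (auto simp: is_weak_deriv_riesz)
  then show "u \<in> X" using assms(1) by (auto simp: Xspace_def)
  from weak_deriv_unique[OF wderiv[OF this] wderiv_L2[OF this] w]
  show "AE t in I. xder u t = z t" by eventually_elim (simp add: xder_def)
qed

lemma xder_weak:
  assumes "u \<in> X" "\<phi> \<in> test_functions T"
  shows "(LINT t|I. deriv \<phi> t * (gram (u t) \<bullet> \<eta>)) = - (LINT t|I. \<phi> t * (xder u t \<bullet> \<eta>))"
  using wderiv[OF assms(1)] assms(2) by (simp add: is_weak_deriv_riesz xder_def)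

lemma gram_L2: "u \<in> L2 T \<Longrightarrow> (\<lambda>t. gram (u t)) \<in> L2 T"
  by (rule L2_bounded_linear[OF bounded_linear_gram])

lemma
  assumes u: "u \<in> X" and v: "v \<in> X"
  shows X_lin: "(\<lambda>t. r *\<^sub>R u t + s *\<^sub>R v t) \<in> X"
    and xder_lin: "AE t in I. xder (\<lambda>t. r *\<^sub>R u t + s *\<^sub>R v t) t = r *\<^sub>R xder u t + s *\<^sub>R xder v t"
proof -
  interpret g: bounded_linear gram by (rule bounded_linear_gram)
  have *: "(LINT t|I. deriv \<phi> t * (gram (r *\<^sub>R u t + s *\<^sub>R v t) \<bullet> \<eta>))
      = - (LINT t|I. \<phi> t * ((r *\<^sub>R xder u t + s *\<^sub>R xder v t) \<bullet> \<eta>))" if \<phi>: "\<phi> \<in> test_functions T" for \<phi> \<eta>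
  proof -
    note d = test_function_deriv[OF T_pos \<phi>]
    have "(LINT t|I. deriv \<phi> t * (gram (r *\<^sub>R u t + s *\<^sub>R v t) \<bullet> \<eta>))
      = (LINT t|I. r * (deriv \<phi> t * (gram (u t) \<bullet> \<eta>)) + s * (deriv \<phi> t * (gram (v t) \<bullet> \<eta>)))"
      by (simp add: g.add g.scaleR inner_add_left algebra_simps)
    also have "\<dots> = r * (LINT t|I. deriv \<phi> t * (gram (u t) \<bullet> \<eta>)) + s * (LINT t|I. deriv \<phi> t * (gram (v t) \<bullet> \<eta>))"
      using integrable_test_inner[OF gram_L2[OF X_L2[OF u]] d, of \<eta>] integrable_test_inner[OF gram_L2[OF X_L2[OF v]] d, of \<eta>]
      by simp
    also have "\<dots> = - (r * (LINT t|I. \<phi> t * (xder u t \<bullet> \<eta>)) + s * (LINT t|I. \<phi> t * (xder v t \<bullet> \<eta>)))"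
      by (simp add: xder_weak[OF u \<phi>] xder_weak[OF v \<phi>])
    also have "\<dots> = - (LINT t|I. r * (\<phi> t * (xder u t \<bullet> \<eta>)) + s * (\<phi> t * (xder v t \<bullet> \<eta>)))"
      using integrable_test_inner[OF xder_L2[OF u] \<phi>, of \<eta>] integrable_test_inner[OF xder_L2[OF v] \<phi>, of \<eta>] by simp
    also have "\<dots> = - (LINT t|I. \<phi> t * ((r *\<^sub>R xder u t + s *\<^sub>R xder v t) \<bullet> \<eta>))"
      by (simp add: inner_add_left algebra_simps)
    finally show ?thesis .
  qed
  show "(\<lambda>t. r *\<^sub>R u t + s *\<^sub>R v t) \<in> X"
    "AE t in I. xder (\<lambda>t. r *\<^sub>R u t + s *\<^sub>R v t) t = r *\<^sub>R xder u t + s *\<^sub>R xder v t"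
    using X_I[OF L2_lin[OF X_L2[OF u] X_L2[OF v]] L2_lin[OF xder_L2[OF u] xder_L2[OF v]] *] by auto
qed

text \<open>
  The lemma of du Bois-Reymond: \<open>gram u\<close> is the indefinite integral of its weak derivative, up to a
  constant.
\<close>

lemma gram_primitive:
  assumes u: "u \<in> X"
  obtains x0 where "AE t in I. gram (u t) = x0 + cumint T (xder u) t"
proof -
  interpret finite_measure I by (rule finite_measure_interval)
  let ?w = "xder u"
  note w = L2_integrable[OF xder_L2[OF u]]
  note gu = L2_integrable[OF gram_L2[OF X_L2[OF u]]]
  define D where "D t = gram (u t) - cumint T ?w t" for t
  have cm: "cumint T ?w \<in> borel_measurable I"
    by (rule measurable_interval_continuous[OF cumint_continuous[OF w]])
  have ci: "integrable I (cumint T ?w)"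
  proof (rule Bochner_Integration.integrable_bound[OF _ cm])
    show "integrable I (\<lambda>_. LINT s|I. norm (?w s))" by simp
    have "norm (cumint T ?w t) \<le> (LINT s|I. norm (?w s))" for t
    proof -
      have "norm (cumint T ?w t) \<le> (LINT s|I. norm (indicator {..<t} s *\<^sub>R ?w s))"
        unfolding cumint_def by (rule integral_norm_bound)
      also have "\<dots> \<le> (LINT s|I. norm (?w s))"
        using w integrable_norm[OF integrable_indicator_mult[OF w, of "{..<t}"]]
        by (intro integral_mono) (auto split: split_indicator)
      finally show ?thesis .
    qed
    then show "AE t in I. norm (cumint T ?w t) \<le> norm (LINT s|I. norm (?w s))"
      by (intro AE_I2) (simp add: integral_nonneg_AE)
  qed
  have Di: "integrable I D" unfolding D_def[abs_def] using gu ci by simp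
  have zero: "(LINT t|I. \<psi> t * (D t \<bullet> \<eta>)) = 0"
    if \<psi>: "\<psi> \<in> test_functions T" and m: "(LINT t|I. \<psi> t) = 0" for \<psi> \<eta>
  proof -
    obtain \<Phi> where \<Phi>: "\<Phi> \<in> test_functions T" "deriv \<Phi> = \<psi>" "\<And>t. t \<in> {0..T} \<Longrightarrow> \<Phi> t = cumint T \<psi> t"
      using test_function_primitive[OF T_pos \<psi> m] by blast
    have pi: "integrable I \<psi>" using integrable_test_mult[OF T_pos \<psi>, of "\<lambda>_. 1::real"] by simp
    have pe: "cumint T (\<lambda>s. \<psi> s *\<^sub>R \<eta>) t = cumint T \<psi> t *\<^sub>R \<eta>" for t
    proof -
      have "(LINT s|I. (indicator {..<t} s *\<^sub>R \<psi> s) *\<^sub>R \<eta>) = cumint T \<psi> t *\<^sub>R \<eta>"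
        unfolding cumint_def by (rule integral_scaleR_left) (use integrable_indicator_mult[OF pi, of "{..<t}"] in simp)
      then show ?thesis by (simp add: cumint_def)
    qed
    \<comment> \<open>integration by parts, with \<open>\<Phi>\<close> the primitive of \<open>\<psi>\<close>\<close>
    have "(LINT t|I. \<Phi> t * (?w t \<bullet> \<eta>)) = (LINT t|I. ?w t \<bullet> cumint T (\<lambda>s. \<psi> s *\<^sub>R \<eta>) t)"
      by (intro Bochner_Integration.integral_cong) (auto simp: pe \<Phi>(3))
    also have "\<dots> = (LINT s|I. (cumint T ?w T - cumint T ?w s) \<bullet> (\<psi> s *\<^sub>R \<eta>))"
      using pi by (intro fubini_triangle w) simp
    also have "\<dots> = (LINT s|I. (cumint T ?w T \<bullet> \<eta>) * \<psi> s - \<psi> s * (cumint T ?w s \<bullet> \<eta>))"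
      by (simp add: inner_diff_left algebra_simps)
    also have "\<dots> = (cumint T ?w T \<bullet> \<eta>) * (LINT s|I. \<psi> s) - (LINT s|I. \<psi> s * (cumint T ?w s \<bullet> \<eta>))"
      using integrable_test_mult[OF T_pos \<psi> integrable_inner_left[OF ci], of \<eta>] pi
      by simp
    finally have 1: "(LINT t|I. \<Phi> t * (?w t \<bullet> \<eta>)) = - (LINT s|I. \<psi> s * (cumint T ?w s \<bullet> \<eta>))"
      using m by simp
    have "(LINT t|I. \<psi> t * (D t \<bullet> \<eta>)) = (LINT t|I. \<psi> t * (gram (u t) \<bullet> \<eta>)) - (LINT t|I. \<psi> t * (cumint T ?w t \<bullet> \<eta>))"
      using integrable_test_mult[OF T_pos \<psi> integrable_inner_left[OF ci], of \<eta>]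
        integrable_test_mult[OF T_pos \<psi> integrable_inner_left[OF gu], of \<eta>]
      by (simp add: D_def inner_diff_left right_diff_distrib)
    then show ?thesis using xder_weak[OF u \<Phi>(1), of \<eta>] 1 \<Phi>(2) by simp
  qed
  obtain \<psi>0 where p0: "\<psi>0 \<in> test_functions T" "(LINT t|I. \<psi>0 t) = 1"
    by (rule test_function_mean_one[OF T_pos])
  define x0 where "x0 = (LINT t|I. \<psi>0 t *\<^sub>R D t)"
  have "AE t in I. D t - x0 = 0"
  proof (rule fundamental_lemma[OF T_pos])
    show "integrable I (\<lambda>t. D t - x0)" using Di by simp
    fix \<phi> d assume \<phi>: "\<phi> \<in> test_functions T"
    define m where "m = (LINT t|I. \<phi> t)"
    have i: "integrable I \<phi>" "integrable I \<psi>0"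
      using integrable_test_mult[OF T_pos \<phi>, of "\<lambda>_. 1::real"] integrable_test_mult[OF T_pos p0(1), of "\<lambda>_. 1::real"] by auto
    have iD: "integrable I (\<lambda>t. \<phi> t * (D t \<bullet> d))" "integrable I (\<lambda>t. \<psi>0 t * (D t \<bullet> d))"
      using integrable_test_mult[OF T_pos \<phi> integrable_inner_left[OF Di], of d]
        integrable_test_mult[OF T_pos p0(1) integrable_inner_left[OF Di], of d] by auto
    \<comment> \<open>subtracting a multiple of \<open>\<psi>0\<close> makes the mean of \<open>\<phi>\<close> vanish\<close>
    have "(LINT t|I. (1 * \<phi> t + (- m) * \<psi>0 t) * (D t \<bullet> d)) = 0"
      by (rule zero[OF test_function_lin[OF T_pos \<phi> p0(1)]]) (use i p0 in \<open>simp add: m_def\<close>)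
    moreover have "(LINT t|I. (1 * \<phi> t + (- m) * \<psi>0 t) * (D t \<bullet> d))
        = (LINT t|I. \<phi> t * (D t \<bullet> d)) - m * (LINT t|I. \<psi>0 t * (D t \<bullet> d))"
    proof -
      have "(LINT t|I. (1 * \<phi> t + (- m) * \<psi>0 t) * (D t \<bullet> d)) = (LINT t|I. \<phi> t * (D t \<bullet> d) - m * (\<psi>0 t * (D t \<bullet> d)))"
        by (simp add: algebra_simps)
      then show ?thesis using iD by simp
    qed
    moreover have "x0 \<bullet> d = (LINT t|I. \<psi>0 t * (D t \<bullet> d))"
    proof -
      have "(LINT t|I. (\<psi>0 t *\<^sub>R D t) \<bullet> d) = x0 \<bullet> d"
        unfolding x0_def by (rule integral_inner_left) (rule integrable_test_mult[OF T_pos p0(1) Di])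
      then show ?thesis by simp
    qed
    moreover have "(LINT t|I. \<phi> t * ((D t - x0) \<bullet> d)) = (LINT t|I. \<phi> t * (D t \<bullet> d)) - m * (x0 \<bullet> d)"
    proof -
      have "(LINT t|I. \<phi> t * ((D t - x0) \<bullet> d)) = (LINT t|I. \<phi> t * (D t \<bullet> d) - (x0 \<bullet> d) * \<phi> t)"
        by (simp add: inner_diff_left algebra_simps)
      then show ?thesis using iD i by (simp add: m_def)
    qed
    ultimately show "(LINT t|I. \<phi> t * ((D t - x0) \<bullet> d)) = 0" by simp
  qed
  then have "AE t in I. gram (u t) = x0 + cumint T ?w t"
    by eventually_elim (simp add: D_def algebra_simps)
  then show ?thesis using that by blast
qed

end

section \<open>Continuous representatives and integration by parts\<close>

lemma cumint_abs_le:
  fixes h :: "real \<Rightarrow> real"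
  assumes h: "integrable (lebesgue_on {0<..<T}) h"
  shows "\<bar>cumint T h t\<bar> \<le> (LINT s|lebesgue_on {0<..<T}. \<bar>h s\<bar>)"
proof -
  have "\<bar>cumint T h t\<bar> \<le> (LINT s|lebesgue_on {0<..<T}. \<bar>indicator {..<t} s *\<^sub>R h s\<bar>)"
    unfolding cumint_def using integral_norm_bound[of "lebesgue_on {0<..<T}" "\<lambda>s. indicator {..<t} s *\<^sub>R h s"] by simp
  also have "\<dots> \<le> (LINT s|lebesgue_on {0<..<T}. \<bar>h s\<bar>)"
    using h integrable_norm[OF integrable_indicator_mult[OF h, of "{..<t}"]]
    by (intro integral_mono) (auto split: split_indicator)
  finally show ?thesis .
qed

lemma cumint_at_0: "cumint T f 0 = 0"
proof -
  have "cumint T f 0 = (LINT s|lebesgue_on {0<..<T}. 0)"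
    unfolding cumint_def by (intro Bochner_Integration.integral_cong) (auto simp: indicator_def)
  then show ?thesis by simp
qed

lemma cumint_at_T: "cumint T f T = (LINT s|lebesgue_on {0<..<T}. f s)"
  unfolding cumint_def by (intro Bochner_Integration.integral_cong) (auto simp: indicator_def)

lemma L2_continuous_times:
  fixes \<zeta> :: "'b::{real_normed_vector,second_countable_topology}" and G :: "real \<Rightarrow> real"
  assumes G: "continuous_on UNIV G"
  shows "(\<lambda>t. G t *\<^sub>R \<zeta>) \<in> L2 T"
proof -
  interpret finite_measure "lebesgue_on {0<..<T}" by (rule finite_measure_interval)
  have "bounded (G ` {0..T})"
    by (intro compact_imp_bounded compact_continuous_image continuous_on_subset[OF G]) auto
  then obtain B where "\<forall>y\<in>G ` {0..T}. norm y \<le> B" using bounded_iff by blast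
  then have B: "\<bar>G s\<bar> \<le> B" if "s \<in> {0..T}" for s using that by simp
  have "(\<lambda>_. \<zeta>) \<in> L2 T" by (simp add: L2_def)
  then show ?thesis
  proof (rule L2_bounded_by[where K = B])
    show "(\<lambda>t. G t *\<^sub>R \<zeta>) \<in> borel_measurable (lebesgue_on {0<..<T})" using measurable_interval_continuous[OF G] by measurable
    show "AE t in lebesgue_on {0<..<T}. norm (G t *\<^sub>R \<zeta>) \<le> B * norm \<zeta>"
      using B by (intro AE_I2) (auto intro!: mult_right_mono)
  qed
qed

context evolution_space
begin

interpretation j: bounded_linear j by (rule bl_j)

lemma cumint_limit:
  fixes f :: "nat \<Rightarrow> real \<Rightarrow> real"
  assumes "\<And>n. f n \<in> borel_measurable I" "g \<in> borel_measurable I" "integrable I b"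
    and "AE s in I. (\<lambda>n. f n s) \<longlonglongrightarrow> g s" "\<And>n. AE s in I. \<bar>f n s\<bar> \<le> b s"
  shows "(\<lambda>n. cumint T (f n) t) \<longlonglongrightarrow> cumint T g t"
  unfolding cumint_def
proof (rule integral_dominated_convergence[where w = b])
  show "(\<lambda>s. indicator {..<t} s *\<^sub>R g s) \<in> borel_measurable I" using assms(2) by measurable
  show "(\<lambda>s. indicator {..<t} s *\<^sub>R f n s) \<in> borel_measurable I" for n using assms(1) by measurable
  show "AE s in I. (\<lambda>n. indicator {..<t} s *\<^sub>R f n s) \<longlonglongrightarrow> indicator {..<t} s *\<^sub>R g s"
    using assms(4) by eventually_elim (intro tendsto_intros)
  show "AE s in I. norm (indicator {..<t} s *\<^sub>R f n s) \<le> b s" for n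
    using assms(5)[of n] by eventually_elim (auto simp: indicator_def intro: order_trans[OF abs_ge_zero])
qed fact

text \<open>
  The functions \<open>v n = resolv n W\<close>, with \<open>W\<close> the primitive in the assumption, are continuous with
  values in \<open>'v\<close> and agree a.e. with \<open>u\<close> up to \<open>(damp ^^ n) u\<close>. By the product rule the squared norm
  of \<open>j (v n) - j (v m)\<close> in \<open>'h\<close> changes in time by at most \<open>4 * (\<delta> n + \<delta> m)\<close>, and at one good point \<open>s0\<close> it
  tends to zero. Hence \<open>j (v n)\<close> converges uniformly, and the product rule for \<open>v n\<close> passes to the limit.
\<close>

lemma continuous_representative:
  assumes u: "u \<in> L2 T" and w: "w \<in> L2 T" and prim: "AE t in I. gram (u t) = x0 + cumint T w t"
  obtains c where "continuous_on {0..T} c" "AE s in I. c s = j (u s)"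
    "\<And>t. t \<in> {0..T} \<Longrightarrow> c t \<bullet> c t = c 0 \<bullet> c 0 + 2 * cumint T (\<lambda>s. w s \<bullet> u s) t"
proof -
  define W where "W t = x0 + cumint T w t" for t
  define P where "P n = damp ^^ n" for n
  define v where "v n t = resolv n (W t)" for n t
  note wi = L2_integrable[OF w]
  have um [measurable]: "u \<in> borel_measurable I" and wm [measurable]: "w \<in> borel_measurable I"
    using u w by (auto intro: L2_measurable)
  have Pbl: "bounded_linear (P n)" for n unfolding P_def by (rule damp.pow_bounded_linear)
  have Rbl: "bounded_linear (resolv n)" for n by (rule bounded_linear_resolv)
  have gbl: "bounded_linear gram" by (rule bounded_linear_gram)
  have Pnorm: "norm (P n x) \<le> norm x" for n x unfolding P_def by (rule damp.pow_norm_le)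
  have P0: "(\<lambda>n. P n x) \<longlonglongrightarrow> 0" for x unfolding P_def by (rule damp_pow_tendsto_0)
  have PL2: "(\<lambda>t. P n (u t)) \<in> L2 T" for n by (rule L2_bounded_linear[OF Pbl u])
  have Wcont: "continuous_on UNIV W"
    unfolding W_def[abs_def] by (intro continuous_intros cumint_continuous[OF wi])
  have vcont: "continuous_on UNIV (v n)" for n
    unfolding v_def[abs_def] by (rule bounded_linear.continuous_on[OF Rbl Wcont])
  have good: "AE t in I. \<forall>n. v n t = u t - P n (u t)"
    using prim
  proof eventually_elim
    case (elim t)
    show ?case unfolding v_def W_def elim[symmetric] P_def by (simp add: resolv_gram)
  qed
  have Wgood: "AE t in I. W t = gram (u t)" using prim by eventually_elim (simp add: W_def)
  define \<delta> where "\<delta> n = (LINT s|I. 2 * (norm (w s) * norm (P n (u s))))" for n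
  have wPi: "integrable I (\<lambda>s. norm (w s) * norm (P n (u s)))" for n
    by (rule L2_norm_mult_integrable[OF w PL2])
  have \<delta>0: "\<delta> \<longlonglongrightarrow> 0"
  proof -
    have "(\<lambda>n. LINT s|I. 2 * (norm (w s) * norm (P n (u s)))) \<longlonglongrightarrow> (LINT s|I. 0)"
    proof (rule integral_dominated_convergence[where w = "\<lambda>s. 2 * (norm (w s) * norm (u s))"])
      show "integrable I (\<lambda>s. 2 * (norm (w s) * norm (u s)))"
        using L2_norm_mult_integrable[OF w u] by simp
      show "AE s in I. (\<lambda>n. 2 * (norm (w s) * norm (P n (u s)))) \<longlonglongrightarrow> 0"
        by (intro AE_I2 tendsto_mult_right_zero tendsto_norm_zero P0)
      show "AE s in I. norm (2 * (norm (w s) * norm (P n (u s)))) \<le> 2 * (norm (w s) * norm (u s))" for n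
        by (intro AE_I2) (auto intro!: mult_left_mono Pnorm)
      show "(\<lambda>s. 2 * (norm (w s) * norm (P n (u s)))) \<in> borel_measurable I" for n
        using wPi[of n] by auto
    qed auto
    then show ?thesis by (simp add: \<delta>_def[abs_def])
  qed
  \<comment> \<open>any point of the good set will do; the centre and the radius are arbitrary\<close>
  obtain s0 where s0: "s0 \<in> {0<..<T}" "\<And>n. v n s0 = u s0 - P n (u s0)"
    using AE_interval_dense[OF T_pos good, of T T] T_pos by auto
  define \<beta> where "\<beta> n = jbound * norm (P n (u s0))" for n
  have \<beta>0: "\<beta> \<longlonglongrightarrow> 0" unfolding \<beta>_def[abs_def] by (intro tendsto_mult_right_zero tendsto_norm_zero P0)
  have est: "(norm (j (v n t) - j (v m t)))\<^sup>2 \<le> (\<beta> n + \<beta> m)\<^sup>2 + 4 * (\<delta> n + \<delta> m)" if t: "t \<in> {0..T}" for n m t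
  proof -
    define D where "D x = resolv n x - resolv m x" for x
    define L where "L x = D (gram (D x))" for x
    have Dbl: "bounded_linear D" unfolding D_def[abs_def] by (intro bounded_linear_sub Rbl)
    have Lbl: "bounded_linear L"
      unfolding L_def[abs_def] by (intro bounded_linear_compose[OF Dbl] bounded_linear_compose[OF gbl] Dbl)
    have Dsym: "D x \<bullet> y = x \<bullet> D y" for x y
      by (simp add: D_def inner_diff_left inner_diff_right resolv_sym)
    have Lsym: "L x \<bullet> y = x \<bullet> L y" for x y by (simp add: L_def Dsym gram_sym)
    have Dg: "D (gram x) = P m x - P n x" for x by (simp add: D_def resolv_gram P_def)
    \<comment> \<open>this quadratic form involves \<open>W\<close> only, so the product rule applies\<close>
    have form: "(norm (j (v n r) - j (v m r)))\<^sup>2 = L (W r) \<bullet> W r" for r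
      by (simp add: power2_norm_eq_inner v_def L_def Dsym flip: j.diff D_def gram_inner)
    define h where "h s = w s \<bullet> L (W s)" for s
    have hint: "integrable I h" unfolding h_def[abs_def]
      by (rule integrable_inner_times[OF wi bounded_linear.continuous_on[OF Lbl Wcont]])
    have eq: "L (W r) \<bullet> W r = L x0 \<bullet> x0 + 2 * cumint T h r" if "r \<le> T" for r
      using quadratic_form_cumint[OF wi Lbl Lsym that, of x0] by (simp add: W_def h_def[abs_def])
    have hle: "(LINT s|I. \<bar>h s\<bar>) \<le> \<delta> n + \<delta> m"
    proof -
      have "(LINT s|I. \<bar>h s\<bar>) \<le> (LINT s|I. 2 * (norm (w s) * norm (P n (u s))) + 2 * (norm (w s) * norm (P m (u s))))"
      proof (rule integral_mono_AE)
        show "integrable I (\<lambda>s. \<bar>h s\<bar>)" using hint by simp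
        show "integrable I (\<lambda>s. 2 * (norm (w s) * norm (P n (u s))) + 2 * (norm (w s) * norm (P m (u s))))"
          using wPi by simp
        show "AE s in I. \<bar>h s\<bar> \<le> 2 * (norm (w s) * norm (P n (u s))) + 2 * (norm (w s) * norm (P m (u s)))"
          using Wgood
        proof eventually_elim
          case (elim s)
          let ?y = "P m (u s) - P n (u s)"
          have "L (W s) = P m ?y - P n ?y" by (simp add: elim L_def Dg)
          also have "norm \<dots> \<le> norm ?y + norm ?y"
            by (rule order_trans[OF norm_triangle_ineq4 add_mono[OF Pnorm Pnorm]])
          also have "\<dots> \<le> 2 * (norm (P n (u s)) + norm (P m (u s)))"
            using norm_triangle_ineq4[of "P m (u s)" "P n (u s)"] by simp
          finally have "norm (w s) * norm (L (W s)) \<le> norm (w s) * (2 * (norm (P n (u s)) + norm (P m (u s))))"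
            by (rule mult_left_mono) simp
          then show ?case
            using Cauchy_Schwarz_ineq2[of "w s" "L (W s)"] by (simp add: h_def algebra_simps)
        qed
      qed
      then show ?thesis using wPi by (simp add: \<delta>_def)
    qed
    have c1: "cumint T h t \<le> \<delta> n + \<delta> m"
      by (rule order_trans[OF order_trans[OF abs_ge_self cumint_abs_le[OF hint]] hle])
    have c2: "- cumint T h s0 \<le> \<delta> n + \<delta> m"
      by (rule order_trans[OF order_trans[OF abs_ge_minus_self cumint_abs_le[OF hint]] hle])
    have "L (W t) \<bullet> W t = L (W s0) \<bullet> W s0 + 2 * (cumint T h t - cumint T h s0)"
      using eq[of t] eq[of s0] t s0(1) by simp
    also have "\<dots> \<le> L (W s0) \<bullet> W s0 + 4 * (\<delta> n + \<delta> m)"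
      using c1 c2 by argo
    also have "L (W s0) \<bullet> W s0 \<le> (\<beta> n + \<beta> m)\<^sup>2"
    proof -
      have "norm (j (v n s0) - j (v m s0)) = norm (j (P m (u s0) - P n (u s0)))"
        by (simp add: s0(2) flip: j.diff)
      also have "\<dots> \<le> norm (P m (u s0) - P n (u s0)) * jbound" by (rule jbound)
      also have "\<dots> \<le> (norm (P m (u s0)) + norm (P n (u s0))) * jbound"
        using jbound(1) by (intro mult_right_mono norm_triangle_ineq4) simp
      finally have "norm (j (v n s0) - j (v m s0)) \<le> \<beta> n + \<beta> m" by (simp add: \<beta>_def algebra_simps)
      from power_mono[OF this norm_ge_zero, of 2] show ?thesis by (simp add: form)
    qed
    finally show ?thesis by (simp add: form)
  qed
  have "uniformly_Cauchy_on {0..T} (\<lambda>n t. j (v n t))"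
    unfolding uniformly_Cauchy_on_def
  proof (intro allI impI)
    fix e :: real assume e: "0 < e"
    have "\<forall>\<^sub>F n in sequentially. \<beta> n < e / 4" using e by (intro order_tendstoD(2)[OF \<beta>0]) simp
    moreover have "\<forall>\<^sub>F n in sequentially. \<delta> n < e\<^sup>2 / 16" using e by (intro order_tendstoD(2)[OF \<delta>0]) simp
    ultimately have "\<forall>\<^sub>F n in sequentially. \<beta> n < e / 4 \<and> \<delta> n < e\<^sup>2 / 16" by eventually_elim simp
    then obtain M where M: "\<And>n. M \<le> n \<Longrightarrow> \<beta> n < e / 4 \<and> \<delta> n < e\<^sup>2 / 16"
      unfolding eventually_sequentially by blast
    show "\<exists>M. \<forall>t\<in>{0..T}. \<forall>m\<ge>M. \<forall>n\<ge>M. dist (j (v m t)) (j (v n t)) < e"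
    proof (intro exI ballI allI impI)
      fix t m n assume t: "t \<in> {0..T}" and mn: "M \<le> m" "M \<le> n"
      have "0 \<le> \<beta> k" for k using jbound(1) by (simp add: \<beta>_def)
      then have "(\<beta> m + \<beta> n)\<^sup>2 \<le> (e / 2)\<^sup>2"
        using M[OF mn(1)] M[OF mn(2)] by (intro power_mono) auto
      then have "(\<beta> m + \<beta> n)\<^sup>2 \<le> e\<^sup>2 / 4" by (simp add: power_divide)
      moreover have "0 < e\<^sup>2" using e by simp
      ultimately have "(norm (j (v m t) - j (v n t)))\<^sup>2 < e\<^sup>2"
        using est[OF t, of m n] M[OF mn(1), THEN conjunct2] M[OF mn(2), THEN conjunct2] by argo
      then show "dist (j (v m t)) (j (v n t)) < e"
        using e by (simp add: dist_norm power_less_imp_less_base)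
    qed
  qed
  then obtain c where c: "uniform_limit {0..T} (\<lambda>n t. j (v n t)) c sequentially"
    using Cauchy_uniformly_convergent unfolding uniformly_convergent_on_def by blast
  have ccont: "continuous_on {0..T} c"
  proof (rule uniform_limit_theorem[OF _ c])
    show "\<forall>\<^sub>F n in sequentially. continuous_on {0..T} (\<lambda>t. j (v n t))"
      by (intro always_eventually allI j.continuous_on continuous_on_subset[OF vcont]) simp
  qed simp
  have clim: "(\<lambda>n. j (v n t)) \<longlonglongrightarrow> c t" if "t \<in> {0..T}" for t
    using tendsto_uniform_limitI[OF c that] .
  have "AE t in I. c t = j (u t)"
    using good AE_space
  proof eventually_elim
    case (elim t)
    have "(\<lambda>n. j (u t - P n (u t))) \<longlonglongrightarrow> j (u t - 0)" by (intro j.tendsto tendsto_intros P0)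
    moreover have "(\<lambda>n. j (u t - P n (u t))) \<longlonglongrightarrow> c t" using clim[of t] elim by simp
    ultimately show ?case using LIMSEQ_unique by fastforce
  qed
  moreover have "c t \<bullet> c t = c 0 \<bullet> c 0 + 2 * cumint T (\<lambda>s. w s \<bullet> u s) t" if t: "t \<in> {0..T}" for t
  proof -
    define L where "L n x = resolv n (gram (resolv n x))" for n x
    have Lbl: "bounded_linear (L n)" for n
      unfolding L_def[abs_def] by (intro bounded_linear_compose[OF Rbl] bounded_linear_compose[OF gbl] Rbl)
    have Lsym: "L n x \<bullet> y = x \<bullet> L n y" for n x y by (simp add: L_def resolv_sym gram_sym)
    have form: "j (v n r) \<bullet> j (v n r) = L n (W r) \<bullet> W r" for n r
      by (simp add: v_def L_def resolv_sym flip: gram_inner)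
    have eq: "j (v n t) \<bullet> j (v n t) = j (v n 0) \<bullet> j (v n 0) + 2 * cumint T (\<lambda>s. w s \<bullet> L n (W s)) t" for n
      using quadratic_form_cumint[OF wi Lbl Lsym, of t n x0] t
      by (simp add: form) (simp add: W_def cumint_at_0)
    have lim: "(\<lambda>n. cumint T (\<lambda>s. w s \<bullet> L n (W s)) t) \<longlonglongrightarrow> cumint T (\<lambda>s. w s \<bullet> u s) t"
    proof (rule cumint_limit[where b = "\<lambda>s. 4 * (norm (w s) * norm (u s))"])
      show "(\<lambda>s. w s \<bullet> L n (W s)) \<in> borel_measurable I" for n
        using integrable_inner_times[OF wi bounded_linear.continuous_on[OF Lbl Wcont]] by auto
      show "(\<lambda>s. w s \<bullet> u s) \<in> borel_measurable I" by measurable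
      show "integrable I (\<lambda>s. 4 * (norm (w s) * norm (u s)))" using L2_norm_mult_integrable[OF w u] by simp
      have LW: "AE s in I. \<forall>n. L n (W s) = (u s - P n (u s)) - P n (u s - P n (u s))"
        using good by eventually_elim (simp add: L_def resolv_gram P_def flip: v_def)
      show "AE s in I. (\<lambda>n. w s \<bullet> L n (W s)) \<longlonglongrightarrow> w s \<bullet> u s"
        using LW
      proof eventually_elim
        case (elim s)
        have "(\<lambda>n. P n (P n (u s))) \<longlonglongrightarrow> 0"
          by (rule Lim_null_comparison[OF _ tendsto_norm_zero[OF P0[of "u s"]]]) (simp add: Pnorm)
        then have "(\<lambda>n. w s \<bullet> ((u s - P n (u s)) - (P n (u s) - P n (P n (u s))))) \<longlonglongrightarrow> w s \<bullet> ((u s - 0) - (0 - 0))"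
          by (intro tendsto_intros P0)
        then show ?case using elim by (simp add: linear_diff[OF bounded_linear.linear[OF Pbl]])
      qed
      show "AE s in I. \<bar>w s \<bullet> L n (W s)\<bar> \<le> 4 * (norm (w s) * norm (u s))" for n
        using LW
      proof eventually_elim
        case (elim s)
        let ?y = "u s - P n (u s)"
        have y: "norm ?y \<le> 2 * norm (u s)" using norm_triangle_ineq4[of "u s" "P n (u s)"] Pnorm[of n "u s"] by simp
        have "norm (?y - P n ?y) \<le> 4 * norm (u s)"
          using norm_triangle_ineq4[of ?y "P n ?y"] Pnorm[of n ?y] y by simp
        then have "norm (w s) * norm (L n (W s)) \<le> norm (w s) * (4 * norm (u s))"
          using elim by (intro mult_left_mono) auto
        then show ?case using Cauchy_Schwarz_ineq2[of "w s" "L n (W s)"] by (simp add: algebra_simps)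
      qed
    qed
    have "(\<lambda>n. j (v n t) \<bullet> j (v n t)) \<longlonglongrightarrow> c 0 \<bullet> c 0 + 2 * cumint T (\<lambda>s. w s \<bullet> u s) t"
      unfolding eq using T_pos by (intro tendsto_intros lim clim) auto
    moreover have "(\<lambda>n. j (v n t) \<bullet> j (v n t)) \<longlonglongrightarrow> c t \<bullet> c t"
      by (intro tendsto_intros clim t)
    ultimately show ?thesis using LIMSEQ_unique by blast
  qed
  ultimately show ?thesis using that ccont by blast
qed

lemma X_continuous_representative:
  assumes u: "u \<in> X"
  shows trace_continuous: "continuous_on {0..T} (\<lambda>t. trace T j t u)"
    and trace_AE: "AE s in I. trace T j s u = j (u s)"
    and trace_energy: "trace T j T u \<bullet> trace T j T u = trace T j 0 u \<bullet> trace T j 0 u + 2 * (LINT s|I. xder u s \<bullet> u s)"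
proof -
  obtain x0 where x0: "AE t in I. gram (u t) = x0 + cumint T (xder u) t" by (rule gram_primitive[OF u])
  obtain c where c: "continuous_on {0..T} c" "AE s in I. c s = j (u s)"
    "\<And>t. t \<in> {0..T} \<Longrightarrow> c t \<bullet> c t = c 0 \<bullet> c 0 + 2 * cumint T (\<lambda>s. xder u s \<bullet> u s) t"
    by (rule continuous_representative[OF X_L2[OF u] xder_L2[OF u] x0]) blast
  have tr: "trace T j t u = c t" if "t \<in> {0..T}" for t
    by (rule trace_eqI[OF T_pos c(1) _ that]) (rule c(2))
  show "continuous_on {0..T} (\<lambda>t. trace T j t u)"
    by (rule continuous_on_eq[OF c(1)]) (simp add: tr)
  show "AE s in I. trace T j s u = j (u s)"
    using c(2) AE_space by eventually_elim (simp add: tr)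
  show "trace T j T u \<bullet> trace T j T u = trace T j 0 u \<bullet> trace T j 0 u + 2 * (LINT s|I. xder u s \<bullet> u s)"
    using c(3)[of T] tr[of 0] tr[of T] T_pos by (simp add: cumint_at_T)
qed

lemma trace_lin:
  assumes u: "u \<in> X" and v: "v \<in> X" and t: "t \<in> {0..T}"
  shows "trace T j t (\<lambda>t. r *\<^sub>R u t + s *\<^sub>R v t) = r *\<^sub>R trace T j t u + s *\<^sub>R trace T j t v"
proof (rule trace_eqI[OF T_pos _ _ t])
  show "continuous_on {0..T} (\<lambda>t. r *\<^sub>R trace T j t u + s *\<^sub>R trace T j t v)"
    by (intro continuous_intros trace_continuous u v)
  show "AE x in I. r *\<^sub>R trace T j x u + s *\<^sub>R trace T j x v = j (r *\<^sub>R u x + s *\<^sub>R v x)"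
    using trace_AE[OF u] trace_AE[OF v] by eventually_elim (simp add: j.add j.scaleR)
qed

lemma integration_by_parts:
  assumes u: "u \<in> X" and v: "v \<in> X"
  shows "(LINT s|I. xder u s \<bullet> v s) + (LINT s|I. xder v s \<bullet> u s)
    = trace T j T u \<bullet> trace T j T v - trace T j 0 u \<bullet> trace T j 0 v"
proof -
  let ?z = "\<lambda>t. 1 *\<^sub>R u t + 1 *\<^sub>R v t"
  have z: "?z \<in> X" by (rule X_lin[OF u v])
  note ints = L2_inner_integrable[OF xder_L2[OF u] X_L2[OF u]] L2_inner_integrable[OF xder_L2[OF u] X_L2[OF v]]
    L2_inner_integrable[OF xder_L2[OF v] X_L2[OF u]] L2_inner_integrable[OF xder_L2[OF v] X_L2[OF v]]
  have "(LINT s|I. xder ?z s \<bullet> ?z s)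
      = (LINT s|I. (xder u s \<bullet> u s + xder u s \<bullet> v s) + (xder v s \<bullet> u s + xder v s \<bullet> v s))"
  proof (rule integral_cong_AE)
    show "(\<lambda>s. xder ?z s \<bullet> ?z s) \<in> borel_measurable I"
      using L2_inner_integrable[OF xder_L2[OF z] X_L2[OF z]] by (rule borel_measurable_integrable)
    show "(\<lambda>s. (xder u s \<bullet> u s + xder u s \<bullet> v s) + (xder v s \<bullet> u s + xder v s \<bullet> v s)) \<in> borel_measurable I"
      using ints by (intro borel_measurable_add borel_measurable_integrable)
    show "AE s in I. xder ?z s \<bullet> ?z s = (xder u s \<bullet> u s + xder u s \<bullet> v s) + (xder v s \<bullet> u s + xder v s \<bullet> v s)"
      using xder_lin[OF u v, of 1 1] by eventually_elim (simp add: inner_add_left inner_add_right)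
  qed
  also have "\<dots> = ((LINT s|I. xder u s \<bullet> u s) + (LINT s|I. xder u s \<bullet> v s)) + ((LINT s|I. xder v s \<bullet> u s) + (LINT s|I. xder v s \<bullet> v s))"
    using ints by simp
  finally have *: "(LINT s|I. xder ?z s \<bullet> ?z s) = \<dots>" .
  have "0 \<in> {0..T}" "T \<in> {0..T}" using T_pos by auto
  from trace_lin[OF u v this(1), of 1 1] trace_lin[OF u v this(2), of 1 1]
  show ?thesis
    using trace_energy[OF z] trace_energy[OF u] trace_energy[OF v] *
    by (simp add: inner_add_left inner_add_right inner_commute)
qed

lemma scalar_times_vector:
  fixes F F' :: "real \<Rightarrow> real"
  assumes F: "\<And>t. (F has_real_derivative F' t) (at t)" and F': "continuous_on UNIV F'"
  shows scalar_times_vector_X: "(\<lambda>t. F t *\<^sub>R \<eta>) \<in> X"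
    and scalar_times_vector_xder: "AE t in I. xder (\<lambda>t. F t *\<^sub>R \<eta>) t = F' t *\<^sub>R gram \<eta>"
    and scalar_times_vector_trace: "t \<in> {0..T} \<Longrightarrow> trace T j t (\<lambda>t. F t *\<^sub>R \<eta>) = F t *\<^sub>R j \<eta>"
proof -
  interpret finite_measure I by (rule finite_measure_interval)
  interpret g: bounded_linear gram by (rule bounded_linear_gram)
  have Fc: "continuous_on UNIV F" using F by (meson DERIV_isCont continuous_at_imp_continuous_on)
  note L2c = L2_continuous_times
  have *: "(LINT t|I. deriv \<phi> t * (gram (F t *\<^sub>R \<eta>) \<bullet> \<zeta>)) = - (LINT t|I. \<phi> t * ((F' t *\<^sub>R gram \<eta>) \<bullet> \<zeta>))"
    if \<phi>: "\<phi> \<in> test_functions T" for \<phi> \<zeta>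
  proof -
    note sm = test_function_smooth[OF \<phi>]
    define k where "k = gram \<eta> \<bullet> \<zeta>"
    have "\<phi> 0 = 0" "\<phi> T = 0" using \<phi> unfolding test_functions_iff[OF T_pos] by auto
    moreover have "cumint T (\<lambda>t. deriv \<phi> t * F t + \<phi> t * F' t) T = \<phi> T * F T - \<phi> 0 * F 0"
    proof (rule cumint_FTC)
      show "((\<lambda>t. \<phi> t * F t) has_real_derivative deriv \<phi> t * F t + \<phi> t * F' t) (at t)" for t
        using DERIV_mult[OF smooth_fun_has_deriv[OF sm, of t] F[of t]] by (simp add: mult.commute add.commute)
      show "continuous_on UNIV (\<lambda>t. deriv \<phi> t * F t + \<phi> t * F' t)"
        by (intro continuous_intros smooth_fun_continuous_on sm smooth_fun_deriv Fc F')
    qed (use T_pos in auto)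
    ultimately have 0: "(LINT t|I. deriv \<phi> t * F t + \<phi> t * F' t) = 0" by (simp add: cumint_at_T)
    have i: "integrable I F" "integrable I F'"
      using L2_integrable[OF L2c[OF Fc, of "1::real"]] L2_integrable[OF L2c[OF F', of "1::real"]] by auto
    have "integrable I (\<lambda>t. deriv \<phi> t * F t)" "integrable I (\<lambda>t. \<phi> t * F' t)"
      using integrable_test_mult[OF T_pos test_function_deriv[OF T_pos \<phi>] i(1)]
        integrable_test_mult[OF T_pos \<phi> i(2)] by auto
    with 0 have "(LINT t|I. deriv \<phi> t * F t) = - (LINT t|I. \<phi> t * F' t)" by simp
    then have "k * (LINT t|I. deriv \<phi> t * F t) = - (k * (LINT t|I. \<phi> t * F' t))" by simp
    then have "(LINT t|I. k * (deriv \<phi> t * F t)) = - (LINT t|I. k * (\<phi> t * F' t))" by simp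
    then show ?thesis by (simp add: k_def g.scaleR mult_ac)
  qed
  show "(\<lambda>t. F t *\<^sub>R \<eta>) \<in> X" "AE t in I. xder (\<lambda>t. F t *\<^sub>R \<eta>) t = F' t *\<^sub>R gram \<eta>"
    using X_I[OF L2c[OF Fc] L2c[OF F'] *] by auto
  show "trace T j t (\<lambda>t. F t *\<^sub>R \<eta>) = F t *\<^sub>R j \<eta>" if "t \<in> {0..T}"
    by (rule trace_eqI[OF T_pos _ _ that])
      (auto intro!: continuous_intros continuous_on_subset[OF Fc] simp: j.scaleR)
qed

end

section \<open>The bilinear forms and the energy norm\<close>

lemma interval_in_sets_lebesgue: "{0<..<T::real} \<in> sets lebesgue"
  by simp

lemma interval_measurable_AE_cong:
  fixes f g :: "real \<Rightarrow> real"
  assumes f: "f \<in> borel_measurable (lebesgue_on {0<..<T})" and ae: "AE t in lebesgue_on {0<..<T}. f t = g t"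
  shows "g \<in> borel_measurable (lebesgue_on {0<..<T})"
proof -
  have "(\<lambda>t. if t \<in> {0<..<T} then f t else 0) \<in> borel_measurable lebesgue"
    using f by (subst borel_measurable_if_I) auto
  moreover have "AE t in lebesgue. (if t \<in> {0<..<T} then f t else 0) = (if t \<in> {0<..<T} then g t else 0)"
    using ae by (subst (asm) AE_restrict_space_iff) (auto elim!: eventually_mono)
  ultimately have "(\<lambda>t. if t \<in> {0<..<T} then g t else 0) \<in> borel_measurable lebesgue"
    by (rule borel_measurable_AE)
  then show ?thesis using borel_measurable_if[OF interval_in_sets_lebesgue] by blast
qed

lemma simple_function_measurable_count_space:
  assumes "simple_function M f"
  shows "f \<in> measurable M (count_space (f ` space M))"
  using assms unfolding simple_function_def by (subst measurable_count_space_eq2) auto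

lemma integral_cauchy_schwarz:
  fixes f g :: "'a \<Rightarrow> real"
  assumes "integrable M (\<lambda>t. (f t)\<^sup>2)" "integrable M (\<lambda>t. (g t)\<^sup>2)" "integrable M (\<lambda>t. f t * g t)"
  shows "(LINT t|M. f t * g t)\<^sup>2 \<le> (LINT t|M. (f t)\<^sup>2) * (LINT t|M. (g t)\<^sup>2)"
proof (rule quadratic_nonneg_discrim)
  fix s :: real
  have "0 \<le> (LINT t|M. (f t + s * g t)\<^sup>2)" by (simp add: integral_nonneg_AE)
  also have "\<dots> = (LINT t|M. (f t)\<^sup>2 + (2 * s * (f t * g t) + s\<^sup>2 * (g t)\<^sup>2))"
    by (simp add: power2_eq_square algebra_simps)
  also have "\<dots> = (LINT t|M. (f t)\<^sup>2) + 2 * s * (LINT t|M. f t * g t) + s\<^sup>2 * (LINT t|M. (g t)\<^sup>2)"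
    using assms by simp
  finally show "0 \<le> (LINT t|M. (f t)\<^sup>2) + 2 * s * (LINT t|M. f t * g t) + s\<^sup>2 * (LINT t|M. (g t)\<^sup>2)" .
qed (simp add: integral_nonneg_AE)

text \<open>
  Bilinear forms bounded by \<open>M\<close>. An admissible family is of this kind, with a common \<open>M\<close>, for almost every time.
\<close>

definition good_form :: "real \<Rightarrow> ('v::real_normed_vector \<Rightarrow> 'v \<Rightarrow> real) \<Rightarrow> bool" where
  "good_form M b \<longleftrightarrow> bilinear b \<and> (\<forall>x y. \<bar>b x y\<bar> \<le> M * norm x * norm y)"

lemma good_form_bounded_bilinear: "good_form M b \<Longrightarrow> bounded_bilinear b"
  by (rule bounded_bilinear.intro)
    (auto simp: good_form_def bilinear_ladd bilinear_radd bilinear_lmul bilinear_rmul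
      intro!: exI[of _ M] simp: mult_ac)

lemma good_form_le: "good_form M b \<Longrightarrow> \<bar>b x y\<bar> \<le> M * (norm x * norm y)"
  by (simp only: good_form_def mult.assoc)

text \<open>
  Along simple functions the integrand is measurable since the form is, for fixed arguments; the
  general case follows from the continuity of the forms.
\<close>

lemma form_measurable:
  fixes a :: "real \<Rightarrow> 'v::{real_normed_vector,second_countable_topology} \<Rightarrow> 'v \<Rightarrow> real"
  assumes good: "AE t in lebesgue_on {0<..<T}. good_form M (a t)"
    and meas: "\<And>\<eta> \<zeta>. (\<lambda>t. a t \<eta> \<zeta>) \<in> borel_measurable (lebesgue_on {0<..<T})"
    and u: "u \<in> borel_measurable (lebesgue_on {0<..<T})" and v: "v \<in> borel_measurable (lebesgue_on {0<..<T})"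
  shows "(\<lambda>t. a t (u t) (v t)) \<in> borel_measurable (lebesgue_on {0<..<T})"
proof -
  let ?I = "lebesgue_on {0<..<T}"
  define b where "b t = (if good_form M (a t) then a t else (\<lambda>x y. 0))" for t
  have ab: "AE t in ?I. b t = a t" using good by eventually_elim (simp add: b_def)
  have bb: "bounded_bilinear (b t)" for t
  proof (cases "good_form M (a t)")
    case False
    have "bounded_bilinear (\<lambda>(x::'v) (y::'v). 0::real)"
      by (rule bounded_bilinear.intro) (auto intro: exI[of _ 0])
    then show ?thesis using False by (simp add: b_def)
  qed (simp add: b_def good_form_bounded_bilinear)
  have bm: "(\<lambda>t. b t \<eta> \<zeta>) \<in> borel_measurable ?I" for \<eta> \<zeta>
    by (rule interval_measurable_AE_cong[OF meas[of \<eta> \<zeta>]]) (use ab in \<open>auto elim!: eventually_mono\<close>)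
  obtain U where U: "\<And>n. simple_function ?I (U n)" "\<And>t. t \<in> space ?I \<Longrightarrow> (\<lambda>n. U n t) \<longlonglongrightarrow> u t"
    using borel_measurable_implies_sequence_metric[OF u] by metis
  obtain V where V: "\<And>n. simple_function ?I (V n)" "\<And>t. t \<in> space ?I \<Longrightarrow> (\<lambda>n. V n t) \<longlonglongrightarrow> v t"
    using borel_measurable_implies_sequence_metric[OF v] by metis
  have "(\<lambda>t. b t (u t) (v t)) \<in> borel_measurable ?I"
  proof (rule borel_measurable_LIMSEQ_real)
    show "(\<lambda>n. b t (U n t) (V n t)) \<longlonglongrightarrow> b t (u t) (v t)" if "t \<in> space ?I" for t
      by (rule bounded_bilinear.tendsto[OF bb U(2)[OF that] V(2)[OF that]])
    fix n
    have cU: "countable (U n ` space ?I)" and cV: "countable (V n ` space ?I)"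
      using U(1)[of n] V(1)[of n] by (auto simp: simple_function_def intro: countable_finite)
    have "(\<lambda>t. b t x (V n t)) \<in> borel_measurable ?I" for x
      by (rule measurable_compose_countable'[where f = "\<lambda>y t. b t x y", OF bm
            simple_function_measurable_count_space[OF V(1)] cV])
    then show "(\<lambda>t. b t (U n t) (V n t)) \<in> borel_measurable ?I"
      by (rule measurable_compose_countable'[where f = "\<lambda>x t. b t x (V n t)", OF _
            simple_function_measurable_count_space[OF U(1)] cU])
  qed
  then show ?thesis
    by (rule interval_measurable_AE_cong) (use ab in \<open>auto elim!: eventually_mono\<close>)
qed

text \<open>
  The setting of the theorem: a dense embedding and an admissible family of forms.
\<close>

locale parabolic = evolution_space j T
  for j :: "'v::{real_inner,banach,second_countable_topology} \<Rightarrow> 'h::{real_inner,banach,second_countable_topology}"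
    and T :: real +
  fixes a :: "real \<Rightarrow> 'v \<Rightarrow> 'v \<Rightarrow> real"
  assumes dense_j: "closure (range j) = UNIV"
    and admissible: "admissible_form T a"
begin

abbreviation "Y \<equiv> L2 T :: (real \<Rightarrow> 'v) set"

lemma form_bounds:
  obtains M c where "0 \<le> M" "0 < c" "AE t in I. good_form M (a t) \<and> (\<forall>\<eta>. c * (norm \<eta>)\<^sup>2 \<le> a t \<eta> \<eta>)"
proof -
  have bil: "AE t in I. bilinear (a t)" using admissible by (simp add: admissible_form_def)
  obtain M where M: "AE t in I. \<forall>\<eta> \<zeta>. \<bar>a t \<eta> \<zeta>\<bar> \<le> M * norm \<eta> * norm \<zeta>"
    using admissible by (auto simp: admissible_form_def)
  obtain c where c: "0 < c" "AE t in I. \<forall>\<eta>. c * (norm \<eta>)\<^sup>2 \<le> a t \<eta> \<eta>"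
    using admissible by (auto simp: admissible_form_def)
  have mono: "M * norm x * norm y \<le> \<bar>M\<bar> * norm x * norm y" for x y :: 'v
    by (intro mult_right_mono) auto
  have "AE t in I. good_form \<bar>M\<bar> (a t) \<and> (\<forall>\<eta>. c * (norm \<eta>)\<^sup>2 \<le> a t \<eta> \<eta>)"
    using bil M c(2) by eventually_elim (auto simp: good_form_def intro: order_trans[OF _ mono])
  then show ?thesis using that[of "\<bar>M\<bar>" c] c(1) by simp
qed

lemma form_meas:
  assumes "u \<in> borel_measurable I" "v \<in> borel_measurable I"
  shows "(\<lambda>t. a t (u t) (v t)) \<in> borel_measurable I"
proof -
  obtain M c where "AE t in I. good_form M (a t) \<and> (\<forall>\<eta>. c * (norm \<eta>)\<^sup>2 \<le> a t \<eta> \<eta>)" by (rule form_bounds)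
  then have "AE t in I. good_form M (a t)" by eventually_elim simp
  moreover have "(\<lambda>t. a t \<eta> \<zeta>) \<in> borel_measurable I" for \<eta> \<zeta>
    using admissible by (simp add: admissible_form_def)
  ultimately show ?thesis using assms by (rule form_measurable)
qed

lemma form_integrable:
  assumes "u \<in> Y" "v \<in> Y"
  shows "integrable I (\<lambda>t. a t (u t) (v t))"
proof -
  obtain M c where 0: "0 \<le> M" and *: "AE t in I. good_form M (a t) \<and> (\<forall>\<eta>. c * (norm \<eta>)\<^sup>2 \<le> a t \<eta> \<eta>)" by (rule form_bounds)
  show ?thesis
  proof (rule Bochner_Integration.integrable_bound)
    show "integrable I (\<lambda>t. M * (norm (u t) * norm (v t)))"
      using L2_norm_mult_integrable[OF assms] by simp
    show "(\<lambda>t. a t (u t) (v t)) \<in> borel_measurable I" using assms[THEN L2_measurable] by (rule form_meas)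
    show "AE t in I. norm (a t (u t) (v t)) \<le> norm (M * (norm (u t) * norm (v t)))"
      using *
    proof eventually_elim
      case (elim t)
      then have "\<bar>a t (u t) (v t)\<bar> \<le> M * (norm (u t) * norm (v t))" by (blast intro: good_form_le)
      then show ?case using 0 by simp
    qed
  qed
qed

lemma Aop_lin_left:
  assumes "u \<in> Y" "u' \<in> Y" "v \<in> Y"
  shows "Aop T a (\<lambda>t. r *\<^sub>R u t + s *\<^sub>R u' t) v = r * Aop T a u v + s * Aop T a u' v"
proof -
  obtain M c where *: "AE t in I. good_form M (a t) \<and> (\<forall>\<eta>. c * (norm \<eta>)\<^sup>2 \<le> a t \<eta> \<eta>)" by (rule form_bounds)
  have "Aop T a (\<lambda>t. r *\<^sub>R u t + s *\<^sub>R u' t) v = (LINT t|I. r * a t (u t) (v t) + s * a t (u' t) (v t))"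
    unfolding Aop_def
  proof (rule integral_cong_AE)
    show "(\<lambda>t. a t (r *\<^sub>R u t + s *\<^sub>R u' t) (v t)) \<in> borel_measurable I"
      using assms by (intro form_meas L2_measurable L2_lin)
    show "(\<lambda>t. r * a t (u t) (v t) + s * a t (u' t) (v t)) \<in> borel_measurable I"
      using form_integrable assms by measurable
    show "AE t in I. a t (r *\<^sub>R u t + s *\<^sub>R u' t) (v t) = r * a t (u t) (v t) + s * a t (u' t) (v t)"
      using * by eventually_elim (auto simp: good_form_def bilinear_ladd bilinear_lmul)
  qed
  then show ?thesis using form_integrable[OF assms(1,3)] form_integrable[OF assms(2,3)] by (simp add: Aop_def)
qed

lemma Aop_lin_right:
  assumes "u \<in> Y" "u' \<in> Y" "v \<in> Y"
  shows "Aop T a v (\<lambda>t. r *\<^sub>R u t + s *\<^sub>R u' t) = r * Aop T a v u + s * Aop T a v u'"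
proof -
  obtain M c where *: "AE t in I. good_form M (a t) \<and> (\<forall>\<eta>. c * (norm \<eta>)\<^sup>2 \<le> a t \<eta> \<eta>)" by (rule form_bounds)
  have "Aop T a v (\<lambda>t. r *\<^sub>R u t + s *\<^sub>R u' t) = (LINT t|I. r * a t (v t) (u t) + s * a t (v t) (u' t))"
    unfolding Aop_def
  proof (rule integral_cong_AE)
    show "(\<lambda>t. a t (v t) (r *\<^sub>R u t + s *\<^sub>R u' t)) \<in> borel_measurable I"
      using assms by (intro form_meas L2_measurable L2_lin)
    show "(\<lambda>t. r * a t (v t) (u t) + s * a t (v t) (u' t)) \<in> borel_measurable I"
      using form_integrable assms by measurable
    show "AE t in I. a t (v t) (r *\<^sub>R u t + s *\<^sub>R u' t) = r * a t (v t) (u t) + s * a t (v t) (u' t)"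
      using * by eventually_elim (auto simp: good_form_def bilinear_radd bilinear_rmul)
  qed
  then show ?thesis using form_integrable[OF assms(3,1)] form_integrable[OF assms(3,2)] by (simp add: Aop_def)
qed

lemma As_self: "As T a u u = Aop T a u u" by (simp add: As_def dual_op_def)
lemma As_sym: "As T a u v = As T a v u" by (simp add: As_def dual_op_def)
lemma Aa_antisym: "Aa T a u v = - Aa T a v u" by (simp add: Aa_def dual_op_def field_simps)
lemma As_plus_Aa: "As T a u v + Aa T a u v = Aop T a u v" by (simp add: As_def Aa_def field_simps)

lemma As_lin:
  assumes "u \<in> Y" "u' \<in> Y" "v \<in> Y"
  shows "As T a (\<lambda>t. r *\<^sub>R u t + s *\<^sub>R u' t) v = r * As T a u v + s * As T a u' v"
  using assms by (simp add: As_def dual_op_def Aop_lin_left Aop_lin_right field_simps)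

lemma Aa_lin:
  assumes "u \<in> Y" "u' \<in> Y" "v \<in> Y"
  shows "Aa T a (\<lambda>t. r *\<^sub>R u t + s *\<^sub>R u' t) v = r * Aa T a u v + s * Aa T a u' v"
  using assms by (simp add: Aa_def dual_op_def Aop_lin_left Aop_lin_right field_simps)

lemma coercive_integral:
  obtains c where "0 < c" "\<And>u. u \<in> Y \<Longrightarrow> c * (LINT t|I. (norm (u t))\<^sup>2) \<le> Aop T a u u"
proof -
  obtain M c where c: "0 < c" and *: "AE t in I. good_form M (a t) \<and> (\<forall>\<eta>. c * (norm \<eta>)\<^sup>2 \<le> a t \<eta> \<eta>)" by (rule form_bounds)
  have "c * (LINT t|I. (norm (u t))\<^sup>2) \<le> Aop T a u u" if u: "u \<in> Y" for u
  proof -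
    have "(LINT t|I. c * (norm (u t))\<^sup>2) \<le> Aop T a u u"
      unfolding Aop_def
    proof (rule integral_mono_AE)
      show "AE t in I. c * (norm (u t))\<^sup>2 \<le> a t (u t) (u t)" using * by eventually_elim simp
    qed (use L2_norm_sq[OF u] form_integrable[OF u u] in auto)
    then show ?thesis by simp
  qed
  then show ?thesis using that c by blast
qed

text \<open>
  The symmetric part of the form is the inner product of the energy norm on \<open>Y\<close>.
\<close>

sublocale Y: semi_ip Y "\<lambda>u v t. u t + v t" "\<lambda>r u t. r *\<^sub>R u t" "As T a"
proof
  show "Y \<noteq> {}" using L2_zero by blast
  fix u v w :: "real \<Rightarrow> 'v" and r assume u: "u \<in> Y"
  show "(\<lambda>t. r *\<^sub>R u t) \<in> Y" by (rule L2_scale[OF u])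
  obtain c where c: "0 < c" "c * (LINT t|I. (norm (u t))\<^sup>2) \<le> Aop T a u u" using coercive_integral u by metis
  have "0 \<le> c * (LINT t|I. (norm (u t))\<^sup>2)" using c(1) by (simp add: integral_nonneg_AE)
  then show "0 \<le> As T a u u" using c(2) by (simp add: As_self)
  assume v: "v \<in> Y"
  show "(\<lambda>t. u t + v t) \<in> Y" by (rule L2_add[OF u v])
  show "As T a (\<lambda>t. r *\<^sub>R u t) v = r * As T a u v" using As_lin[OF u u v, of r 0] by simp
  show "As T a u v = As T a v u" by (rule As_sym)
  assume w: "w \<in> Y"
  show "As T a (\<lambda>t. u t + v t) w = As T a u w + As T a v w" using As_lin[OF u v w, of 1 1] by simp
qed

lemma nrm_eq: "Y.nrm = normY T a"
  by (intro ext) (simp add: Y.nrm_def normY_def)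

lemma fnorm_eq: "Y.fnorm = dual_norm T a"
  by (intro ext) (simp add: Y.fnorm_def dual_norm_def nrm_eq)

lemma normY_nonneg: "u \<in> Y \<Longrightarrow> 0 \<le> normY T a u"
  using Y.nrm_nonneg by (simp add: nrm_eq)

lemma L2_product_bound:
  obtains K where "0 \<le> K" "\<And>u. u \<in> Y \<Longrightarrow> sqrt (LINT t|I. (norm (u t))\<^sup>2) \<le> K * normY T a u"
proof -
  obtain c where c: "0 < c" "\<And>u. u \<in> Y \<Longrightarrow> c * (LINT t|I. (norm (u t))\<^sup>2) \<le> Aop T a u u" by (rule coercive_integral) blast
  have "sqrt (LINT t|I. (norm (u t))\<^sup>2) \<le> sqrt (1 / c) * normY T a u" if "u \<in> Y" for u
  proof -
    have "(LINT t|I. (norm (u t))\<^sup>2) \<le> (1 / c) * As T a u u"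
      using c(2)[OF that] c(1) by (simp add: As_self field_simps)
    then show ?thesis unfolding normY_def by (simp flip: real_sqrt_mult)
  qed
  then show ?thesis using that[of "sqrt (1/c)"] c(1) by simp
qed

lemma L2_cauchy_schwarz:
  fixes f g :: "real \<Rightarrow> 'v"
  assumes f: "f \<in> Y" and g: "g \<in> Y"
  shows "(LINT t|I. norm (f t) * norm (g t)) \<le> sqrt (LINT t|I. (norm (f t))\<^sup>2) * sqrt (LINT t|I. (norm (g t))\<^sup>2)"
  using integral_cauchy_schwarz[OF L2_norm_sq[OF f] L2_norm_sq[OF g] L2_norm_mult_integrable[OF f g]]
  by (simp add: real_le_rsqrt flip: real_sqrt_mult)

lemma form_functional_bound:
  fixes f :: "real \<Rightarrow> 'v"
  assumes f: "f \<in> Y" and i: "\<And>v. v \<in> Y \<Longrightarrow> integrable I (k v)" and K: "0 \<le> K"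
    and le: "\<And>v. v \<in> Y \<Longrightarrow> AE t in I. \<bar>k v t\<bar> \<le> K * (norm (f t) * norm (v t))"
  shows "\<exists>C. 0 \<le> C \<and> (\<forall>v\<in>Y. \<bar>LINT t|I. k v t\<bar> \<le> C * normY T a v)"
proof -
  obtain K' where K': "0 \<le> K'" "\<And>u. u \<in> Y \<Longrightarrow> sqrt (LINT t|I. (norm (u t))\<^sup>2) \<le> K' * normY T a u"
    by (rule L2_product_bound) blast
  let ?F = "sqrt (LINT t|I. (norm (f t))\<^sup>2)"
  have F: "0 \<le> ?F" by (simp add: integral_nonneg_AE)
  have "\<bar>LINT t|I. k v t\<bar> \<le> (K * ?F * K') * normY T a v" if v: "v \<in> Y" for v
  proof -
    have "\<bar>LINT t|I. k v t\<bar> \<le> (LINT t|I. \<bar>k v t\<bar>)" using integral_norm_bound[of I "k v"] by simp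
    also have "\<dots> \<le> (LINT t|I. K * (norm (f t) * norm (v t)))"
      using i[OF v] le[OF v] L2_norm_mult_integrable[OF f v] by (intro integral_mono_AE) auto
    also have "\<dots> = K * (LINT t|I. norm (f t) * norm (v t))" by simp
    also have "\<dots> \<le> K * (?F * (K' * normY T a v))"
      by (intro mult_left_mono order_trans[OF L2_cauchy_schwarz[OF f v]] K'(2)[OF v] K F)
    finally show ?thesis by (simp add: mult_ac)
  qed
  then show ?thesis using K F K'(1) by (intro exI[of _ "K * ?F * K'"]) auto
qed

lemma Aop_bound: "\<exists>C\<ge>0. \<forall>u\<in>Y. \<forall>v\<in>Y. \<bar>Aop T a u v\<bar> \<le> C * (normY T a u * normY T a v)"
proof -
  obtain M c where M: "0 \<le> M" and *: "AE t in I. good_form M (a t) \<and> (\<forall>\<eta>. c * (norm \<eta>)\<^sup>2 \<le> a t \<eta> \<eta>)" by (rule form_bounds)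
  obtain K' where K': "0 \<le> K'" "\<And>u. u \<in> Y \<Longrightarrow> sqrt (LINT t|I. (norm (u t))\<^sup>2) \<le> K' * normY T a u"
    by (rule L2_product_bound) blast
  have "\<bar>Aop T a u v\<bar> \<le> (M * (K' * K')) * (normY T a u * normY T a v)" if u: "u \<in> Y" and v: "v \<in> Y" for u v
  proof -
    have "\<bar>Aop T a u v\<bar> \<le> (LINT t|I. \<bar>a t (u t) (v t)\<bar>)"
      unfolding Aop_def using integral_norm_bound[of I "\<lambda>t. a t (u t) (v t)"] by simp
    also have "\<dots> \<le> (LINT t|I. M * (norm (u t) * norm (v t)))"
    proof (rule integral_mono_AE)
      show "AE t in I. \<bar>a t (u t) (v t)\<bar> \<le> M * (norm (u t) * norm (v t))"
        using * by eventually_elim (blast intro: good_form_le)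
    qed (use form_integrable[OF u v] L2_norm_mult_integrable[OF u v] in auto)
    also have "\<dots> = M * (LINT t|I. norm (u t) * norm (v t))" by simp
    also have "\<dots> \<le> M * ((K' * normY T a u) * (K' * normY T a v))"
      using M K' normY_nonneg[OF u] u v
      by (intro mult_left_mono order_trans[OF L2_cauchy_schwarz[OF u v]] mult_mono) (auto simp: integral_nonneg_AE)
    finally show ?thesis by (simp add: mult_ac)
  qed
  then show ?thesis using M K'(1) by (intro exI[of _ "M * (K' * K')"]) auto
qed

lemma Aa_functional: "u \<in> Y \<Longrightarrow> Y.is_functional (Aa T a u)"
  and Aa_bound: "u \<in> Y \<Longrightarrow> v \<in> Y \<Longrightarrow> \<bar>Aa T a u v\<bar> \<le> op_norm T a (Aa T a) * normY T a u * normY T a v"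
  and op_norm_nonneg: "0 \<le> op_norm T a (Aa T a)"
proof -
  obtain C where C: "0 \<le> C" "\<And>u v. u \<in> Y \<Longrightarrow> v \<in> Y \<Longrightarrow> \<bar>Aop T a u v\<bar> \<le> C * (normY T a u * normY T a v)"
    using Aop_bound by blast
  have le: "\<bar>Aa T a u v\<bar> \<le> C * (normY T a u * normY T a v)" if "u \<in> Y" "v \<in> Y" for u v
    using C(2)[OF that] C(2)[OF that(2,1)] unfolding Aa_def dual_op_def by (simp add: mult_ac abs_le_iff)
  show fu: "Y.is_functional (Aa T a u)" if u: "u \<in> Y" for u
    unfolding Y.is_functional_def nrm_eq
  proof (intro conjI ballI allI exI)
    fix v w r assume v: "v \<in> Y"
    show "Aa T a u (\<lambda>t. r *\<^sub>R v t) = r * Aa T a u v"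
      using Aa_lin[OF v v u, of r 0] by (simp add: Aa_antisym[of u])
    show "\<bar>Aa T a u v\<bar> \<le> (C * normY T a u) * normY T a v" using le[OF u v] by (simp add: mult_ac)
    assume w: "w \<in> Y"
    show "Aa T a u (\<lambda>t. v t + w t) = Aa T a u v + Aa T a u w"
      using Aa_lin[OF v w u, of 1 1] by (simp add: Aa_antisym[of u])
  qed
  have dn: "dual_norm T a (Aa T a u) \<le> C * normY T a u" if u: "u \<in> Y" for u
    using Y.fnorm_least[OF fu[OF u], of "C * normY T a u"] le[OF u] C(1) normY_nonneg[OF u]
    by (simp add: fnorm_eq nrm_eq mult_ac)
  have bdd: "bdd_above ((\<lambda>v. dual_norm T a (Aa T a v)) ` {v \<in> Y. normY T a v \<le> 1})"
  proof (rule bdd_aboveI2)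
    fix v assume v: "v \<in> {v \<in> Y. normY T a v \<le> 1}"
    then have "C * normY T a v \<le> C * 1" using C(1) by (intro mult_left_mono) auto
    then show "dual_norm T a (Aa T a v) \<le> C" using dn[of v] v by simp
  qed
  have up: "dual_norm T a (Aa T a v) \<le> op_norm T a (Aa T a)" if "v \<in> Y" "normY T a v \<le> 1" for v
    unfolding op_norm_def using that by (intro cSUP_upper bdd) auto
  show nn: "0 \<le> op_norm T a (Aa T a)"
  proof -
    obtain z where z: "z \<in> Y" "normY T a z = 0" using Y.zero_mem by (auto simp: nrm_eq)
    have "0 \<le> dual_norm T a (Aa T a z)" using Y.fnorm_nonneg[OF fu[OF z(1)]] by (simp add: fnorm_eq)
    then show ?thesis using up[of z] z by simp
  qed
  show "\<bar>Aa T a u v\<bar> \<le> op_norm T a (Aa T a) * normY T a u * normY T a v" if u: "u \<in> Y" and v: "v \<in> Y" for u v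
  proof (cases "normY T a u = 0")
    case True
    then show ?thesis using le[OF u v] by simp
  next
    case False
    then have p: "0 < normY T a u" using normY_nonneg[OF u] by simp
    let ?u = "\<lambda>t. (1 / normY T a u) *\<^sub>R u t"
    have uY: "?u \<in> Y" by (rule L2_scale[OF u])
    have "normY T a ?u = 1" using Y.nrm_smul[OF u, of "1 / normY T a u"] p by (simp add: nrm_eq)
    then have d: "dual_norm T a (Aa T a ?u) \<le> op_norm T a (Aa T a)" using up[OF uY] by simp
    have "\<bar>Aa T a ?u v\<bar> \<le> dual_norm T a (Aa T a ?u) * normY T a v"
      using Y.functional_bound[OF fu[OF uY] v] by (simp add: nrm_eq fnorm_eq)
    also have "\<dots> \<le> op_norm T a (Aa T a) * normY T a v" by (intro mult_right_mono d normY_nonneg v)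
    finally have "\<bar>Aa T a ?u v\<bar> \<le> op_norm T a (Aa T a) * normY T a v" .
    moreover have "Aa T a ?u v = Aa T a u v / normY T a u" using Aa_lin[OF u u v, of "1 / normY T a u" 0] by simp
    ultimately show ?thesis using p by (simp add: field_simps abs_mult)
  qed
qed

lemma normY_eq_0_iff:
  assumes u: "u \<in> Y"
  shows "normY T a u = 0 \<longleftrightarrow> (AE t in I. u t = 0)"
proof
  assume "normY T a u = 0"
  then have 0: "Aop T a u u = 0" using Y.nrm_sq[OF u] by (simp add: nrm_eq As_self)
  obtain c where c: "0 < c" "c * (LINT t|I. (norm (u t))\<^sup>2) \<le> Aop T a u u" using coercive_integral u by metis
  then have "(LINT t|I. (norm (u t))\<^sup>2) \<le> 0" using 0 by (simp add: mult_le_0_iff)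
  moreover have "0 \<le> (LINT t|I. (norm (u t))\<^sup>2)" by (simp add: integral_nonneg_AE)
  ultimately have "(LINT t|I. (norm (u t))\<^sup>2) = 0" by simp
  then show "AE t in I. u t = 0" using integral_nonneg_eq_0_iff_AE[OF L2_norm_sq[OF u]] by simp
next
  assume z: "AE t in I. u t = 0"
  obtain M c where *: "AE t in I. good_form M (a t) \<and> (\<forall>\<eta>. c * (norm \<eta>)\<^sup>2 \<le> a t \<eta> \<eta>)" by (rule form_bounds)
  have "Aop T a u u = (LINT t|I. 0)" unfolding Aop_def
  proof (rule integral_cong_AE)
    show "(\<lambda>t. a t (u t) (u t)) \<in> borel_measurable I" using form_integrable[OF u u] by auto
    show "AE t in I. a t (u t) (u t) = 0"
      using z * by eventually_elim (auto simp: good_form_def bilinear_lzero)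
  qed simp
  then show "normY T a u = 0" by (simp add: normY_def As_self)
qed

lemma dt_eq:
  assumes u: "u \<in> X" and v: "v \<in> Y"
  shows "dt T j a u v = (LINT t|I. xder u t \<bullet> v t)"
proof -
  have "Bop T j a u v = (LINT t|I. xder u t \<bullet> v t + a t (u t) (v t))"
    by (simp add: Bop_def xder_def riesz)
  also have "\<dots> = (LINT t|I. xder u t \<bullet> v t) + Aop T a u v"
    using L2_inner_integrable[OF xder_L2[OF u] v] form_integrable[OF X_L2[OF u] v] by (simp add: Aop_def)
  finally show ?thesis by (simp add: dt_def)
qed

lemma Cop_eq: "Cop T j a u v = dt T j a u v + Aa T a u v"
  using As_plus_Aa[of u v] by (simp add: Cop_def dt_def)

lemma dt_functional:
  assumes u: "u \<in> X"
  shows "Y.is_functional (dt T j a u)"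
  unfolding Y.is_functional_def nrm_eq
proof (intro conjI ballI allI)
  fix v w r assume v: "v \<in> Y"
  show "dt T j a u (\<lambda>t. r *\<^sub>R v t) = r * dt T j a u v"
    by (simp add: dt_eq[OF u] v L2_scale)
  assume w: "w \<in> Y"
  show "dt T j a u (\<lambda>t. v t + w t) = dt T j a u v + dt T j a u w"
    using L2_inner_integrable[OF xder_L2[OF u] v] L2_inner_integrable[OF xder_L2[OF u] w]
    by (simp add: dt_eq[OF u] v w L2_add inner_add_right)
next
  have "\<exists>C. 0 \<le> C \<and> (\<forall>v\<in>Y. \<bar>LINT t|I. xder u t \<bullet> v t\<bar> \<le> C * normY T a v)"
  proof (rule form_functional_bound[OF xder_L2[OF u], where K = 1])
    show "integrable I (\<lambda>t. xder u t \<bullet> v t)" if "v \<in> Y" for v by (rule L2_inner_integrable[OF xder_L2[OF u] that])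
    show "AE t in I. \<bar>xder u t \<bullet> v t\<bar> \<le> 1 * (norm (xder u t) * norm (v t))" for v
      by (intro AE_I2) (simp add: Cauchy_Schwarz_ineq2)
  qed simp
  then show "\<exists>K. \<forall>v\<in>Y. \<bar>dt T j a u v\<bar> \<le> K * normY T a v" by (auto simp: dt_eq[OF u])
qed

lemma dt_lin:
  assumes u: "u \<in> X" and u': "u' \<in> X" and v: "v \<in> Y"
  shows "dt T j a (\<lambda>t. r *\<^sub>R u t + s *\<^sub>R u' t) v = r * dt T j a u v + s * dt T j a u' v"
proof -
  note i = L2_inner_integrable[OF xder_L2[OF u] v] L2_inner_integrable[OF xder_L2[OF u'] v]
  have "dt T j a (\<lambda>t. r *\<^sub>R u t + s *\<^sub>R u' t) v = (LINT t|I. r * (xder u t \<bullet> v t) + s * (xder u' t \<bullet> v t))"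
    unfolding dt_eq[OF X_lin[OF u u'] v]
  proof (rule integral_cong_AE)
    show "(\<lambda>t. xder (\<lambda>t. r *\<^sub>R u t + s *\<^sub>R u' t) t \<bullet> v t) \<in> borel_measurable I"
      by (rule borel_measurable_integrable[OF L2_inner_integrable[OF xder_L2[OF X_lin[OF u u']] v]])
    show "(\<lambda>t. r * (xder u t \<bullet> v t) + s * (xder u' t \<bullet> v t)) \<in> borel_measurable I" using i by measurable
    show "AE t in I. xder (\<lambda>t. r *\<^sub>R u t + s *\<^sub>R u' t) t \<bullet> v t = r * (xder u t \<bullet> v t) + s * (xder u' t \<bullet> v t)"
      using xder_lin[OF u u', of r s] by eventually_elim (simp add: inner_add_left)
  qed
  then show ?thesis using i by (simp add: dt_eq[OF u v] dt_eq[OF u' v])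
qed

lemma dt_by_parts:
  assumes u: "u \<in> X" and v: "v \<in> X"
  shows "dt T j a u v + dt T j a v u = trace T j T u \<bullet> trace T j T v - trace T j 0 u \<bullet> trace T j 0 v"
  using integration_by_parts[OF u v] by (simp add: dt_eq u v X_L2)

section \<open>The multiplier equals the solution\<close>

text \<open>
  The equation says that \<open>e\<close> solves the homogeneous backward problem. With \<open>w\<close> a test function of
  time multiplied by a vector it shows that \<open>e\<close> has a weak derivative, represented by \<open>z\<close>; with \<open>w\<close> a
  multiple of \<open>t\<close> it shows that \<open>e\<close> vanishes at \<open>T\<close>; then the energy identity gives \<open>e = 0\<close>.
\<close>

lemma adjoint_solution_zero:
  assumes e: "e \<in> Y" and eq: "\<And>w. w \<in> X \<Longrightarrow> Aop T a w e + dt T j a w e + d \<bullet> trace T j 0 w = 0"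
  shows "AE t in I. e t = 0"
proof -
  obtain M c where M: "0 \<le> M" and *: "AE t in I. good_form M (a t) \<and> (\<forall>\<eta>. c * (norm \<eta>)\<^sup>2 \<le> a t \<eta> \<eta>)" by (rule form_bounds)
  define z where "z t = (if good_form M (a t) then riesz (Blinfun (\<lambda>\<eta>. a t \<eta> (e t))) else 0)" for t
  have z_inner: "z t \<bullet> \<eta> = a t \<eta> (e t)" if g: "good_form M (a t)" for t \<eta>
  proof -
    have "bounded_linear (\<lambda>\<eta>. a t \<eta> (e t))"
      by (rule bounded_bilinear.bounded_linear_left[OF good_form_bounded_bilinear[OF g]])
    then show ?thesis using g by (simp add: z_def riesz bounded_linear_Blinfun_apply)
  qed
  have zae: "AE t in I. \<forall>\<eta>. z t \<bullet> \<eta> = a t \<eta> (e t)" using * by eventually_elim (simp add: z_inner)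
  have znorm: "norm (z t) \<le> M * norm (e t)" for t
  proof (cases "good_form M (a t)")
    case True
    have "norm (z t) * norm (z t) = a t (z t) (e t)"
      by (simp flip: z_inner[OF True] power2_norm_eq_inner add: power2_eq_square)
    also have "\<dots> \<le> M * norm (z t) * norm (e t)" using good_form_le[OF True, of "z t" "e t"] by (simp add: mult.assoc)
    finally show ?thesis by (cases "norm (z t) = 0") (auto simp: M mult_ac)
  qed (simp add: z_def M)
  have zm: "z \<in> borel_measurable I"
  proof (rule weakly_measurable_imp_measurable)
    fix \<eta>
    have "(\<lambda>t. a t \<eta> (e t)) \<in> borel_measurable I" using L2_measurable[OF e] by (intro form_meas) auto
    then show "(\<lambda>t. z t \<bullet> \<eta>) \<in> borel_measurable I"
      by (rule interval_measurable_AE_cong) (use zae in \<open>auto elim!: eventually_mono\<close>)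
  qed
  have zL2: "z \<in> L2 T" by (rule L2_bounded_by[OF e zm, of M]) (simp add: znorm)
  have Az: "Aop T a w e = (LINT t|I. z t \<bullet> w t)" if w: "w \<in> Y" for w
    unfolding Aop_def
  proof (rule integral_cong_AE)
    show "AE t in I. a t (w t) (e t) = z t \<bullet> w t" using zae by eventually_elim simp
    show "(\<lambda>t. z t \<bullet> w t) \<in> borel_measurable I"
      by (rule borel_measurable_integrable[OF L2_inner_integrable[OF zL2 w]])
    show "(\<lambda>t. a t (w t) (e t)) \<in> borel_measurable I" using form_integrable[OF w e] by auto
  qed
  have tensor: "dt T j a (\<lambda>t. F t *\<^sub>R \<eta>) e = (LINT t|I. F' t * (gram (e t) \<bullet> \<eta>))"
    if F: "\<And>t. (F has_real_derivative F' t) (at t)" "continuous_on UNIV F'" for F F' \<eta>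
  proof -
    note w = scalar_times_vector_X[OF F, of \<eta>]
    show ?thesis unfolding dt_eq[OF w e]
    proof (rule integral_cong_AE)
      show "(\<lambda>t. xder (\<lambda>t. F t *\<^sub>R \<eta>) t \<bullet> e t) \<in> borel_measurable I"
        by (rule borel_measurable_integrable[OF L2_inner_integrable[OF xder_L2[OF w] e]])
      show "(\<lambda>t. F' t * (gram (e t) \<bullet> \<eta>)) \<in> borel_measurable I"
        using measurable_interval_continuous[OF F(2)] L2_measurable[OF gram_L2[OF e]] by measurable
      show "AE t in I. xder (\<lambda>t. F t *\<^sub>R \<eta>) t \<bullet> e t = F' t * (gram (e t) \<bullet> \<eta>)"
        using scalar_times_vector_xder[OF F, of \<eta>] by eventually_elim (simp add: inner_commute[of \<eta>] gram_sym[of \<eta>])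
    qed
  qed
  have weak: "(LINT t|I. deriv \<phi> t * (gram (e t) \<bullet> \<eta>)) = - (LINT t|I. \<phi> t * (z t \<bullet> \<eta>))"
    if \<phi>: "\<phi> \<in> test_functions T" for \<phi> \<eta>
  proof -
    note sm = test_function_smooth[OF \<phi>]
    note F = smooth_fun_has_deriv[OF sm] smooth_fun_continuous_on[OF smooth_fun_deriv[OF sm]]
    note w = scalar_times_vector_X[OF F, of \<eta>]
    have "\<phi> 0 = 0" using \<phi> unfolding test_functions_iff[OF T_pos] by auto
    then have "trace T j 0 (\<lambda>t. \<phi> t *\<^sub>R \<eta>) = 0"
      using scalar_times_vector_trace[OF F, of 0 \<eta>] T_pos by simp
    then show ?thesis using eq[OF w] tensor[OF F, of \<eta>] Az[OF X_L2[OF w]] by simp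
  qed
  have eX: "e \<in> X" "AE t in I. xder e t = z t"
    by (rule X_I[OF e zL2], erule weak)+
  have dte: "dt T j a e w = Aop T a w e" if w: "w \<in> Y" for w
  proof -
    have "dt T j a e w = (LINT t|I. xder e t \<bullet> w t)" by (rule dt_eq[OF eX(1) w])
    also have "\<dots> = (LINT t|I. z t \<bullet> w t)"
    proof (rule integral_cong_AE)
      show "(\<lambda>t. xder e t \<bullet> w t) \<in> borel_measurable I"
        by (rule borel_measurable_integrable[OF L2_inner_integrable[OF xder_L2[OF eX(1)] w]])
      show "(\<lambda>t. z t \<bullet> w t) \<in> borel_measurable I"
        by (rule borel_measurable_integrable[OF L2_inner_integrable[OF zL2 w]])
      show "AE t in I. xder e t \<bullet> w t = z t \<bullet> w t" using eX(2) by eventually_elim simp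
    qed
    finally show ?thesis by (simp add: Az[OF w])
  qed
  have orth: "j \<eta> \<bullet> trace T j T e = 0" for \<eta>
  proof -
    have F: "\<And>t. ((\<lambda>t. t / T) has_real_derivative 1 / T) (at t)" "continuous_on UNIV (\<lambda>t. 1 / T)"
      using T_pos by (auto intro!: derivative_eq_intros)
    note w = scalar_times_vector_X[OF F, of \<eta>]
    have "trace T j 0 (\<lambda>t. (t / T) *\<^sub>R \<eta>) = 0" "trace T j T (\<lambda>t. (t / T) *\<^sub>R \<eta>) = j \<eta>"
      using scalar_times_vector_trace[OF F, of 0 \<eta>] scalar_times_vector_trace[OF F, of T \<eta>] T_pos by auto
    then show ?thesis
      using eq[OF w] dt_by_parts[OF w eX(1)] dte[OF X_L2[OF w]] by simp
  qed
  have "trace T j T e = 0"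
  proof -
    have "closure (range j) \<subseteq> {h. h \<bullet> trace T j T e = 0}"
      using orth by (intro closure_minimal closed_Collect_eq continuous_intros) auto
    then have "trace T j T e \<bullet> trace T j T e = 0" unfolding dense_j by blast
    then show ?thesis by simp
  qed
  then have "2 * Aop T a e e = - (trace T j 0 e \<bullet> trace T j 0 e)"
    using dt_by_parts[OF eX(1) eX(1)] dte[OF e] by simp
  then have "Aop T a e e \<le> 0" using inner_ge_zero[of "trace T j 0 e"] by linarith
  then have "normY T a e = 0" using Y.ip_nonneg[OF e] by (simp add: normY_def As_self)
  then show ?thesis using normY_eq_0_iff[OF e] by simp
qed

text \<open>
  Both equations are tested with \<open>w\<close> in \<open>X\<close> and added, which eliminates \<open>g\<close>; integration by parts
  leaves an equation for \<open>l - u\<close>.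
\<close>

lemma mixed_solution_multiplier:
  assumes sol: "mixed_solution T j a g u0 l u"
  shows "AE t in I. l t = u t"
proof -
  have l: "l \<in> Y" and u: "u \<in> X" and e1: "\<And>v. v \<in> Y \<Longrightarrow> As T a l v + Cop T j a u v = g v"
    and e2: "\<And>w. w \<in> X \<Longrightarrow> Cop T j a w l - (As T a u w + trace T j T u \<bullet> trace T j T w) = - (g w + u0 \<bullet> trace T j 0 w)"
    using sol by (auto simp: mixed_solution_def dual_op_def)
  note uY = X_L2[OF u]
  let ?e = "\<lambda>t. 1 *\<^sub>R l t + (- 1) *\<^sub>R u t"
  have eY: "?e \<in> Y" by (rule L2_lin[OF l uY])
  have "AE t in I. ?e t = 0"
  proof (rule adjoint_solution_zero[OF eY, where d = "u0 - trace T j 0 u"])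
    fix w assume w: "w \<in> X"
    note wY = X_L2[OF w]
    have "Aop T a w ?e = As T a l w - As T a u w - Aa T a l w + Aa T a u w"
      using As_plus_Aa[of w ?e] As_lin[OF l uY wY, of 1 "-1"] Aa_lin[OF l uY wY, of 1 "-1"]
      by (simp add: As_sym[of w] Aa_antisym[of w])
    moreover have "dt T j a w ?e = dt T j a w l - dt T j a w u"
    proof -
      have "dt T j a w ?e = (LINT t|I. xder w t \<bullet> l t - xder w t \<bullet> u t)"
        unfolding dt_eq[OF w eY] by (simp add: inner_diff_right)
      then show ?thesis
        using L2_inner_integrable[OF xder_L2[OF w] l] L2_inner_integrable[OF xder_L2[OF w] uY]
        by (simp add: dt_eq[OF w l] dt_eq[OF w uY])
    qed
    ultimately show "Aop T a w ?e + dt T j a w ?e + (u0 - trace T j 0 u) \<bullet> trace T j 0 w = 0"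
      using e1[OF wY] e2[OF w] dt_by_parts[OF u w]
      by (simp add: Cop_eq Aa_antisym[of w l] inner_diff_left)
  qed
  then show ?thesis by eventually_elim simp
qed

end

section \<open>The constants\<close>

lemma rho_root_unique:
  fixes \<gamma> \<alpha> :: real
  assumes g: "0 < \<gamma>" "\<gamma> \<le> 1"
  shows "\<exists>!\<rho>. 0 \<le> \<rho> \<and> \<rho> < 1 \<and> \<gamma>\<^sup>2 * (\<rho>\<^sup>2 - \<rho>) + \<alpha>\<^sup>2 * (\<rho> - 1) + \<rho> = 0"
proof -
  define f where "f x = \<gamma>\<^sup>2 * (x\<^sup>2 - x) + \<alpha>\<^sup>2 * (x - 1) + x" for x :: real
  have "\<exists>x\<ge>0. x \<le> 1 \<and> f x = 0"
    by (rule IVT') (auto simp: f_def intro!: continuous_intros)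
  then obtain x where x': "0 \<le> x" "x \<le> 1" "f x = 0" by blast
  have "f 1 = 1" by (simp add: f_def)
  then have "x \<noteq> 1" using x'(3) by auto
  with x' have x: "0 \<le> x" "x < 1" "f x = 0" by auto
  have "y = x" if y: "0 \<le> y" "f y = 0" for y
  proof (rule ccontr)
    assume ne: "y \<noteq> x"
    have "(x - y) * (\<gamma>\<^sup>2 * (x + y) + (1 - \<gamma>\<^sup>2) + \<alpha>\<^sup>2) = f x - f y"
      by (simp add: f_def power2_eq_square algebra_simps)
    then have 0: "\<gamma>\<^sup>2 * (x + y) + (1 - \<gamma>\<^sup>2) + \<alpha>\<^sup>2 = 0" using ne x(3) y(2) by simp
    have "0 \<le> 1 - \<gamma>\<^sup>2" using g by (simp add: power_le_one)
    moreover have "0 \<le> \<gamma>\<^sup>2 * (x + y)" using x y by simp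
    ultimately have "\<gamma>\<^sup>2 * (x + y) = 0" using 0 zero_le_power2[of \<alpha>] by linarith
    then show False using g x y ne by auto
  qed
  note unique = this
  show ?thesis
  proof (rule ex1I[of _ x])
    show "0 \<le> x \<and> x < 1 \<and> \<gamma>\<^sup>2 * (x\<^sup>2 - x) + \<alpha>\<^sup>2 * (x - 1) + x = 0"
      using x by (simp only: f_def)
    show "y = x" if "0 \<le> y \<and> y < 1 \<and> \<gamma>\<^sup>2 * (y\<^sup>2 - y) + \<alpha>\<^sup>2 * (y - 1) + y = 0" for y
      using that unique[of y] by (simp only: f_def)
  qed
qed

lemma
  fixes \<gamma> \<alpha> :: real
  assumes g: "0 < \<gamma>" "\<gamma> \<le> 1"
  shows rho_root_ge_0: "0 \<le> rho_root \<gamma> \<alpha>" and rho_root_less_1: "rho_root \<gamma> \<alpha> < 1"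
    and rho_root_eq: "\<gamma>\<^sup>2 * ((rho_root \<gamma> \<alpha>)\<^sup>2 - rho_root \<gamma> \<alpha>) + \<alpha>\<^sup>2 * (rho_root \<gamma> \<alpha> - 1) + rho_root \<gamma> \<alpha> = 0"
    and rho_root_0: "rho_root \<gamma> 0 = 0"
  using theI'[OF rho_root_unique[OF g, of \<alpha>], folded rho_root_def]
    the1_equality[OF rho_root_unique[OF g, of 0], of 0, folded rho_root_def] by auto

lemma
  fixes \<gamma> \<alpha> :: real
  assumes g: "0 < \<gamma>" "\<gamma> \<le> 1"
  shows kappa_pos: "0 < (1 - rho_root \<gamma> \<alpha>) * \<gamma>\<^sup>2" and kappa_le_1: "(1 - rho_root \<gamma> \<alpha>) * \<gamma>\<^sup>2 \<le> 1"
  using rho_root_ge_0[OF g, of \<alpha>] rho_root_less_1[OF g, of \<alpha>] g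
  by (auto intro!: mult_le_one simp: power_le_one)

lemma C_const_ge:
  fixes \<gamma> \<alpha> :: real
  assumes g: "0 < \<gamma>" "\<gamma> \<le> 1" and a: "0 \<le> \<alpha>"
  shows "1 + \<alpha> \<le> C_const \<gamma> \<alpha>"
proof -
  let ?k = "(1 - rho_root \<gamma> \<alpha>) * \<gamma>\<^sup>2"
  have s3: "1 \<le> sqrt (3::real)" by simp
  have "1 + \<alpha> \<le> 1 * (sqrt 3 + \<alpha>)" using s3 by simp
  also have "\<dots> \<le> (3 + \<alpha>\<^sup>2) * (sqrt 3 + \<alpha>)" using s3 a by (intro mult_right_mono) auto
  also have "\<dots> \<le> (3 + \<alpha>\<^sup>2) * (sqrt 3 + \<alpha>) / ?k"
    using kappa_pos[OF g, of \<alpha>] kappa_le_1[OF g, of \<alpha>] a s3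
    by (simp add: pos_le_divide_eq) (intro mult_left_le, auto)
  finally show ?thesis by (simp add: C_const_def)
qed

lemma C_const_at_top:
  assumes "0 < \<gamma>" "\<gamma> \<le> (1::real)"
  shows "filterlim (C_const \<gamma>) at_top at_top"
proof (rule filterlim_at_top_mono[OF filterlim_ident])
  show "\<forall>\<^sub>F \<alpha> in at_top. \<alpha> \<le> C_const \<gamma> \<alpha>"
    using eventually_ge_at_top[of 0] by eventually_elim (use C_const_ge[OF assms] in force)
qed

text \<open>
  In the application \<open>p\<close>, \<open>q\<close> and \<open>r\<close> are the three parts of the norm of \<open>u\<close> in \<open>X\<close>, and \<open>S\<close> bounds the dual
  norm of \<open>C u\<close> on the discrete space. Young's inequality with weight \<open>\<rho>\<close> is used, and the equation of
  \<open>\<rho>\<close> says that the coefficients of \<open>p\<^sup>2\<close> and \<open>q\<^sup>2\<close> come out equal.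
\<close>

lemma schur_coercive:
  fixes \<gamma> \<alpha> p q r S :: real
  assumes g: "0 < \<gamma>" "\<gamma> \<le> 1" and nn: "0 \<le> p" "0 \<le> q" "0 \<le> S" and a: "0 \<le> \<alpha>" and le: "\<gamma> * q \<le> S + \<alpha> * p"
  shows "(1 - rho_root \<gamma> \<alpha>) * \<gamma>\<^sup>2 * (p\<^sup>2 + q\<^sup>2 + r\<^sup>2) \<le> S\<^sup>2 + p\<^sup>2 + r\<^sup>2"
proof -
  define \<rho> where "\<rho> = rho_root \<gamma> \<alpha>"
  have r: "0 \<le> \<rho>" "\<rho> < 1" and eq: "\<gamma>\<^sup>2 * (\<rho>\<^sup>2 - \<rho>) + \<alpha>\<^sup>2 * (\<rho> - 1) + \<rho> = 0"
    using rho_root_ge_0[OF g, of \<alpha>] rho_root_less_1[OF g, of \<alpha>] rho_root_eq[OF g, of \<alpha>] by (simp_all add: \<rho>_def)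
  have q2: "\<gamma>\<^sup>2 * q\<^sup>2 \<le> (S + \<alpha> * p)\<^sup>2"
    using power_mono[OF le, of 2] g nn by (simp add: power_mult_distrib)
  have r2: "(1 - \<rho>) * \<gamma>\<^sup>2 * r\<^sup>2 \<le> r\<^sup>2"
    using mult_right_mono[OF kappa_le_1[OF g, of \<alpha>], of "r\<^sup>2"] by (simp add: \<rho>_def)
  have "(1 - \<rho>) * \<gamma>\<^sup>2 * q\<^sup>2 + (1 - \<rho>) * \<gamma>\<^sup>2 * p\<^sup>2 \<le> S\<^sup>2 + p\<^sup>2"
  proof (cases "\<rho> = 0")
    case True
    then have "\<alpha> = 0" using eq by simp
    moreover have "\<gamma>\<^sup>2 * p\<^sup>2 \<le> p\<^sup>2" using g by (intro mult_left_le_one_le) (auto simp: power_le_one)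
    ultimately show ?thesis using q2 True by simp
  next
    case False
    then have rp: "0 < \<rho>" using r by simp
    have id: "\<rho> * ((1 - \<rho>) * \<gamma>\<^sup>2) = \<rho> - (1 - \<rho>) * \<alpha>\<^sup>2" using eq by (simp add: power2_eq_square algebra_simps)
    have young: "\<rho> * (1 - \<rho>) * (S + \<alpha> * p)\<^sup>2 \<le> \<rho> * S\<^sup>2 + (1 - \<rho>) * (\<alpha> * p)\<^sup>2"
    proof -
      have "\<rho> * S\<^sup>2 + (1 - \<rho>) * (\<alpha> * p)\<^sup>2 - \<rho> * (1 - \<rho>) * (S + \<alpha> * p)\<^sup>2 = (\<rho> * S - (1 - \<rho>) * (\<alpha> * p))\<^sup>2"
        by (simp add: power2_eq_square algebra_simps)
      then show ?thesis using zero_le_power2[of "\<rho> * S - (1 - \<rho>) * (\<alpha> * p)"] by linarith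
    qed
    have "\<rho> * ((1 - \<rho>) * \<gamma>\<^sup>2 * q\<^sup>2 + (1 - \<rho>) * \<gamma>\<^sup>2 * p\<^sup>2) = \<rho> * (1 - \<rho>) * (\<gamma>\<^sup>2 * q\<^sup>2) + (\<rho> * ((1 - \<rho>) * \<gamma>\<^sup>2)) * p\<^sup>2"
      by (simp add: algebra_simps)
    also have "\<dots> \<le> \<rho> * (1 - \<rho>) * (S + \<alpha> * p)\<^sup>2 + (\<rho> - (1 - \<rho>) * \<alpha>\<^sup>2) * p\<^sup>2"
      unfolding id using q2 r by (intro add_right_mono mult_left_mono) auto
    also have "\<dots> \<le> (\<rho> * S\<^sup>2 + (1 - \<rho>) * (\<alpha> * p)\<^sup>2) + (\<rho> - (1 - \<rho>) * \<alpha>\<^sup>2) * p\<^sup>2"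
      using young by simp
    also have "\<dots> = \<rho> * (S\<^sup>2 + p\<^sup>2)" by (simp add: power2_eq_square algebra_simps)
    finally show ?thesis using rp by simp
  qed
  then show ?thesis using r2 by (simp add: \<rho>_def algebra_simps)
qed

text \<open>
  A projection in a Hilbert space and its complement have the same norm. Here \<open>a\<close> and \<open>b\<close> are the norms
  of a vector \<open>e\<close> in the kernel and a vector \<open>y\<close> in the range of the projection, and \<open>B\<close> is their inner
  product. The vectors \<open>e + y\<close> and \<open>(b/a) e + (a/b) y\<close> have the same norm, and the second one is
  projected to a vector of norm \<open>a\<close>.
\<close>

lemma kato_projection:
  fixes a b B C :: real
  assumes nn: "0 \<le> a" "0 \<le> b" "1 \<le> C"
    and pos: "\<And>s t. 0 \<le> t\<^sup>2 * a\<^sup>2 + 2 * (t * s) * B + s\<^sup>2 * b\<^sup>2"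
    and stab: "\<And>s t. s\<^sup>2 * b\<^sup>2 \<le> C\<^sup>2 * (t\<^sup>2 * a\<^sup>2 + 2 * (t * s) * B + s\<^sup>2 * b\<^sup>2)"
  shows "a \<le> C * sqrt (a\<^sup>2 + 2 * B + b\<^sup>2)"
proof -
  have "a\<^sup>2 \<le> C\<^sup>2 * (a\<^sup>2 + 2 * B + b\<^sup>2)"
  proof (cases "a = 0 \<or> b = 0")
    case True
    have "B\<^sup>2 \<le> a\<^sup>2 * b\<^sup>2" by (rule quadratic_nonneg_discrim) (use pos[of 1] in auto)
    then have "B = 0" using True by auto
    have "1 * (a\<^sup>2 + b\<^sup>2) \<le> C\<^sup>2 * (a\<^sup>2 + b\<^sup>2)" using nn by (intro mult_right_mono) (auto simp: one_le_power)
    then show ?thesis using \<open>B = 0\<close> by simp (metis add_increasing2 order_refl order_trans zero_le_power2)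
  next
    case False
    then show ?thesis using stab[of "a / b" "b / a"] by (simp add: power_divide) (simp add: algebra_simps)
  qed
  then have "sqrt (a\<^sup>2) \<le> sqrt (C\<^sup>2 * (a\<^sup>2 + 2 * B + b\<^sup>2))" by (rule real_sqrt_le_mono)
  then show ?thesis using nn by (simp add: real_sqrt_mult)
qed

text \<open>
  The left-hand side bounds the norm of the data of the discrete system generated by a pair with norm
  \<open>l\<close> of the first component and norm parts \<open>p\<close>, \<open>q\<close>, \<open>r\<close> of the second.
\<close>

lemma data_norm_bound:
  fixes l p q r \<alpha> :: real
  assumes a: "0 \<le> \<alpha>" 
  shows "sqrt ((l + q + \<alpha> * p)\<^sup>2 + (l\<^sup>2 + (\<alpha> * l + p)\<^sup>2 + r\<^sup>2)) \<le> (sqrt 3 + \<alpha>) * sqrt (l\<^sup>2 + (p\<^sup>2 + q\<^sup>2 + r\<^sup>2))"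
proof -
  let ?x = "((l + q, p), (l, r))" and ?y = "((p, l), (0::real, 0::real))"
  have "norm (?x + \<alpha> *\<^sub>R ?y) \<le> norm ?x + \<alpha> * norm ?y"
    using norm_triangle_ineq[of ?x "\<alpha> *\<^sub>R ?y"] a by (simp only: norm_scaleR abs_of_nonneg)
  moreover have "norm (?x + \<alpha> *\<^sub>R ?y) = sqrt ((l + q + \<alpha> * p)\<^sup>2 + (l\<^sup>2 + (\<alpha> * l + p)\<^sup>2 + r\<^sup>2))"
    by (simp add: norm_prod_def algebra_simps)
  moreover have "norm ?x \<le> sqrt 3 * sqrt (l\<^sup>2 + (p\<^sup>2 + q\<^sup>2 + r\<^sup>2))"
  proof -
    have "(l + q)\<^sup>2 \<le> 2 * l\<^sup>2 + 2 * q\<^sup>2" using sum_squares_bound[of l q] by (simp add: power2_sum)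
    then have "(l + q)\<^sup>2 + p\<^sup>2 + (l\<^sup>2 + r\<^sup>2) \<le> 3 * (l\<^sup>2 + (p\<^sup>2 + q\<^sup>2 + r\<^sup>2))"
      using zero_le_power2[of p] zero_le_power2[of q] zero_le_power2[of r] by argo
    then show ?thesis by (simp add: norm_prod_def flip: real_sqrt_mult)
  qed
  moreover have "\<alpha> * norm ?y \<le> \<alpha> * sqrt (l\<^sup>2 + (p\<^sup>2 + q\<^sup>2 + r\<^sup>2))"
    using a by (intro mult_left_mono) (simp_all add: norm_prod_def)
  ultimately show ?thesis by (simp add: algebra_simps)
qed

text \<open>
  The norm of a two by two matrix that dominates the inverse of the saddle point system, bounded by
  its trace; \<open>n\<close> is the norm of the primal variable, \<open>L\<close> that of the multiplier.
\<close>

lemma saddle_bound: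
  fixes L n F H c k :: real
  assumes nn: "0 \<le> L" "0 \<le> n" "0 \<le> F" "0 \<le> H" "0 \<le> c" and k: "0 < k" "k \<le> 1"
    and n: "k * n\<^sup>2 \<le> c * n * F + H * n" and L: "L \<le> F + c * n"
  shows "sqrt (L\<^sup>2 + n\<^sup>2) \<le> ((2 + c\<^sup>2) / k) * sqrt (F\<^sup>2 + H\<^sup>2)"
proof -
  define s where "s = (c * F + H) / k"
  have s: "0 \<le> s" using nn k by (simp add: s_def)
  have ns: "n \<le> s"
  proof (cases "n = 0")
    case False
    then have "k * n * n \<le> (c * F + H) * n" using n by (simp add: power2_eq_square algebra_simps)
    then have "k * n \<le> c * F + H" using False nn by simp
    then show ?thesis using k by (simp add: s_def field_simps)
  qed (use s in simp)
  have Ls: "L \<le> F + c * s" using L mult_left_mono[OF ns nn(5)] by linarith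
  have "sqrt (L\<^sup>2 + n\<^sup>2) \<le> sqrt ((F + c * s)\<^sup>2 + (0 + s)\<^sup>2)"
    using Ls ns nn by (intro real_sqrt_le_mono add_mono power_mono) auto
  also have "\<dots> \<le> sqrt (F\<^sup>2 + 0\<^sup>2) + sqrt ((c * s)\<^sup>2 + s\<^sup>2)"
    by (rule real_sqrt_sum_squares_triangle_ineq)
  also have "sqrt ((c * s)\<^sup>2 + s\<^sup>2) = sqrt (c\<^sup>2 + 1) * s"
  proof -
    have "(c * s)\<^sup>2 + s\<^sup>2 = (c\<^sup>2 + 1) * s\<^sup>2" by (simp add: power_mult_distrib algebra_simps)
    then show ?thesis using s by (simp add: real_sqrt_mult)
  qed
  also have "sqrt (F\<^sup>2 + 0\<^sup>2) + sqrt (c\<^sup>2 + 1) * s \<le> (1 / k) * sqrt (F\<^sup>2 + H\<^sup>2) + ((c\<^sup>2 + 1) / k) * sqrt (F\<^sup>2 + H\<^sup>2)"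
  proof (rule add_mono)
    have "sqrt (F\<^sup>2 + 0\<^sup>2) \<le> 1 * sqrt (F\<^sup>2 + H\<^sup>2)" by simp
    also have "\<dots> \<le> (1 / k) * sqrt (F\<^sup>2 + H\<^sup>2)" using k by (intro mult_right_mono) auto
    finally show "sqrt (F\<^sup>2 + 0\<^sup>2) \<le> (1 / k) * sqrt (F\<^sup>2 + H\<^sup>2)" .
    have "c * F + H \<le> sqrt (c\<^sup>2 + 1) * sqrt (F\<^sup>2 + H\<^sup>2)"
    proof -
      have "0 \<le> (c * H - F)\<^sup>2" by simp
      then have "(c * F + H)\<^sup>2 \<le> (c\<^sup>2 + 1) * (F\<^sup>2 + H\<^sup>2)" by (simp add: power2_eq_square algebra_simps)
      then show ?thesis by (metis real_le_rsqrt real_sqrt_mult)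
    qed
    then have "sqrt (c\<^sup>2 + 1) * (c * F + H) \<le> sqrt (c\<^sup>2 + 1) * (sqrt (c\<^sup>2 + 1) * sqrt (F\<^sup>2 + H\<^sup>2))"
      by (rule mult_left_mono) simp
    also have "\<dots> = (c\<^sup>2 + 1) * sqrt (F\<^sup>2 + H\<^sup>2)"
      by (simp add: real_sqrt_mult_self abs_of_nonneg flip: mult.assoc)
    finally show "sqrt (c\<^sup>2 + 1) * s \<le> ((c\<^sup>2 + 1) / k) * sqrt (F\<^sup>2 + H\<^sup>2)"
      using k by (simp add: s_def divide_right_mono)
  qed
  also have "\<dots> = ((2 + c\<^sup>2) / k) * sqrt (F\<^sup>2 + H\<^sup>2)" by (simp add: add_divide_distrib algebra_simps)
  finally show ?thesis .
qed

section \<open>Stability of the discrete system\<close>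

context parabolic
begin

text \<open>
  The norm of the time derivative of \<open>u\<close> in the dual of \<open>Y\<close>.
\<close>

definition dtn :: "(real \<Rightarrow> 'v) \<Rightarrow> real" where "dtn u = dual_norm T a (dt T j a u)"

lemma dtn_nonneg: "u \<in> X \<Longrightarrow> 0 \<le> dtn u"
  using Y.fnorm_nonneg[OF dt_functional] by (simp add: dtn_def fnorm_eq)

lemma dt_bound: "u \<in> X \<Longrightarrow> v \<in> Y \<Longrightarrow> \<bar>dt T j a u v\<bar> \<le> dtn u * normY T a v"
  using Y.functional_bound[OF dt_functional] by (simp add: dtn_def fnorm_eq nrm_eq)

lemma Cop_bound:
  assumes u: "u \<in> X" and v: "v \<in> Y"
  shows "\<bar>Cop T j a u v\<bar> \<le> (dtn u + op_norm T a (Aa T a) * normY T a u) * normY T a v"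
  using dt_bound[OF u v] Aa_bound[OF X_L2[OF u] v] abs_triangle_ineq[of "dt T j a u v" "Aa T a u v"]
  by (simp add: Cop_eq algebra_simps)

lemma Cop_lin_left:
  assumes "u \<in> X" "u' \<in> X" "v \<in> Y"
  shows "Cop T j a (\<lambda>t. r *\<^sub>R u t + s *\<^sub>R u' t) v = r * Cop T j a u v + s * Cop T j a u' v"
  using dt_lin[OF assms] Aa_lin[OF X_L2[OF assms(1)] X_L2[OF assms(2)] assms(3)]
  by (simp add: Cop_eq algebra_simps)

lemma functional_lin:
  assumes f: "Y.is_functional f" and "v \<in> Y" "w \<in> Y"
  shows "f (\<lambda>t. r *\<^sub>R v t + s *\<^sub>R w t) = r * f v + s * f w"
  using f assms(2,3) by (simp add: Y.is_functional_def L2_scale)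

lemma Cop_functional:
  assumes u: "u \<in> X"
  shows "Y.is_functional (Cop T j a u)"
  using Y.is_functional_comb[OF dt_functional[OF u] Aa_functional[OF X_L2[OF u]], of 1 1]
  by (simp add: Cop_eq[abs_def])

lemma normX_sq: "(normX T j a u)\<^sup>2 = (normY T a u)\<^sup>2 + (dtn u)\<^sup>2 + (norm (trace T j T u))\<^sup>2"
  by (simp add: normX_def dtn_def)

lemma norm_YX_sq: "(norm_YX T j a v u)\<^sup>2
    = (normY T a v)\<^sup>2 + ((normY T a u)\<^sup>2 + (dtn u)\<^sup>2 + (norm (trace T j T u))\<^sup>2)"
  by (simp add: norm_YX_def normX_sq)

lemma norm_YX_nonneg: "0 \<le> norm_YX T j a v u"
  by (simp add: norm_YX_def)

text \<open>
  The norm on pairs is quadratic along planes; \<open>B\<close> is the inner product of the two pairs.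
\<close>

lemma norm_YX_comb:
  assumes v: "v \<in> Y" "v' \<in> Y" and u: "u \<in> X" "u' \<in> X"
  obtains B where "\<And>r s. (norm_YX T j a (\<lambda>t. r *\<^sub>R v t + s *\<^sub>R v' t) (\<lambda>t. r *\<^sub>R u t + s *\<^sub>R u' t))\<^sup>2
    = r\<^sup>2 * (norm_YX T j a v u)\<^sup>2 + 2 * (r * s) * B + s\<^sup>2 * (norm_YX T j a v' u')\<^sup>2"
proof -
  obtain D where D: "\<And>r s. (Y.fnorm (\<lambda>w. r * dt T j a u w + s * dt T j a u' w))\<^sup>2
      = r\<^sup>2 * (Y.fnorm (dt T j a u))\<^sup>2 + 2 * (r * s) * D + s\<^sup>2 * (Y.fnorm (dt T j a u'))\<^sup>2"
    by (rule Y.fnorm_comb_sq[OF dt_functional[OF u(1)] dt_functional[OF u(2)]]) blast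
  have dn: "dtn (\<lambda>t. r *\<^sub>R u t + s *\<^sub>R u' t) = Y.fnorm (\<lambda>w. r * dt T j a u w + s * dt T j a u' w)" for r s
    unfolding dtn_def fnorm_eq dual_norm_def by (rule SUP_cong) (auto simp: dt_lin[OF u])
  have TT: "T \<in> {0..T}" using T_pos by simp
  have tr: "(norm (trace T j T (\<lambda>t. r *\<^sub>R u t + s *\<^sub>R u' t)))\<^sup>2
     = r\<^sup>2 * (norm (trace T j T u))\<^sup>2 + 2 * (r * s) * (trace T j T u \<bullet> trace T j T u') + s\<^sup>2 * (norm (trace T j T u'))\<^sup>2" for r s
    unfolding trace_lin[OF u TT] power2_norm_eq_inner
    by (simp add: inner_add_left inner_add_right inner_commute power2_eq_square algebra_simps)
  have q: "(normY T a (\<lambda>t. r *\<^sub>R v t + s *\<^sub>R v' t))\<^sup>2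
      = r\<^sup>2 * (normY T a v)\<^sup>2 + 2 * (r * s) * As T a v v' + s\<^sup>2 * (normY T a v')\<^sup>2" if "v \<in> Y" "v' \<in> Y" for v v' r s
    using Y.nrm_comb_sq[OF that, of r s] by (simp add: nrm_eq)
  show ?thesis
  proof (rule that)
    fix r s
    show "(norm_YX T j a (\<lambda>t. r *\<^sub>R v t + s *\<^sub>R v' t) (\<lambda>t. r *\<^sub>R u t + s *\<^sub>R u' t))\<^sup>2
      = r\<^sup>2 * (norm_YX T j a v u)\<^sup>2 + 2 * (r * s) * (As T a v v' + As T a u u' + D + trace T j T u \<bullet> trace T j T u')
        + s\<^sup>2 * (norm_YX T j a v' u')\<^sup>2"
      unfolding norm_YX_sq q[OF v] q[OF X_L2[OF u(1)] X_L2[OF u(2)]] tr dn D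
      by (simp add: fnorm_eq dtn_def algebra_simps)
  qed
qed

text \<open>
  The norm of the Galerkin projection of a pair \<open>(\<Lambda>, U)\<close> is at most \<open>C_const\<close> times the norm of the pair. The first data
  functional is \<open>f\<close>, with dual norm \<open>F\<close> on \<open>Yd\<close>, and \<open>h\<close> is the value of the second one at \<open>u\<close>. The
  number \<open>S\<close> bounds the dual norm of \<open>C u\<close> on \<open>Yd\<close>. Testing with the pair \<open>(l, u)\<close> itself gives
  \<open>S\<^sup>2 + p\<^sup>2 + r\<^sup>2 = F\<^sup>2 - f l - h\<close>, which plays the part of the Schur complement equation.
\<close>

lemma discrete_stability:
  fixes Yd Xd :: "(real \<Rightarrow> 'v) set" and \<gamma> \<alpha> :: real
  assumes Yd: "Yd \<subseteq> Y" "(\<lambda>t. 0) \<in> Yd" "\<And>u v. u \<in> Yd \<Longrightarrow> v \<in> Yd \<Longrightarrow> (\<lambda>t. u t + v t) \<in> Yd"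
      "\<And>r u. u \<in> Yd \<Longrightarrow> (\<lambda>t. r *\<^sub>R u t) \<in> Yd"
    and Xd: "Xd \<subseteq> X"
    and \<gamma>: "0 < \<gamma>" "\<gamma> \<le> 1" and \<alpha>: "\<alpha> = op_norm T a (Aa T a)"
    and infsup: "\<And>u S. u \<in> Xd \<Longrightarrow> 0 \<le> S \<Longrightarrow> (\<And>v. v \<in> Yd \<Longrightarrow> \<bar>dt T j a u v\<bar> \<le> S * normY T a v) \<Longrightarrow> \<gamma> * dtn u \<le> S"
    and l: "l \<in> Yd" and u: "u \<in> Xd" and \<Lambda>: "\<Lambda> \<in> Y" and U: "U \<in> X"
    and eq1: "\<And>v. v \<in> Yd \<Longrightarrow> As T a l v + Cop T j a u v = As T a \<Lambda> v + Cop T j a U v"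
    and eq2: "\<And>w. w \<in> Xd \<Longrightarrow> Cop T j a w l - As T a u w - trace T j T u \<bullet> trace T j T w
      = Cop T j a w \<Lambda> - As T a U w - trace T j T U \<bullet> trace T j T w"
  shows "norm_YX T j a l u \<le> C_const \<gamma> \<alpha> * norm_YX T j a \<Lambda> U"
proof -
  interpret D: semi_ip Yd "\<lambda>u v t. u t + v t" "\<lambda>r u t. r *\<^sub>R u t" "As T a"
  proof
    show "Yd \<noteq> {}" using Yd(2) by blast
    fix u v w r assume u: "u \<in> Yd"
    then have uY: "u \<in> Y" using Yd(1) by blast
    show "(\<lambda>t. r *\<^sub>R u t) \<in> Yd" by (rule Yd(4)[OF u])
    show "0 \<le> As T a u u" by (rule Y.ip_nonneg[OF uY])
    assume v: "v \<in> Yd"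
    then have vY: "v \<in> Y" using Yd(1) by blast
    show "(\<lambda>t. u t + v t) \<in> Yd" by (rule Yd(3)[OF u v])
    show "As T a (\<lambda>t. r *\<^sub>R u t) v = r * As T a u v" by (rule Y.ip_smul[OF uY vY])
    show "As T a u v = As T a v u" by (rule As_sym)
    assume w: "w \<in> Yd"
    then have wY: "w \<in> Y" using Yd(1) by blast
    show "As T a (\<lambda>t. u t + v t) w = As T a u w + As T a v w" by (rule Y.ip_add[OF uY vY wY])
  qed
  have Dn: "D.nrm = normY T a" by (intro ext) (simp add: D.nrm_def normY_def)
  have lY: "l \<in> Y" and uX: "u \<in> X" using l u Yd Xd by auto
  note uY = X_L2[OF uX] and UY = X_L2[OF U]
  have a0: "0 \<le> \<alpha>" using op_norm_nonneg by (simp add: \<alpha>)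
  define p q r where "p = normY T a u" and "q = dtn u" and "r = norm (trace T j T u)"
  define p' q' r' l' where "p' = normY T a U" and "q' = dtn U" and "r' = norm (trace T j T U)" and "l' = normY T a \<Lambda>"
  define L where "L = normY T a l"
  have nn: "0 \<le> p" "0 \<le> q" "0 \<le> r" "0 \<le> p'" "0 \<le> q'" "0 \<le> r'" "0 \<le> l'" "0 \<le> L"
    by (auto simp: p_def q_def r_def p'_def q'_def r'_def l'_def L_def normY_nonneg dtn_nonneg uY UY uX U \<Lambda> lY)
  define n where "n = sqrt (p\<^sup>2 + q\<^sup>2 + r\<^sup>2)"
  define c where "c = sqrt (1 + \<alpha>\<^sup>2)"
  have n2: "n\<^sup>2 = p\<^sup>2 + q\<^sup>2 + r\<^sup>2" by (simp add: n_def)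
  have c2: "c\<^sup>2 = 1 + \<alpha>\<^sup>2" by (simp add: c_def)
  have n0: "0 \<le> n" and c0: "0 \<le> c" by (simp_all add: n_def c_def)
  define f where "f v = As T a \<Lambda> v + Cop T j a U v" for v
  define F where "F = D.fnorm f"
  have fY: "Y.is_functional f"
  proof -
    have "Y.is_functional (As T a \<Lambda>)"
      unfolding Y.is_functional_def using Y.ip_add_right Y.ip_smul_right Y.ip_cauchy_schwarz \<Lambda> by blast
    from Y.is_functional_comb[OF this Cop_functional[OF U], of 1 1] show ?thesis by (simp add: f_def[abs_def])
  qed
  have fD: "D.is_functional f"
    using fY Yd(1) unfolding Y.is_functional_def D.is_functional_def nrm_eq Dn by blast
  have fb: "\<bar>f v\<bar> \<le> (l' + q' + \<alpha> * p') * normY T a v" if "v \<in> Y" for v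
    using Y.ip_cauchy_schwarz[OF \<Lambda> that] Cop_bound[OF U that] abs_triangle_ineq[of "As T a \<Lambda> v" "Cop T j a U v"]
    unfolding f_def nrm_eq l'_def q'_def p'_def \<alpha> by (simp add: algebra_simps)
  have F0: "0 \<le> F" unfolding F_def by (rule D.fnorm_nonneg[OF fD])
  have Fle: "F \<le> l' + q' + \<alpha> * p'"
    unfolding F_def by (rule D.fnorm_least[OF fD]) (use fb Yd(1) nn a0 in \<open>auto simp: Dn\<close>)
  have Cu: "f v - As T a l v = Cop T j a u v" if "v \<in> Yd" for v using eq1[OF that] by (simp add: f_def)
  have qc: "q + \<alpha> * p \<le> c * n"
  proof -
    have "0 \<le> (\<alpha> * q - p)\<^sup>2 + (1 + \<alpha>\<^sup>2) * r\<^sup>2" by simp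
    then have "(q + \<alpha> * p)\<^sup>2 \<le> (1 + \<alpha>\<^sup>2) * (p\<^sup>2 + q\<^sup>2 + r\<^sup>2)"
      by (simp add: power2_eq_square algebra_simps)
    then show ?thesis unfolding c_def n_def by (metis real_le_rsqrt real_sqrt_mult)
  qed
  have Cub: "\<bar>Cop T j a u v\<bar> \<le> (c * n) * normY T a v" if v: "v \<in> Y" for v
    using Cop_bound[OF uX v] mult_right_mono[OF qc normY_nonneg[OF v]] by (simp add: q_def p_def \<alpha>)
  have B: "F\<^sup>2 - f l \<le> (c * n) * F"
    unfolding F_def by (rule D.fnorm_sq_minus_le[OF fD l]) (use Cu Cub Yd(1) in \<open>auto simp: Dn\<close>)
  \<comment> \<open>the norm of the discrete representer of \<open>f\<close> minus \<open>l\<close>, that is, of the representer of \<open>C u\<close>\<close>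
  define S where "S = sqrt (F\<^sup>2 - 2 * f l + L\<^sup>2)"
  have S2: "S\<^sup>2 = F\<^sup>2 - 2 * f l + L\<^sup>2"
  proof -
    have "f l \<le> F * L" using D.functional_bound[OF fD l] by (simp add: F_def L_def Dn abs_le_iff)
    then have "0 \<le> F\<^sup>2 - 2 * f l + L\<^sup>2" using zero_le_power2[of "F - L"] by (simp add: power2_diff)
    then show ?thesis by (simp add: S_def)
  qed
  have S0: "0 \<le> S" using S2 unfolding S_def by (metis S_def abs_ge_zero real_sqrt_abs)
  have A: "\<bar>Cop T j a u v\<bar> \<le> S * normY T a v" if v: "v \<in> Yd" for v
    using D.functional_minus_ip_bound[OF fD l v] Cu[OF v] by (simp add: S_def F_def L_def Dn)
  have "\<gamma> * dtn u \<le> S + \<alpha> * p"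
  proof (rule infsup[OF u])
    show "0 \<le> S + \<alpha> * p" using S0 a0 nn by simp
    fix v assume v: "v \<in> Yd"
    then have vY: "v \<in> Y" using Yd(1) by blast
    have "\<bar>dt T j a u v\<bar> \<le> \<bar>Cop T j a u v\<bar> + \<bar>Aa T a u v\<bar>" unfolding Cop_eq by linarith
    also have "\<dots> \<le> S * normY T a v + \<alpha> * p * normY T a v"
      using A[OF v] Aa_bound[OF uY vY] by (simp add: \<alpha> p_def)
    finally show "\<bar>dt T j a u v\<bar> \<le> (S + \<alpha> * p) * normY T a v" by (simp add: algebra_simps)
  qed
  then have coer: "(1 - rho_root \<gamma> \<alpha>) * \<gamma>\<^sup>2 * n\<^sup>2 \<le> S\<^sup>2 + p\<^sup>2 + r\<^sup>2"
    unfolding n2 q_def[symmetric] by (intro schur_coercive \<gamma> nn S0 a0)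
  define h where "h = Cop T j a u \<Lambda> - As T a U u - trace T j T U \<bullet> trace T j T u"
  define H where "H = sqrt (l'\<^sup>2 + (\<alpha> * l' + p')\<^sup>2 + r'\<^sup>2)"
  have hb: "- h \<le> H * n"
  proof -
    have "- h \<le> (q + \<alpha> * p) * l' + p' * p + r' * r"
      using Cop_bound[OF uX \<Lambda>] Y.ip_cauchy_schwarz[OF UY uY] Cauchy_Schwarz_ineq2[of "trace T j T U" "trace T j T u"]
      unfolding h_def nrm_eq p_def q_def r_def p'_def r'_def l'_def \<alpha> by linarith
    also have "\<dots> = ((\<alpha> * l' + p', l'), r') \<bullet> ((p, q), r)" by (simp add: algebra_simps)
    also have "\<dots> \<le> norm ((\<alpha> * l' + p', l'), r') * norm ((p, q), r)" by (rule norm_cauchy_schwarz)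
    also have "\<dots> = H * n" by (simp add: norm_prod_def H_def n_def add.commute add.left_commute)
    finally show ?thesis .
  qed
  have e1: "L\<^sup>2 + Cop T j a u l = f l" using Cu[OF l] Y.nrm_sq[OF lY] by (simp add: nrm_eq L_def)
  have e2: "Cop T j a u l - p\<^sup>2 - r\<^sup>2 = h"
    using eq2[OF u] Y.nrm_sq[OF uY] by (simp add: nrm_eq p_def r_def h_def power2_norm_eq_inner)
  have main: "(1 - rho_root \<gamma> \<alpha>) * \<gamma>\<^sup>2 * n\<^sup>2 \<le> c * n * F + H * n"
    using coer S2 e1 e2 B hb by linarith
  have LL: "L \<le> F + c * n"
  proof (cases "L = 0")
    case False
    have "L * L \<le> (F + c * n) * L"
      using e1 D.functional_bound[OF fD l] Cub[OF lY] by (simp add: F_def L_def Dn power2_eq_square algebra_simps abs_le_iff)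
    then show ?thesis using False nn by simp
  qed (use F0 c0 n0 in simp)
  have H0: "0 \<le> H" by (simp add: H_def)
  have H2: "H\<^sup>2 = l'\<^sup>2 + (\<alpha> * l' + p')\<^sup>2 + r'\<^sup>2" by (simp add: H_def)
  let ?k = "(1 - rho_root \<gamma> \<alpha>) * \<gamma>\<^sup>2"
  note kp = kappa_pos[OF \<gamma>, of \<alpha>] and k1 = kappa_le_1[OF \<gamma>, of \<alpha>]
  have "norm_YX T j a l u = sqrt (L\<^sup>2 + n\<^sup>2)"
    using norm_YX_sq[of l u] norm_YX_nonneg[of l u] by (metis L_def n2 p_def q_def r_def real_sqrt_unique)
  also have "\<dots> \<le> ((2 + c\<^sup>2) / ?k) * sqrt (F\<^sup>2 + H\<^sup>2)"
    by (rule saddle_bound[OF nn(8) n0 F0 H0 c0 kp k1 main LL])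
  also have "\<dots> \<le> ((2 + c\<^sup>2) / ?k) * ((sqrt 3 + \<alpha>) * sqrt (l'\<^sup>2 + (p'\<^sup>2 + q'\<^sup>2 + r'\<^sup>2)))"
  proof (rule mult_left_mono)
    have "sqrt (F\<^sup>2 + H\<^sup>2) \<le> sqrt ((l' + q' + \<alpha> * p')\<^sup>2 + H\<^sup>2)"
      using Fle F0 by (intro real_sqrt_le_mono add_right_mono power_mono)
    also have "\<dots> \<le> (sqrt 3 + \<alpha>) * sqrt (l'\<^sup>2 + (p'\<^sup>2 + q'\<^sup>2 + r'\<^sup>2))"
      unfolding H2 by (rule data_norm_bound[OF a0])
    finally show "sqrt (F\<^sup>2 + H\<^sup>2) \<le> (sqrt 3 + \<alpha>) * sqrt (l'\<^sup>2 + (p'\<^sup>2 + q'\<^sup>2 + r'\<^sup>2))" .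
    show "0 \<le> (2 + c\<^sup>2) / ?k" using kp by simp
  qed
  also have "sqrt (l'\<^sup>2 + (p'\<^sup>2 + q'\<^sup>2 + r'\<^sup>2)) = norm_YX T j a \<Lambda> U"
    using norm_YX_sq[of \<Lambda> U] norm_YX_nonneg[of \<Lambda> U] by (metis l'_def p'_def q'_def r'_def real_sqrt_unique)
  finally show ?thesis by (simp add: C_const_def c2)
qed

end

section \<open>Quasi-optimality\<close>

context parabolic
begin

text \<open>
  The real form of the inf-sup condition. The upper bound \<open>\<gamma> \<le> 1\<close> is needed, since for larger \<open>\<gamma>\<close> the
  equation for \<open>\<rho>\<close> can have two roots in \<open>[0, 1)\<close>.
\<close>

lemma inf_sup_bounds:
  assumes "\<Delta> \<noteq> {}" and Yd: "\<And>\<delta>. \<delta> \<in> \<Delta> \<Longrightarrow> Yd \<delta> \<subseteq> Y" and Xd: "\<And>\<delta>. \<delta> \<in> \<Delta> \<Longrightarrow> Xd \<delta> \<subseteq> X"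
    and pos: "gamma_inf_sup T j a \<Delta> Yd Xd > 0" and \<gamma>: "\<gamma> = real_of_ereal (gamma_inf_sup T j a \<Delta> Yd Xd)"
  shows inf_sup_pos: "0 < \<gamma>" and inf_sup_le_1: "\<gamma> \<le> 1"
    and inf_sup: "\<lbrakk>\<delta> \<in> \<Delta>; u \<in> Xd \<delta>; 0 \<le> S; \<And>v. v \<in> Yd \<delta> \<Longrightarrow> \<bar>dt T j a u v\<bar> \<le> S * normY T a v\<rbrakk>
      \<Longrightarrow> \<gamma> * dtn u \<le> S"
proof -
  define U where "U \<delta> = {u \<in> Xd \<delta>. \<exists>v\<in>Y. dt T j a u v \<noteq> 0}" for \<delta>
  define s where "s \<delta> u = (SUP v\<in>{v \<in> Yd \<delta>. \<not> (AE t in I. v t = 0)}.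
      ereal (dt T j a u v / (dtn u * normY T a v)))" for \<delta> u
  let ?G = "gamma_inf_sup T j a \<Delta> Yd Xd"
  define val where "val \<delta> = (if U \<delta> = {} then 1 else (INF u\<in>U \<delta>. s \<delta> u))" for \<delta>
  have G: "?G = (INF \<delta>\<in>\<Delta>. val \<delta>)"
    unfolding gamma_inf_sup_def Let_def val_def U_def s_def dtn_def ..
  have dtn_pos: "0 < dtn u" if d: "\<delta> \<in> \<Delta>" and u: "u \<in> U \<delta>" for \<delta> u
  proof -
    have uX: "u \<in> X" using d u Xd by (auto simp: U_def)
    obtain v where v: "v \<in> Y" "dt T j a u v \<noteq> 0" using u unfolding U_def by blast
    have "dtn u \<noteq> 0" using dt_bound[OF uX v(1)] v(2) by auto
    then show ?thesis using dtn_nonneg[OF uX] by simp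
  qed
  have s_le: "s \<delta> u \<le> ereal (S / dtn u)"
    if "\<delta> \<in> \<Delta>" "u \<in> U \<delta>" and le: "\<And>v. v \<in> Yd \<delta> \<Longrightarrow> \<bar>dt T j a u v\<bar> \<le> S * normY T a v" for \<delta> u S
    unfolding s_def
  proof (rule SUP_least)
    fix v assume v: "v \<in> {v \<in> Yd \<delta>. \<not> (AE t in I. v t = 0)}"
    then have vY: "v \<in> Y" using Yd[OF that(1)] by blast
    have "normY T a v \<noteq> 0" using v normY_eq_0_iff[OF vY] by simp
    then have "0 < normY T a v" using normY_nonneg[OF vY] by simp
    then have "dt T j a u v / (dtn u * normY T a v) \<le> S / dtn u"
      using le[of v] v dtn_pos[OF that(1,2)] by (simp add: divide_simps abs_le_iff mult_ac)
    then show "ereal (dt T j a u v / (dtn u * normY T a v)) \<le> ereal (S / dtn u)" by simp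
  qed
  have G_le: "?G \<le> s \<delta> u" if "\<delta> \<in> \<Delta>" "u \<in> U \<delta>" for \<delta> u
  proof -
    have "?G \<le> val \<delta>" unfolding G by (rule INF_lower[OF that(1)])
    also have "\<dots> = (INF u\<in>U \<delta>. s \<delta> u)" using that(2) by (auto simp: val_def)
    also have "\<dots> \<le> s \<delta> u" by (rule INF_lower[OF that(2)])
    finally show ?thesis .
  qed
  have G1: "?G \<le> 1"
  proof -
    obtain \<delta> where d: "\<delta> \<in> \<Delta>" using assms(1) by blast
    show ?thesis
    proof (cases "U \<delta> = {}")
      case True
      have "?G \<le> val \<delta>" unfolding G by (rule INF_lower[OF d])
      then show ?thesis using True by (simp add: val_def)
    next
      case False
      then obtain u where u: "u \<in> U \<delta>" by blast
      have uX: "u \<in> X" using u d Xd by (auto simp: U_def)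
      have "s \<delta> u \<le> ereal (dtn u / dtn u)"
        by (rule s_le[OF d u]) (use dt_bound[OF uX] Yd[OF d] in blast)
      then show ?thesis using G_le[OF d u] dtn_pos[OF d u] by (simp add: one_ereal_def order_trans)
    qed
  qed
  then have Gr: "?G = ereal \<gamma>" using pos \<gamma> by (cases ?G) auto
  show "0 < \<gamma>" "\<gamma> \<le> 1" using pos G1 by (simp_all add: Gr)
  show "\<gamma> * dtn u \<le> S" if d: "\<delta> \<in> \<Delta>" and u: "u \<in> Xd \<delta>" and S: "0 \<le> S"
    and le: "\<And>v. v \<in> Yd \<delta> \<Longrightarrow> \<bar>dt T j a u v\<bar> \<le> S * normY T a v"
  proof (cases "u \<in> U \<delta>")
    case True
    have "ereal \<gamma> \<le> ereal (S / dtn u)" using G_le[OF d True] s_le[OF d True le] unfolding Gr by (rule order_trans)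
    then show ?thesis using dtn_pos[OF d True] by (simp add: pos_le_divide_eq)
  next
    case False
    have uX: "u \<in> X" using u d Xd by blast
    have "dtn u \<le> 0"
      unfolding dtn_def fnorm_eq[symmetric]
      by (rule Y.fnorm_least[OF dt_functional[OF uX]]) (use False u in \<open>auto simp: U_def\<close>)
    then show ?thesis using S dtn_nonneg[OF uX] by simp
  qed
qed

text \<open>
  The pair \<open>(e, e')\<close> is the Galerkin error, and \<open>(y, y')\<close> is the difference of the Galerkin solution and the
  competitor. By Galerkin orthogonality the discrete pair \<open>s (y, y')\<close> is the projection of
  \<open>r (e, e') + s (y, y')\<close>, for all \<open>r\<close> and \<open>s\<close>, so the stability bound holds on the whole plane.
\<close>

lemma galerkin_quasi_optimal:
  assumes Yd: "closed_subspace (normY T a) Y Yd" and Xd: "closed_subspace (normX T j a) X Xd"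
    and \<gamma>: "0 < \<gamma>" "\<gamma> \<le> 1" and \<alpha>: "\<alpha> = op_norm T a (Aa T a)"
    and infsup: "\<And>u S. u \<in> Xd \<Longrightarrow> 0 \<le> S \<Longrightarrow> (\<And>v. v \<in> Yd \<Longrightarrow> \<bar>dt T j a u v\<bar> \<le> S * normY T a v) \<Longrightarrow> \<gamma> * dtn u \<le> S"
    and sol: "mixed_solution T j a g u0 l u" and gal: "galerkin_solution T j a g u0 Yd Xd ld ud"
    and lb: "lb \<in> Yd" and ub: "ub \<in> Xd"
  shows "norm_YX T j a (\<lambda>t. l t - ld t) (\<lambda>t. u t - ud t)
    \<le> C_const \<gamma> \<alpha> * norm_YX T j a (\<lambda>t. l t - lb t) (\<lambda>t. u t - ub t)"
proof -
  have YdY: "Yd \<subseteq> Y" and Yd0: "(\<lambda>t. 0) \<in> Yd" and Yda: "\<And>u v. u \<in> Yd \<Longrightarrow> v \<in> Yd \<Longrightarrow> (\<lambda>t. u t + v t) \<in> Yd"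
    and Yds: "\<And>r u. u \<in> Yd \<Longrightarrow> (\<lambda>t. r *\<^sub>R u t) \<in> Yd"
    using Yd by (auto simp: closed_subspace_def)
  have XdX: "Xd \<subseteq> X" and Xd0: "(\<lambda>t. 0) \<in> Xd" and Xda: "\<And>u v. u \<in> Xd \<Longrightarrow> v \<in> Xd \<Longrightarrow> (\<lambda>t. u t + v t) \<in> Xd"
    and Xds: "\<And>r u. u \<in> Xd \<Longrightarrow> (\<lambda>t. r *\<^sub>R u t) \<in> Xd"
    using Xd by (auto simp: closed_subspace_def)
  have l: "l \<in> Y" and u: "u \<in> X" and ld: "ld \<in> Yd" and ud: "ud \<in> Xd"
    using sol gal by (auto simp: mixed_solution_def galerkin_solution_def)
  have "ld \<in> Y" "lb \<in> Y" "ud \<in> X" "ub \<in> X" using ld lb ud ub YdY XdX by auto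
  note in_spaces = this
  define e y where "e = (\<lambda>t. 1 *\<^sub>R l t + (-1) *\<^sub>R ld t)" and "y = (\<lambda>t. 1 *\<^sub>R ld t + (-1) *\<^sub>R lb t)"
  define e' y' where "e' = (\<lambda>t. 1 *\<^sub>R u t + (-1) *\<^sub>R ud t)" and "y' = (\<lambda>t. 1 *\<^sub>R ud t + (-1) *\<^sub>R ub t)"
  have eY: "e \<in> Y" and yYd: "y \<in> Yd" unfolding e_def y_def
    by (rule L2_lin[OF l in_spaces(1)], rule Yda[OF Yds[OF ld] Yds[OF lb]])
  have eX: "e' \<in> X" and yXd: "y' \<in> Xd" unfolding e'_def y'_def
    by (rule X_lin[OF u in_spaces(3)], rule Xda[OF Xds[OF ud] Xds[OF ub]])
  have yY: "y \<in> Y" and yX: "y' \<in> X" using yYd yXd YdY XdX by auto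
  have TT: "T \<in> {0..T}" using T_pos by simp
  have orth1: "As T a e v + Cop T j a e' v = 0" if v: "v \<in> Yd" for v
  proof -
    have vY: "v \<in> Y" using v YdY by blast
    have "As T a l v + Cop T j a u v = g v" using sol vY by (simp add: mixed_solution_def)
    moreover have "As T a ld v + Cop T j a ud v = g v" using gal v Xd0 unfolding galerkin_solution_def by blast
    ultimately show ?thesis
      unfolding e_def e'_def As_lin[OF l in_spaces(1) vY] Cop_lin_left[OF u in_spaces(3) vY] by simp
  qed
  have orth2: "Cop T j a w e - As T a e' w - trace T j T e' \<bullet> trace T j T w = 0" if w: "w \<in> Xd" for w
  proof -
    have wX: "w \<in> X" using w XdX by blast
    have "Cop T j a w l - (As T a u w + trace T j T u \<bullet> trace T j T w) = - (g w + u0 \<bullet> trace T j 0 w)"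
      using sol wX by (simp add: mixed_solution_def dual_op_def)
    moreover have "Cop T j a w ld - As T a ud w - trace T j T ud \<bullet> trace T j T w = - g w - u0 \<bullet> trace T j 0 w"
      using gal w Yd0 unfolding galerkin_solution_def by blast
    ultimately show ?thesis
      unfolding e_def e'_def functional_lin[OF Cop_functional[OF wX] l in_spaces(1)]
        As_lin[OF X_L2[OF u] X_L2[OF in_spaces(3)] X_L2[OF wX]] trace_lin[OF u in_spaces(3) TT]
      by (simp add: inner_diff_left)
  qed
  obtain B where B: "\<And>r s. (norm_YX T j a (\<lambda>t. r *\<^sub>R e t + s *\<^sub>R y t) (\<lambda>t. r *\<^sub>R e' t + s *\<^sub>R y' t))\<^sup>2
    = r\<^sup>2 * (norm_YX T j a e e')\<^sup>2 + 2 * (r * s) * B + s\<^sup>2 * (norm_YX T j a y y')\<^sup>2"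
    using norm_YX_comb[OF eY yY eX yX] by blast
  have C1: "1 \<le> C_const \<gamma> \<alpha>"
    using C_const_ge[OF \<gamma>, of \<alpha>] op_norm_nonneg by (simp add: \<alpha>)
  have stab: "s\<^sup>2 * (norm_YX T j a y y')\<^sup>2
      \<le> (C_const \<gamma> \<alpha>)\<^sup>2 * (r\<^sup>2 * (norm_YX T j a e e')\<^sup>2 + 2 * (r * s) * B + s\<^sup>2 * (norm_YX T j a y y')\<^sup>2)" for r s
  proof -
    let ?\<Lambda> = "\<lambda>t. r *\<^sub>R e t + s *\<^sub>R y t" and ?U = "\<lambda>t. r *\<^sub>R e' t + s *\<^sub>R y' t"
    let ?y = "\<lambda>t. s *\<^sub>R y t" and ?y' = "\<lambda>t. s *\<^sub>R y' t"
    have "norm_YX T j a ?y ?y' \<le> C_const \<gamma> \<alpha> * norm_YX T j a ?\<Lambda> ?U"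
    proof (rule discrete_stability[OF YdY Yd0 Yda Yds XdX \<gamma> \<alpha> infsup Yds[OF yYd] Xds[OF yXd] L2_lin[OF eY yY] X_lin[OF eX yX]])
      fix v assume v: "v \<in> Yd"
      then have vY: "v \<in> Y" using YdY by blast
      show "As T a ?y v + Cop T j a ?y' v = As T a ?\<Lambda> v + Cop T j a ?U v"
        using As_lin[OF yY yY vY, of s 0] Cop_lin_left[OF yX yX vY, of s 0] orth1[OF v]
        unfolding As_lin[OF eY yY vY] Cop_lin_left[OF eX yX vY]
        by (simp add: algebra_simps) (metis distrib_left mult_zero_right)
    next
      fix w assume w: "w \<in> Xd"
      then have wX: "w \<in> X" using XdX by blast
      note Cf = Cop_functional[OF wX]
      have r0: "r * Cop T j a w e = r * As T a e' w + r * (trace T j T e' \<bullet> trace T j T w)"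
        using orth2[OF w] by (simp flip: distrib_left)
      show "Cop T j a w ?y - As T a ?y' w - trace T j T ?y' \<bullet> trace T j T w
          = Cop T j a w ?\<Lambda> - As T a ?U w - trace T j T ?U \<bullet> trace T j T w"
        using functional_lin[OF Cf yY yY, of s 0] As_lin[OF X_L2[OF yX] X_L2[OF yX] X_L2[OF wX], of s 0]
          trace_lin[OF yX yX TT, of s 0] r0
        unfolding functional_lin[OF Cf eY yY] As_lin[OF X_L2[OF eX] X_L2[OF yX] X_L2[OF wX]] trace_lin[OF eX yX TT]
        by (simp add: inner_add_left)
    qed (fact | assumption)+
    then have "(norm_YX T j a ?y ?y')\<^sup>2 \<le> (C_const \<gamma> \<alpha> * norm_YX T j a ?\<Lambda> ?U)\<^sup>2"
      by (intro power_mono norm_YX_nonneg)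
    moreover have "(norm_YX T j a ?y ?y')\<^sup>2 = s\<^sup>2 * (norm_YX T j a y y')\<^sup>2" using B[of 0 s] by simp
    ultimately show ?thesis by (simp add: power_mult_distrib B)
  qed
  have "norm_YX T j a e e' \<le> C_const \<gamma> \<alpha> * sqrt ((norm_YX T j a e e')\<^sup>2 + 2 * B + (norm_YX T j a y y')\<^sup>2)"
  proof (rule kato_projection[OF norm_YX_nonneg norm_YX_nonneg C1 _ stab])
    show "0 \<le> t\<^sup>2 * (norm_YX T j a e e')\<^sup>2 + 2 * (t * s) * B + s\<^sup>2 * (norm_YX T j a y y')\<^sup>2" for s t
      unfolding B[symmetric] by simp
  qed
  also have "sqrt ((norm_YX T j a e e')\<^sup>2 + 2 * B + (norm_YX T j a y y')\<^sup>2)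
      = norm_YX T j a (\<lambda>t. 1 *\<^sub>R e t + 1 *\<^sub>R y t) (\<lambda>t. 1 *\<^sub>R e' t + 1 *\<^sub>R y' t)"
    using B[of 1 1] norm_YX_nonneg by (intro real_sqrt_unique) auto
  finally show ?thesis by (simp add: e_def e'_def y_def y'_def)
qed

end

theorem theorem3p3:
  fixes T :: real
    and j :: "'v::{real_inner,banach,second_countable_topology} \<Rightarrow>
              'h::{real_inner,banach,second_countable_topology}"
    and a :: "real \<Rightarrow> 'v \<Rightarrow> 'v \<Rightarrow> real"
    and \<Delta> :: "'d set"
    and Yd Xd :: "'d \<Rightarrow> (real \<Rightarrow> 'v) set"
    and \<gamma> \<alpha> :: real
  assumes "T > 0"
    and "gelfand_embedding j"
    and "admissible_form T a"
    and "\<Delta> \<noteq> {}"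
    and "\<And>\<delta>. \<delta> \<in> \<Delta> \<Longrightarrow> closed_subspace (normY T a) (Yspace T) (Yd \<delta>)"
    and "\<And>\<delta>. \<delta> \<in> \<Delta> \<Longrightarrow> closed_subspace (normX T j a) (Xspace T j) (Xd \<delta>)"
    and "gamma_inf_sup T j a \<Delta> Yd Xd > 0"
    and "\<gamma> = real_of_ereal (gamma_inf_sup T j a \<Delta> Yd Xd)"
    and "\<alpha> = op_norm T a (Aa T a)"
  shows "(\<alpha> = 0 \<longrightarrow> C_const \<gamma> \<alpha> = 3 * sqrt 3 / \<gamma>\<^sup>2) \<and>
    filterlim (C_const \<gamma>) at_top at_top \<and>
    (\<forall>g\<in>dual_space T a. \<forall>u0 l u. mixed_solution T j a g u0 l u \<longrightarrow>
       (AE t in lebesgue_on {0<..<T}. l t = u t) \<and>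
       (\<forall>\<delta>\<in>\<Delta>. \<forall>ld ud. galerkin_solution T j a g u0 (Yd \<delta>) (Xd \<delta>) ld ud \<longrightarrow>
          norm_YX T j a (\<lambda>t. l t - ld t) (\<lambda>t. u t - ud t)
          \<le> C_const \<gamma> \<alpha> *
            (INF (lb, ub) \<in> Yd \<delta> \<times> Xd \<delta>.
               norm_YX T j a (\<lambda>t. l t - lb t) (\<lambda>t. u t - ub t))))"
proof -
  interpret parabolic j T a
    by (intro parabolic.intro evolution_space.intro hilbert_embedding.intro evolution_space_axioms.intro
        parabolic_axioms.intro) (use assms(1-3) in \<open>auto simp: gelfand_embedding_def\<close>)
  have Yd: "Yd \<delta> \<subseteq> Y" and Xd: "Xd \<delta> \<subseteq> X" if "\<delta> \<in> \<Delta>" for \<delta>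
    using assms(5,6)[OF that] by (auto simp: closed_subspace_def)
  note bounds = inf_sup_bounds[OF assms(4) Yd Xd assms(7,8)]
  have \<gamma>: "0 < \<gamma>" "\<gamma> \<le> 1" by (rule bounds; assumption)+
  have C1: "1 \<le> C_const \<gamma> \<alpha>"
    using C_const_ge[OF \<gamma>, of \<alpha>] op_norm_nonneg by (simp add: assms(9))
  show ?thesis
  proof (intro conjI ballI allI impI)
    show "C_const \<gamma> \<alpha> = 3 * sqrt 3 / \<gamma>\<^sup>2" if "\<alpha> = 0"
      using that by (simp add: C_const_def rho_root_0[OF \<gamma>])
    show "filterlim (C_const \<gamma>) at_top at_top" by (rule C_const_at_top[OF \<gamma>])
    fix g u0 l u assume sol: "mixed_solution T j a g u0 l u"
    show "AE t in lebesgue_on {0<..<T}. l t = u t" by (rule mixed_solution_multiplier[OF sol])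
    fix \<delta> ld ud assume d: "\<delta> \<in> \<Delta>" and gal: "galerkin_solution T j a g u0 (Yd \<delta>) (Xd \<delta>) ld ud"
    let ?E = "norm_YX T j a (\<lambda>t. l t - ld t) (\<lambda>t. u t - ud t)"
    have infsup: "\<gamma> * dtn u \<le> S"
      if "u \<in> Xd \<delta>" "0 \<le> S" "\<And>v. v \<in> Yd \<delta> \<Longrightarrow> \<bar>dt T j a u v\<bar> \<le> S * normY T a v" for u S
      by (rule bounds(3)[OF _ _ d that]; assumption)
    have "?E / C_const \<gamma> \<alpha> \<le> (INF (lb, ub) \<in> Yd \<delta> \<times> Xd \<delta>. norm_YX T j a (\<lambda>t. l t - lb t) (\<lambda>t. u t - ub t))"
    proof (rule cINF_greatest)
      show "Yd \<delta> \<times> Xd \<delta> \<noteq> {}" using gal by (auto simp: galerkin_solution_def)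
      fix x assume "x \<in> Yd \<delta> \<times> Xd \<delta>"
      then obtain lb ub where x: "x = (lb, ub)" "lb \<in> Yd \<delta>" "ub \<in> Xd \<delta>" by blast
      have "?E \<le> C_const \<gamma> \<alpha> * norm_YX T j a (\<lambda>t. l t - lb t) (\<lambda>t. u t - ub t)"
        by (rule galerkin_quasi_optimal[OF assms(5)[OF d] assms(6)[OF d] \<gamma> assms(9) infsup sol gal x(2,3)])
      then show "?E / C_const \<gamma> \<alpha> \<le> (case x of (lb, ub) \<Rightarrow> norm_YX T j a (\<lambda>t. l t - lb t) (\<lambda>t. u t - ub t))"
        using C1 by (simp add: x(1) pos_divide_le_eq mult.commute)
    qed
    then show "?E \<le> C_const \<gamma> \<alpha> * (INF (lb, ub) \<in> Yd \<delta> \<times> Xd \<delta>. norm_YX T j a (\<lambda>t. l t - lb t) (\<lambda>t. u t - ub t))"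
      using C1 by (simp add: pos_divide_le_eq mult.commute)
  qed
qed

end
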